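(* Let $g:\mathbb{R}^d\to\mathbb{R}^d$ and suppose that $h(x):=x-g(x)$ satisfies Assumption (H) stated in the context, with associated point $x^*$ and constants $\hat\rho,\hat\kappa,\mu,L>0$. Let $\{x_k\}$ and $\{r_k\}$ denote the iterates and residuals of the restarted Anderson mixing method (Type-I or Type-II) described in the context, let $A:=I-g'(x^* )$, $\theta_k:=\|I-\beta_kA\|_2$, and let $\eta_0>0$ be a constant. Assume $\beta_j\in[\beta,\beta']$ for all $j\ge 0$, for some positive constants $\beta,\beta'$. Then the following hold. 1. For the Type-I method, let $\pi_k$ be the orthogonal projector onto $\mathcal{K}_{m_k}(A,r_{k-m_k})$, let $A_k:=\pi_kA\pi_k$, and let $A_k|_{\mathcal{K}_{m_k}(A,r_{k-m_k})}$ be the restriction of $A_k$ to $\mathcal{K}_{m_k}(A,r_{k-m_k})$. If $\|r_j\|_2\le\eta_0\|r_0\|_2$ for $0\le j\le k$ and $x_0$ is sufficiently close to $x^*$, then $$\|x_{k+1}-x^*\|_2\le\theta_k\sqrt{1+\gamma_k^2\kappa_k^2}\,\min_{p\in\mathcal{P}_{m_k},\,p(0)=1}\|p(A)(x_{k-m_k}-x^* )\|_2+\hat\kappa\,\mathcal{O}(\|x_{k-m_k}-x^*\|_2^2),$$ where $\gamma_k=\|\pi_kA(I-\pi_k)\|_2\le L$ and $\kappa_k=\|(A_k|_{\mathcal{K}_{m_k}(A,r_{k-m_k})})^{-1}\|_2\le 1/\mu$. 2. For the Type-II method, if $\|r_j\|_2\le\eta_0\|r_0\|_2$ for $0\le j\le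 k+1$ and $x_0$ is sufficiently close to $x^*$, then $$\|r_{k+1}\|_2\le\theta_k\min_{p\in\mathcal{P}_{m_k},\,p(0)=1}\|p(A)r_{k-m_k}\|_2+\hat\kappa\,\mathcal{O}(\|x_{k-m_k}-x^*\|_2^2).\qquad( * )$$ Alternatively, letting $\theta\in\bigl[(1-\mu^2/L^2)^{1/2},1\bigr)$ be a constant, if $\theta_j=\|I-\beta_jA\|_2\le\theta$ for all $j\ge0$ and $x_0$ is sufficiently close to $x^*$, then $( * )$ holds. 3. For either method, if the corresponding assumptions above (those of part 1 for Type-I, either set of assumptions of part 2 for Type-II) hold and $m_k=d$, then $\|x_{k+1}-x^*\|_2=\hat\kappa\,\mathcal{O}(\|x_{k-m_k}-x^*\|_2^2)$, i.e. $(d+1)$-step quadratic convergence.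
   Context: Notation. $\mathcal{K}_k(A,v)=\mathrm{span}\{v,Av,\dots,A^{k-1}v\}$; $\mathcal{P}_k$ is the space of polynomials of degree at most $k$; $\mathcal{S}(B)=(B+B^{\mathrm T})/2$; $h'$ is the Jacobian of $h$. A (not necessarily symmetric) real square matrix $B$ is called positive definite if all eigenvalues of $\mathcal{S}(B)$ are positive. Assumption (H) on $h(x)=x-g(x)$: (i) there exists $x^*$ with $h(x^* )=0$; (ii) $h$ is Lipschitz continuously differentiable in a neighbourhood of $x^*$; (iii) $h'(x^* )$ is positive definite. Consequently there are positive constants $\hat\rho,\hat\kappa,\mu,L$, which are fixed, such that for all $x\in\mathcal{B}_{\hat\rho}(x^* ):=\{z\in\mathbb{R}^d:\|z-x^*\|_2\le\hat\rho\}$ and all $y\in\mathbb{R}^d$: $\mu\|y\|_2\le\|h'(x)y\|_2\le L\|y\|_2$; $\mu\|y\|_2^2\le y^{\mathrm T}h'(x)y\le L\|y\|_2^2$; $\|h(x)-h'(x^* )(x-x^* )\|_2\le\frac12\hat\kappa\|x-x^*\|_2^2$. Restarted Anderson mixing. Inputs: $x_0\in\mathbb{R}^d$, mixing parameters $\beta_k$, an integer $m$ with $0<m\le d$, $\tau\in(0,1)$, $\eta>0$. Put $v_j:=p_j$ for the Type-I method and $v_j:=q_j$ for the Type-II method. Set $m_0=0$. For $k=0,1,\dots$ until convergence (i.e. as long as $r_k\ne0$): (1) $r_k:=g(x_k)-x_k$. If $m_k>m$ or $\|r_k\|_2>\eta\|r_{k-m_k}\|_2$, reset $m_k:=0$.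 (2) If $m_k>0$: set $p_k:=x_k-x_{k-1}$, $q_k:=r_k-r_{k-1}$; for $j=1,\dots,m_k-1$ successively set $\zeta_k^{(j)}:=\frac{v_{k-m_k+j}^{\mathrm T}q_k}{v_{k-m_k+j}^{\mathrm T}q_{k-m_k+j}}$ and replace $p_k$ by $p_k-p_{k-m_k+j}\zeta_k^{(j)}$ and $q_k$ by $q_k-q_{k-m_k+j}\zeta_k^{(j)}$. Then, if $|v_k^{\mathrm T}q_k|<\tau|v_{k-m_k+1}^{\mathrm T}q_{k-m_k+1}|$, reset $m_k:=0$. (3) Set $\bar x_k:=x_k$, $\bar r_k:=r_k$; for $j=1,\dots,m_k$ successively set $\Gamma_k^{(j)}:=\frac{v_{k-m_k+j}^{\mathrm T}\bar r_k}{v_{k-m_k+j}^{\mathrm T}q_{k-m_k+j}}$ and replace $\bar x_k$ by $\bar x_k-p_{k-m_k+j}\Gamma_k^{(j)}$ and $\bar r_k$ by $\bar r_k-q_{k-m_k+j}\Gamma_k^{(j)}$. (4) $x_{k+1}:=\bar x_k+\beta_k\bar r_k$, $m_{k+1}:=m_k+1$ (possibly reset to $0$ in iteration $k+1$). In statements, $m_k$ denotes the final value in iteration $k$ (after possible resets), so $k-m_k$ is the index of the most recent restart. Convention. "If $x_0$ is sufficiently close to $x^*$, then ... $\hat\kappa\,\mathcal{O}(t)$" means: there are $\varepsilon>0$ and $C>0$, depending on $g$, $x^*$, the fixed constants and the method parameters ($m,\tau,\eta,\beta,\beta',\eta_0,\theta$) but not on $x_0$ or $k$, such that whenever $\|x_0-x^*\|_2\le\varepsilon$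 the assertion holds with $\hat\kappa\,\mathcal{O}(t)$ standing for a quantity bounded in absolute value by $\hat\kappa Ct$. *)

theory Defs
  imports "HOL-Analysis.Analysis" "HOL-Computational_Algebra.Polynomial"
begin

text \<open>The Euclidean space of dimension \<open>d\<close> is \<^typ>\<open>real^'n\<close> with \<open>d = CARD('n)\<close>.\<close>

section \<open>Matrices\<close>

definition spectral_norm :: "real^'n^'n \<Rightarrow> real" where
  "spectral_norm B = onorm ((*v) B)"

definition sym_part :: "real^'n^'n \<Rightarrow> real^'n^'n" where
  "sym_part B = (1 / 2) *\<^sub>R (B + transpose B)"

text \<open>All eigenvalues of the symmetric part are positive. As that matrix is real symmetric,
  its eigenvalues are real and have real eigenvectors.\<close>

definition pos_def_mat :: "real^'n^'n \<Rightarrow> bool" where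
  "pos_def_mat B \<longleftrightarrow>
     (\<forall>c v. v \<noteq> 0 \<and> sym_part B *v v = c *\<^sub>R v \<longrightarrow> c > 0)"

definition mat_pow :: "real^'n^'n \<Rightarrow> nat \<Rightarrow> real^'n^'n" where
  "mat_pow B i = (((**) B) ^^ i) (mat 1)"

definition poly_mat :: "real poly \<Rightarrow> real^'n^'n \<Rightarrow> real^'n^'n" where
  "poly_mat p B = (\<Sum>i\<le>degree p. coeff p i *\<^sub>R mat_pow B i)"

definition krylov :: "real^'n^'n \<Rightarrow> nat \<Rightarrow> real^'n \<Rightarrow> (real^'n) set" where
  "krylov B k v = span {mat_pow B i *v v | i. i < k}"

text \<open>The infimum below is a minimum, see \<open>krylov_min_attained\<close>.\<close>

definition krylov_min :: "real^'n^'n \<Rightarrow> nat \<Rightarrow> real^'n \<Rightarrow> real" where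
  "krylov_min B k v = (INF p \<in> {p. degree p \<le> k \<and> poly p 0 = 1}. norm (poly_mat p B *v v))"

definition orth_projector :: "(real^'n) set \<Rightarrow> real^'n^'n" where
  "orth_projector K = matrix (\<lambda>x. THE y. y \<in> K \<and> (\<forall>z\<in>K. orthogonal (x - y) z))"

text \<open>The operator norm of a map defined on a subspace \<open>K\<close>; \<^term>\<open>onorm f\<close> is the case
  \<open>K = UNIV\<close>. The value is 0 if \<open>K\<close> is the zero space.\<close>

definition onorm_on :: "(real^'n) set \<Rightarrow> (real^'n \<Rightarrow> real^'n) \<Rightarrow> real" where
  "onorm_on K f = (SUP x\<in>K. norm (f x) / norm x)"

lemma orth_projector_works:
  fixes K :: "(real^'n) set"
  assumes K: "subspace K"
  shows "orth_projector K *v x \<in> K" "\<forall>z\<in>K. orthogonal (x - orth_projector K *v x) z"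
proof -
  define f where "f x = (THE y. y \<in> K \<and> (\<forall>z\<in>K. orthogonal (x - y) z))" for x :: "real^'n"
  have uniq: "y = y'" if "y \<in> K" "y' \<in> K" "\<forall>z\<in>K. orthogonal (x - y) z"
    "\<forall>z\<in>K. orthogonal (x - y') z" for x y y' :: "real^'n"
  proof -
    have "y - y' \<in> K" using that K by (simp add: subspace_diff)
    with that have "inner (x - y') (y - y') - inner (x - y) (y - y') = 0"
      by (simp add: orthogonal_def)
    then have "inner (y - y') (y - y') = 0" by (simp add: inner_diff_left)
    then show ?thesis by simp
  qed
  have ex: "\<exists>y. y \<in> K \<and> (\<forall>z\<in>K. orthogonal (x - y) z)" for x :: "real^'n"
  proof -
    obtain y z where "y \<in> span K" "\<And>w. w \<in> span K \<Longrightarrow> orthogonal z w" "x = y + z"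
      using orthogonal_subspace_decomp_exists[of K x] by blast
    then show ?thesis using K by (metis add_diff_cancel_left' span_eq_iff)
  qed
  have f: "f x \<in> K \<and> (\<forall>z\<in>K. orthogonal (x - f x) z)" for x
    unfolding f_def by (rule theI') (use ex uniq in blast)
  have "linear f"
  proof (rule linearI)
    fix a b :: "real^'n" and c :: real
    have add: "f a + f b \<in> K" "c *\<^sub>R f a \<in> K"
      using f K by (blast intro: subspace_add subspace_scale)+
    have "orthogonal (a + b - (f a + f b)) z" if "z \<in> K" for z
      using f[of a] f[of b] that unfolding orthogonal_def by (simp add: inner_diff_left inner_add_left)
    then show "f (a + b) = f a + f b" using uniq f add(1) by blast
    have "orthogonal (c *\<^sub>R a - c *\<^sub>R f a) z" if "z \<in> K" for z
      using f[of a] that unfolding orthogonal_def by (simp add: inner_diff_left)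
    then show "f (c *\<^sub>R a) = c *\<^sub>R f a" using uniq f add(2) by blast
  qed
  then have "orth_projector K *v x = f x"
    unfolding orth_projector_def f_def[symmetric] by (simp add: matrix_works)
  with f show "orth_projector K *v x \<in> K" "\<forall>z\<in>K. orthogonal (x - orth_projector K *v x) z"
    by auto
qed

lemma poly_mat_extend:
  assumes "degree p \<le> k"
  shows "poly_mat p B = (\<Sum>i\<le>k. coeff p i *\<^sub>R mat_pow B i)"
  unfolding poly_mat_def using assms
  by (intro sum.mono_neutral_left) (auto simp: coeff_eq_0)

lemma krylov_min_attained:
  fixes B :: "real^'n^'n"
  shows "\<exists>p. degree p \<le> k \<and> poly p 0 = 1 \<and> krylov_min B k v = norm (poly_mat p B *v v)"
proof -
  define P where "P = {p :: real poly. degree p \<le> k \<and> poly p 0 = 1}"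
  define ev where "ev p = poly_mat p B *v v" for p
  have one: "1 \<in> P" by (simp add: P_def)
  have comb: "ev (smult a p + smult b q) = a *\<^sub>R ev p + b *\<^sub>R ev q"
    if "p \<in> P" "q \<in> P" for a b p q
  proof -
    have d: "degree p \<le> k" "degree q \<le> k" using that by (auto simp: P_def)
    then have d': "degree (smult a p + smult b q) \<le> k"
      by (meson degree_add_le degree_smult_le order_trans)
    have "poly_mat (smult a p + smult b q) B = a *\<^sub>R poly_mat p B + b *\<^sub>R poly_mat q B"
      unfolding poly_mat_extend[OF d(1)] poly_mat_extend[OF d(2)] poly_mat_extend[OF d']
      by (simp add: sum.distrib scaleR_sum_right scaleR_add_left)
    then show ?thesis
      by (simp add: ev_def matrix_vector_mult_add_rdistrib scaleR_matrix_vector_assoc)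
  qed
  have "affine (ev ` P)"
    unfolding affine_def
  proof (intro ballI allI impI)
    fix y z a b assume "y \<in> ev ` P" "z \<in> ev ` P" and ab: "a + b = (1 :: real)"
    then obtain p q where pq: "p \<in> P" "q \<in> P" "y = ev p" "z = ev q" by blast
    have "degree p \<le> k" "degree q \<le> k" using pq by (auto simp: P_def)
    then have "degree (smult a p + smult b q) \<le> k"
      by (meson degree_add_le degree_smult_le order_trans)
    then have "smult a p + smult b q \<in> P" using pq ab by (simp add: P_def)
    then show "a *\<^sub>R y + b *\<^sub>R z \<in> ev ` P" using comb[OF pq(1,2)] pq by (metis imageI)
  qed
  then have "closed (ev ` P)" by (rule affine_closed)
  then obtain y where y: "y \<in> ev ` P" "\<And>z. z \<in> ev ` P \<Longrightarrow> dist 0 y \<le> dist 0 z"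
    using distance_attains_inf[of "ev ` P" 0] one by blast
  then obtain p where p: "p \<in> P" "y = ev p" by blast
  have "(INF q\<in>P. norm (ev q)) = norm (ev p)"
    by (rule cInf_eq_minimum) (use p y in auto)
  with p show ?thesis unfolding krylov_min_def P_def ev_def by auto
qed


section \<open>The assumption on \<open>h\<close>\<close>

text \<open>The Lipschitz condition on the Jacobian is with respect to the library norm (Frobenius) on
  matrices. All norms being equivalent in finite dimension, the choice affects only the
  Lipschitz constant.\<close>

definition assumption_H :: "(real^'n \<Rightarrow> real^'n) \<Rightarrow> real^'n \<Rightarrow> bool" where
  "assumption_H h xs \<longleftrightarrow>
     h xs = 0 \<and>
     (\<exists>U M. open U \<and> xs \<in> U \<and> h differentiable_on U \<and>
            M-lipschitz_on U (\<lambda>x. jacobian h (at x))) \<and>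
     pos_def_mat (jacobian h (at xs))"

definition constants_H ::
    "(real^'n \<Rightarrow> real^'n) \<Rightarrow> real^'n \<Rightarrow> real \<Rightarrow> real \<Rightarrow> real \<Rightarrow> real \<Rightarrow> bool" where
  "constants_H h xs \<rho> \<kappa> \<mu> L \<longleftrightarrow>
     \<rho> > 0 \<and> \<kappa> > 0 \<and> \<mu> > 0 \<and> L > 0 \<and>
     (\<forall>x\<in>cball xs \<rho>. \<forall>y.
        \<mu> * norm y \<le> norm (jacobian h (at x) *v y) \<and>
        norm (jacobian h (at x) *v y) \<le> L * norm y \<and>
        \<mu> * (norm y)\<^sup>2 \<le> inner y (jacobian h (at x) *v y) \<and>
        inner y (jacobian h (at x) *v y) \<le> L * (norm y)\<^sup>2 \<and>
        norm (h x - jacobian h (at xs) *v (x - xs)) \<le> \<kappa> / 2 * (norm (x - xs))\<^sup>2)"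


section \<open>Restarted Anderson mixing\<close>

datatype am_type = Type_I | Type_II

text \<open>The inner loops of steps (2) and (3) both have this form. With \<open>s\<close> the index of the most
  recent restart, for \<open>j = 1, \<dots>, n\<close> the pair \<open>(y, z)\<close> is successively replaced by
  \<open>(y - c p\<^bsub>s+j\<^esub>, z - c q\<^bsub>s+j\<^esub>)\<close> where
  \<open>c = v\<^bsub>s+j\<^esub>\<^sup>T z / v\<^bsub>s+j\<^esub>\<^sup>T q\<^bsub>s+j\<^esub>\<close>.\<close>

primrec am_sweep :: "(nat \<Rightarrow> real^'n) \<Rightarrow> (nat \<Rightarrow> real^'n) \<Rightarrow> (nat \<Rightarrow> real^'n) \<Rightarrow> nat \<Rightarrow>
    nat \<Rightarrow> (real^'n) \<times> (real^'n) \<Rightarrow> (real^'n) \<times> (real^'n)" where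
  "am_sweep v p q s 0 yz = yz"
| "am_sweep v p q s (Suc n) yz =
     (let (y, z) = am_sweep v p q s n yz;
          i = s + Suc n;
          c = inner (v i) z / inner (v i) (q i)
      in (y - c *\<^sub>R p i, z - c *\<^sub>R q i))"

text \<open>\<open>restarted_AM ty g m \<tau> \<eta> \<beta> x r p q mm\<close>: the sequences are generated by the method from the
  initial point \<open>x 0\<close>. Here \<open>p k\<close>, \<open>q k\<close> are the final values of \<open>p\<^sub>k\<close>, \<open>q\<^sub>k\<close> in iteration \<open>k\<close>, and
  \<open>mm k\<close> is the final value of \<open>m\<^sub>k\<close>; \<open>m0\<close> and \<open>m1\<close> are its values before and after the reset
  of step (1). The method stops at the first vanishing residual; entries that it does not
  compute are left unconstrained.\<close>

definition restarted_AM ::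
    "am_type \<Rightarrow> (real^'n \<Rightarrow> real^'n) \<Rightarrow> nat \<Rightarrow> real \<Rightarrow> real \<Rightarrow> (nat \<Rightarrow> real) \<Rightarrow>
     (nat \<Rightarrow> real^'n) \<Rightarrow> (nat \<Rightarrow> real^'n) \<Rightarrow> (nat \<Rightarrow> real^'n) \<Rightarrow> (nat \<Rightarrow> real^'n) \<Rightarrow>
     (nat \<Rightarrow> nat) \<Rightarrow> bool" where
  "restarted_AM ty g m \<tau> \<eta> \<beta> x r p q mm \<longleftrightarrow>
     (let v = (case ty of Type_I \<Rightarrow> p | Type_II \<Rightarrow> q) in
      (\<forall>k. r k = g (x k) - x k) \<and>
      (\<forall>k. (\<forall>j\<le>k. r j \<noteq> 0) \<longrightarrow>
        (let m0 = (if k = 0 then 0 else mm (k - 1) + 1);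
             m1 = (if m0 > m \<or> norm (r k) > \<eta> * norm (r (k - m0)) then 0 else m0)
         in
           (m1 > 0 \<longrightarrow>
              (p k, q k) = am_sweep v p q (k - m1) (m1 - 1) (x k - x (k - 1), r k - r (k - 1))) \<and>
           mm k = (if m1 > 0 \<and> \<bar>inner (v k) (q k)\<bar>
                       < \<tau> * \<bar>inner (v (k - m1 + 1)) (q (k - m1 + 1))\<bar>
                   then 0 else m1) \<and>
           (let (xbar, rbar) = am_sweep v p q (k - mm k) (mm k) (x k, r k)
            in x (Suc k) = xbar + \<beta> k *\<^sub>R rbar))))"

end

theory Submission
  imports Defs
begin

text \<open>Write \<open>s\<close> for the index of the last restart, \<open>n\<close> for the number of directions built since then,
  \<open>e\<^sub>j = x\<^sub>j - x\<^sup>*\<close> and \<open>E = \<parallel>e\<^sub>s\<parallel>\<close>. If \<open>g\<close> is affine, a block of the method is a Krylov method for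
  \<open>A e = 0\<close>: the directions span \<open>K = span {r\<^sub>s, A r\<^sub>s, \<dots>, A\<^bsup>n-1\<^esup> r\<^sub>s}\<close>, and the second sweep makes
  the mixed residual \<open>rbar\<close> orthogonal to \<open>K\<close> (Type I, a Galerkin method) or to \<open>A K\<close> (Type II, a
  minimal residual method). In general the orthogonality relations between the directions still hold
  exactly, and only the relations \<open>r = -A e\<close> and \<open>q = -A p\<close> are perturbed, by \<open>O(E\<^sup>2)\<close>.

  The perturbations do not get amplified, because of the test against \<open>\<tau>\<close>. The first direction is
  \<open>\<beta>\<^sub>s r\<^sub>s\<close>, so \<open>\<bar>v\<^sup>T q\<bar> \<ge> c E\<^sup>2\<close> for its denominator, and the test passes this bound on to all
  directions that the block keeps (\<open>denominator_lower\<close>). Hence all coefficients of the sweeps are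
  \<open>O(1)\<close>, all directions are \<open>O(E)\<close>, and the \<open>j\<close>-th direction lies within \<open>O(E\<^sup>2)\<close> of the \<open>j\<close>-th
  Krylov space. The triangular relations \<open>v\<^sub>i\<^sup>T q\<^sub>j = 0\<close> for \<open>i < j\<close> bound the coefficients of a
  combination of directions by its length (\<open>triangular_coefficient_bound\<close>). So the Krylov elements
  next to the \<open>n\<close> directions are linearly independent, they span the whole Krylov space, and an
  element of length \<open>O(E)\<close> in it is a combination of directions up to \<open>O(E\<^sup>2)\<close>
  (\<open>krylov_approximation\<close>). This argument replaces a comparison with the iterates of the affine
  problem, and it is insensitive to the coefficients of the optimal polynomial, which may be
  arbitrarily large.

  For Type II, \<open>rbar\<close> has minimal norm in \<open>r\<^sub>s + span {q\<^sub>1, \<dots>, q\<^sub>n}\<close>, a set that contains a vector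
  within \<open>O(E\<^sup>2)\<close> of the optimal \<open>p(A) r\<^sub>s\<close>. For Type I, the projection of \<open>rbar\<close> to the Krylov
  space is \<open>O(E\<^sup>2)\<close>, and the usual estimate for oblique projections (\<open>oblique_projection_bound\<close>)
  applies up to that order. If \<open>n\<close> is the dimension of the space, \<open>n\<close> independent conditions force
  \<open>rbar = 0\<close>. The last step \<open>x\<^sub>k\<^sub>+\<^sub>1 = xbar + \<beta>\<^sub>k rbar\<close> contributes the factor \<open>\<theta>\<^sub>k\<close>.

  Finally, the estimate for one block gives \<open>\<parallel>e\<^sub>k\<^sub>+\<^sub>1\<parallel> = O(E)\<close>, which together with the bound on the
  residuals keeps the whole trajectory in the region where the estimate is valid
  (\<open>trajectory_estimate\<close>). Under a uniform contraction the bound on the residuals follows from the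
  estimate itself (\<open>contractive_trajectory\<close>).\<close>

section \<open>Krylov spaces and orthogonal projectors\<close>

lemma mat_pow_Suc: "mat_pow B (Suc i) = B ** mat_pow B i"
  by (simp add: mat_pow_def)

lemma mat_pow_0: "mat_pow B 0 = mat 1"
  by (simp add: mat_pow_def)

lemma mat_pow_mult_vector: "mat_pow B i *v (B *v v) = B *v (mat_pow B i *v v)"
  by (induction i) (simp_all add: mat_pow_Suc mat_pow_0 matrix_vector_mul_assoc[symmetric])

lemma subspace_krylov: "subspace (krylov B k v)"
  by (simp add: krylov_def)

lemma krylov_mono: "j \<le> k \<Longrightarrow> krylov B j v \<subseteq> krylov B k v"
  unfolding krylov_def by (intro span_mono) auto

lemma krylov_start: "v \<in> krylov B (Suc k) v"
  unfolding krylov_def by (intro span_base) (auto intro!: exI[of _ 0] simp: mat_pow_0)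

lemma mult_krylov:
  assumes "u \<in> krylov B k v"
  shows "B *v u \<in> krylov B (Suc k) v"
proof -
  have "(*v) B ` span {mat_pow B i *v v | i. i < k} = span ((*v) B ` {mat_pow B i *v v | i. i < k})"
    by (simp add: linear_span_image)
  also have "\<dots> \<subseteq> krylov B (Suc k) v"
    unfolding krylov_def
    by (intro span_mono) (force simp: mat_pow_Suc matrix_vector_mul_assoc)
  finally show ?thesis using assms unfolding krylov_def by auto
qed

lemma mult_krylov_shift:
  assumes "u \<in> krylov B k v"
  shows "B *v u \<in> krylov B k (B *v v)"
proof -
  have "(*v) B ` span {mat_pow B i *v v | i. i < k} = span ((*v) B ` {mat_pow B i *v v | i. i < k})"
    by (simp add: linear_span_image)
  also have "\<dots> \<subseteq> krylov B k (B *v v)"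
    unfolding krylov_def
    by (intro span_mono) (force simp: mat_pow_mult_vector)
  finally show ?thesis using assms unfolding krylov_def by auto
qed

lemma dim_krylov_le: "dim (krylov B k v) \<le> k"
proof -
  have "{mat_pow B i *v v | i. i < k} = (\<lambda>i. mat_pow B i *v v) ` {..<k}" by auto
  then have "dim (krylov B k v) \<le> card ((\<lambda>i. mat_pow B i *v v) ` {..<k})"
    unfolding krylov_def by (simp add: dim_le_card')
  also have "\<dots> \<le> k" using card_image_le[of "{..<k}"] by force
  finally show ?thesis .
qed

text \<open>The constraint \<open>p(0) = 1\<close> splits off \<open>v\<close>; the remaining terms have a factor \<open>B\<close>. So minimizing
  over the polynomials is minimizing over \<open>v + B K\<close> with \<open>K\<close> the Krylov space.\<close>

lemma poly_mat_mult_vector_eq: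
  assumes "degree p \<le> k" "poly p 0 = 1"
  obtains u where "u \<in> krylov B k v" "poly_mat p B *v v = v + B *v u"
proof
  define u where "u = (\<Sum>i<k. coeff p (Suc i) *\<^sub>R (mat_pow B i *v v))"
  show "u \<in> krylov B k v"
    unfolding u_def krylov_def by (intro span_sum span_scale span_base) auto
  have "poly_mat p B *v v = (\<Sum>i\<le>k. coeff p i *\<^sub>R (mat_pow B i *v v))"
    unfolding poly_mat_extend[OF assms(1)]
    by (simp add: vec_eq_iff matrix_vector_mult_def sum_distrib_left sum_distrib_right
        sum.swap[of _ _ UNIV] mult.assoc)
  also have "\<dots> = coeff p 0 *\<^sub>R v + (\<Sum>i<k. coeff p (Suc i) *\<^sub>R (mat_pow B (Suc i) *v v))"
    by (simp add: sum.atMost_shift mat_pow_0)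
  also have "(\<Sum>i<k. coeff p (Suc i) *\<^sub>R (mat_pow B (Suc i) *v v)) = B *v u"
    by (simp add: u_def linear_sum[of "(*v) B"] mat_pow_Suc matrix_vector_mul_assoc
        matrix_vector_mult_scaleR)
  also have "coeff p 0 = 1" using assms(2) by (simp add: poly_0_coeff_0)
  finally show "poly_mat p B *v v = v + B *v u" by simp
qed

lemma krylov_min_le_norm: "krylov_min B k v \<le> norm v"
proof -
  have "krylov_min B k v \<le> norm (poly_mat 1 B *v v)"
    unfolding krylov_min_def
    by (rule cINF_lower) (auto intro!: bdd_belowI[of _ 0])
  then show ?thesis by (simp add: poly_mat_def mat_pow_0)
qed

lemma krylov_min_nonneg: "0 \<le> krylov_min B k v"
  using krylov_min_attained[of k B v] by force

lemma krylov_min_realized: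
  obtains u where "u \<in> krylov B k v" "norm (v + B *v u) = krylov_min B k v"
  by (metis krylov_min_attained poly_mat_mult_vector_eq)

lemma family_spans_subspace:
  fixes u :: "nat \<Rightarrow> 'a::euclidean_space"
  assumes u: "\<And>i. i < n \<Longrightarrow> u i \<in> K" and dim: "dim K \<le> n"
    and indep: "\<And>a. (\<Sum>i<n. a i *\<^sub>R u i) = 0 \<Longrightarrow> \<forall>i<n. a i = 0"
    and z: "z \<in> K"
  obtains a where "z = (\<Sum>i<n. a i *\<^sub>R u i)"
proof -
  have inj: "inj_on u {..<n}"
  proof (rule inj_onI, rule ccontr)
    fix i j assume ij: "i \<in> {..<n}" "j \<in> {..<n}" "u i = u j" "i \<noteq> j"
    define a where "a l = (if l = i then 1 else 0) - (if l = j then 1 else (0::real))" for l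
    have "(\<Sum>l<n. a l *\<^sub>R u l) = 0"
      using ij by (simp add: a_def scaleR_left_diff_distrib sum_subtractf if_distrib[of "\<lambda>t. t *\<^sub>R _"]
          if_distribR cong: if_cong)
    then have "a i = 0" using indep ij by auto
    then show False using ij by (simp add: a_def)
  qed
  have ind: "independent (u ` {..<n})"
  proof (rule independent_if_scalars_zero)
    fix f x assume s: "(\<Sum>x\<in>u ` {..<n}. f x *\<^sub>R x) = 0" and x: "x \<in> u ` {..<n}"
    have "(\<Sum>i<n. f (u i) *\<^sub>R u i) = 0"
      using s by (simp add: sum.reindex[OF inj])
    with indep x show "f x = 0" by fast
  qed simp
  have "K \<subseteq> span (u ` {..<n})"
    by (rule card_ge_dim_independent) (use u ind dim in \<open>auto simp: card_image[OF inj]\<close>)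
  with z have "z \<in> span (u ` {..<n})" by blast
  then obtain f where "z = (\<Sum>x\<in>u ` {..<n}. f x *\<^sub>R x)"
    by (auto simp: span_finite)
  then have "z = (\<Sum>i<n. f (u i) *\<^sub>R u i)" by (simp add: sum.reindex[OF inj])
  then show ?thesis by (rule that[of "f \<circ> u", simplified])
qed

lemma norm_mult_spectral_norm: "norm (B *v v) \<le> spectral_norm B * norm v"
  unfolding spectral_norm_def by (intro onorm matrix_vector_mul_bounded_linear)

lemma spectral_norm_nonneg: "0 \<le> spectral_norm B"
  unfolding spectral_norm_def by (intro onorm_pos_le matrix_vector_mul_bounded_linear)

lemma spectral_norm_le: "(\<And>v. norm (B *v v) \<le> b * norm v) \<Longrightarrow> spectral_norm B \<le> b"
  unfolding spectral_norm_def by (rule onorm_le)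

lemma inner_mult_ge_imp_norm_ge:
  fixes A :: "real^'n^'n"
  assumes "\<And>y. \<mu> * (norm y)\<^sup>2 \<le> inner y (A *v y)"
  shows "\<mu> * norm y \<le> norm (A *v y)"
proof (cases "y = 0")
  case False
  have "norm y * (\<mu> * norm y) \<le> norm y * norm (A *v y)"
    using assms[of y] norm_cauchy_schwarz[of y "A *v y"] by (simp add: power2_eq_square algebra_simps)
  with False show ?thesis by simp
qed simp

context
  fixes K :: "(real^'n) set"
  assumes K: "subspace K"
begin

lemma orth_projector_in: "orth_projector K *v x \<in> K"
  by (rule orth_projector_works(1)[OF K])

lemma inner_orth_projector: "z \<in> K \<Longrightarrow> inner (orth_projector K *v x) z = inner x z"
  using orth_projector_works(2)[OF K, of x] by (simp add: orthogonal_def inner_diff_left)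

lemma orth_projector_eq_self: "x \<in> K \<Longrightarrow> orth_projector K *v x = x"
proof -
  assume "x \<in> K"
  then have "x - orth_projector K *v x \<in> K" by (simp add: K orth_projector_in subspace_diff)
  then have "inner (x - orth_projector K *v x) (x - orth_projector K *v x) = 0"
    by (simp add: inner_diff_left inner_orth_projector)
  then show ?thesis by simp
qed

lemma norm_orth_projector_pythagoras:
  "(norm x)\<^sup>2 = (norm (orth_projector K *v x))\<^sup>2 + (norm (x - orth_projector K *v x))\<^sup>2"
proof -
  have "orthogonal (orth_projector K *v x) (x - orth_projector K *v x)"
    using orth_projector_works(2)[OF K, of x] orth_projector_in by (simp add: orthogonal_commute)
  from norm_add_Pythagorean[OF this] show ?thesis by simp
qed

lemma norm_orth_projector_le: "norm (orth_projector K *v x) \<le> norm x"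
  using norm_orth_projector_pythagoras[of x] by (simp add: power2_le_imp_le)

lemma norm_orth_complement_le: "norm (x - orth_projector K *v x) \<le> norm x"
  using norm_orth_projector_pythagoras[of x] by (simp add: power2_le_imp_le)

lemma spectral_norm_off_diagonal_le:
  assumes "\<And>y. norm (A *v y) \<le> L * norm y" "0 \<le> L"
  shows "spectral_norm (orth_projector K ** A ** (mat 1 - orth_projector K)) \<le> L"
proof (rule spectral_norm_le)
  fix v
  let ?w = "v - orth_projector K *v v"
  have "norm (orth_projector K *v (A *v ?w)) \<le> norm (A *v ?w)" by (rule norm_orth_projector_le)
  also have "\<dots> \<le> L * norm ?w" by (rule assms)
  also have "\<dots> \<le> L * norm v" using assms(2) norm_orth_complement_le by (intro mult_left_mono)
  finally show "norm (orth_projector K ** A ** (mat 1 - orth_projector K) *v v) \<le> L * norm v"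
    by (simp add: matrix_vector_mul_assoc[symmetric] matrix_vector_mult_diff_rdistrib)
qed

text \<open>Coercivity passes to the compression \<open>\<pi>A\<pi>\<close> on \<open>K\<close>, because \<open>y\<^sup>T \<pi>A\<pi> y = y\<^sup>T A y\<close> for
  \<open>y\<close> in \<open>K\<close>.\<close>

lemma compression_coercive:
  assumes "\<And>y. \<mu> * (norm y)\<^sup>2 \<le> inner y (A *v y)" and y: "y \<in> K"
  shows "\<mu> * norm y \<le> norm (orth_projector K ** A ** orth_projector K *v y)"
proof (cases "y = 0")
  case False
  have eq: "orth_projector K ** A ** orth_projector K *v y = orth_projector K *v (A *v y)"
    by (simp add: matrix_vector_mul_assoc[symmetric] orth_projector_eq_self y)
  have "norm y * (\<mu> * norm y) \<le> inner y (A *v y)"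
    using assms(1)[of y] by (simp add: power2_eq_square algebra_simps)
  also have "\<dots> = inner (orth_projector K *v (A *v y)) y"
    using inner_orth_projector[OF y, of "A *v y"] by (simp add: inner_commute)
  also have "\<dots> \<le> norm (orth_projector K *v (A *v y)) * norm y" by (rule norm_cauchy_schwarz)
  finally show ?thesis using False by (simp add: eq mult.commute)
qed simp

lemma compression_bij:
  assumes "0 < \<mu>" "\<And>y. \<mu> * (norm y)\<^sup>2 \<le> inner y (A *v y)"
  shows "bij_betw ((*v) (orth_projector K ** A ** orth_projector K)) K K"
proof -
  let ?f = "(*v) (orth_projector K ** A ** orth_projector K)"
  have lin: "linear ?f" by simp
  have inj: "inj_on ?f K"
  proof (rule inj_onI)
    fix a b assume ab: "a \<in> K" "b \<in> K" "?f a = ?f b"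
    then have "\<mu> * norm (a - b) \<le> norm (?f (a - b))"
      using K by (intro compression_coercive assms) (simp add: subspace_diff)
    with ab assms(1) have "norm (a - b) \<le> 0" by (simp add: matrix_vector_mult_diff_distrib mult_le_0_iff)
    then show "a = b" by simp
  qed
  have sub: "?f ` K \<subseteq> K" by (auto simp: matrix_vector_mul_assoc[symmetric] orth_projector_in)
  have "dim (?f ` K) = dim K"
    using lin inj K by (intro dim_image_eq) (simp_all add: span_eq_iff[THEN iffD2])
  then have "?f ` K = K"
    by (intro subspace_dim_equal) (use lin K sub in \<open>auto intro: linear_subspace_image\<close>)
  with inj show ?thesis by (simp add: bij_betw_def)
qed

lemma compression_inverse_bounds:
  fixes A :: "real^'n^'n"
  assumes "0 < \<mu>" "\<And>y. \<mu> * (norm y)\<^sup>2 \<le> inner y (A *v y)"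
  defines "M \<equiv> orth_projector K ** A ** orth_projector K"
  defines "\<kappa> \<equiv> onorm_on K (inv_into K ((*v) M))"
  shows "0 \<le> \<kappa>" "\<kappa> \<le> 1 / \<mu>" "y \<in> K \<Longrightarrow> norm y \<le> \<kappa> * norm (M *v y)"
proof -
  let ?g = "inv_into K ((*v) M)"
  have bij: "bij_betw ((*v) M) K K" unfolding M_def by (rule compression_bij[OF assms(1,2)])
  have co: "\<mu> * norm y \<le> norm (M *v y)" if "y \<in> K" for y
    unfolding M_def using assms(2) that by (rule compression_coercive)
  have b: "norm (?g x) / norm x \<le> 1 / \<mu>" if "x \<in> K" for x
  proof -
    have "?g x \<in> K" "M *v ?g x = x"
      using bij that by (auto simp: bij_betw_def inv_into_into f_inv_into_f)
    with co[of "?g x"] show ?thesis using assms(1)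
      by (cases "x = 0") (auto simp: field_simps)
  qed
  have bdd: "bdd_above ((\<lambda>x. norm (?g x) / norm x) ` K)" by (rule bdd_aboveI2[OF b])
  have ne: "K \<noteq> {}" using K subspace_0 by blast
  show "\<kappa> \<le> 1 / \<mu>" unfolding \<kappa>_def onorm_on_def using ne b by (rule cSUP_least)
  have up: "norm (?g x) / norm x \<le> \<kappa>" if "x \<in> K" for x
    unfolding \<kappa>_def onorm_on_def using that bdd by (rule cSUP_upper)
  show "0 \<le> \<kappa>" using up[of 0] K by (simp add: subspace_0)
  show "norm y \<le> \<kappa> * norm (M *v y)" if y: "y \<in> K"
  proof (cases "M *v y = 0")
    case True
    then show ?thesis using co[OF y] assms(1) by (simp add: mult_le_0_iff)
  next
    case False
    have "?g (M *v y) = y" using bij y by (simp add: bij_betw_def)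
    moreover have "M *v y \<in> K" using bij y by (auto simp: bij_betw_def)
    ultimately show ?thesis using up[of "M *v y"] False by (simp add: field_simps)
  qed
qed

text \<open>If the projected residual \<open>\<pi>Ae\<close> is \<open>\<delta>\<close>, then \<open>\<pi>A\<pi> e = \<delta> - \<pi>A(I-\<pi>)e\<close>, so the part of
  \<open>e\<close> in \<open>K\<close> is controlled by its part orthogonal to \<open>K\<close>; Pythagoras combines the two.\<close>

lemma oblique_projection_bound:
  fixes A :: "real^'n^'n"
  assumes mu: "0 < \<mu>" "\<And>y. \<mu> * (norm y)\<^sup>2 \<le> inner y (A *v y)"
  defines "\<pi> \<equiv> orth_projector K"
  defines "\<gamma> \<equiv> spectral_norm (\<pi> ** A ** (mat 1 - \<pi>))"
  defines "\<kappa> \<equiv> onorm_on K (inv_into K ((*v) (\<pi> ** A ** \<pi>)))"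
  shows "norm e \<le> sqrt (1 + \<gamma>\<^sup>2 * \<kappa>\<^sup>2) * norm (e - \<pi> *v e) + norm (\<pi> *v (A *v e)) / \<mu>"
proof -
  define a where "a = norm (e - \<pi> *v e)"
  define d where "d = norm (\<pi> *v (A *v e))"
  note kb = compression_inverse_bounds[OF mu, folded \<pi>_def, folded \<kappa>_def]
  have in_K: "\<pi> *v e \<in> K" by (simp add: \<pi>_def orth_projector_in)
  have self: "\<pi> *v (\<pi> *v e) = \<pi> *v e" using in_K by (simp add: \<pi>_def orth_projector_eq_self)
  have "(\<pi> ** A ** \<pi>) *v (\<pi> *v e)
      = \<pi> *v (A *v e) - (\<pi> ** A ** (mat 1 - \<pi>)) *v (e - \<pi> *v e)"
    by (simp add: matrix_vector_mul_assoc[symmetric] matrix_vector_mult_diff_rdistrib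
        matrix_vector_mult_diff_distrib self)
  then have "norm ((\<pi> ** A ** \<pi>) *v (\<pi> *v e)) \<le> d + norm ((\<pi> ** A ** (mat 1 - \<pi>)) *v (e - \<pi> *v e))"
    by (simp add: d_def norm_triangle_ineq4)
  also have "\<dots> \<le> d + \<gamma> * a"
    using norm_mult_spectral_norm by (simp add: \<gamma>_def a_def)
  finally have "norm (\<pi> *v e) \<le> \<kappa> * (d + \<gamma> * a)"
    using kb(3)[OF in_K] kb(1) by (meson mult_left_mono order_trans)
  also have "\<dots> \<le> d / \<mu> + \<kappa> * \<gamma> * a"
    using mult_right_mono[OF kb(2), of d] by (simp add: d_def algebra_simps)
  finally have pe: "norm (\<pi> *v e) \<le> d / \<mu> + \<kappa> * \<gamma> * a" .
  have "norm e = sqrt ((norm (\<pi> *v e))\<^sup>2 + a\<^sup>2)"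
    using norm_orth_projector_pythagoras[of e] unfolding a_def \<pi>_def
    by (metis norm_ge_zero real_sqrt_abs abs_of_nonneg)
  also have "\<dots> \<le> sqrt ((d / \<mu> + \<kappa> * \<gamma> * a)\<^sup>2 + (0 + a)\<^sup>2)"
    using pe by (intro real_sqrt_le_mono add_mono power_mono) (auto simp: a_def)
  also have "\<dots> \<le> sqrt ((d / \<mu>)\<^sup>2 + 0\<^sup>2) + sqrt ((\<kappa> * \<gamma> * a)\<^sup>2 + a\<^sup>2)"
    by (rule real_sqrt_sum_squares_triangle_ineq)
  also have "(\<kappa> * \<gamma> * a)\<^sup>2 + a\<^sup>2 = (1 + \<gamma>\<^sup>2 * \<kappa>\<^sup>2) * a\<^sup>2" by (simp add: algebra_simps power_mult_distrib)
  also have "sqrt \<dots> = sqrt (1 + \<gamma>\<^sup>2 * \<kappa>\<^sup>2) * a" by (simp add: real_sqrt_mult a_def)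
  finally show ?thesis using mu(1) by (simp add: a_def d_def)
qed

end

section \<open>The algebra of a sweep\<close>

text \<open>The coefficient of step \<open>i + 1\<close> of a sweep: \<open>\<zeta>\<close> or \<open>\<Gamma>\<close> in the two loops of the method.\<close>

definition sweep_coeff :: "(nat \<Rightarrow> real^'n) \<Rightarrow> (nat \<Rightarrow> real^'n) \<Rightarrow> (nat \<Rightarrow> real^'n) \<Rightarrow>
    (real^'n) \<times> (real^'n) \<Rightarrow> nat \<Rightarrow> real" where
  "sweep_coeff v p q yz i =
     inner (v (Suc i)) (snd (am_sweep v p q 0 i yz)) / inner (v (Suc i)) (q (Suc i))"

lemma am_sweep_shift:
  "am_sweep v p q s n yz = am_sweep (\<lambda>i. v (s + i)) (\<lambda>i. p (s + i)) (\<lambda>i. q (s + i)) 0 n yz"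
  by (induction n) (simp_all add: Let_def)

lemma fst_am_sweep:
  "fst (am_sweep v p q 0 n yz) = fst yz - (\<Sum>i<n. sweep_coeff v p q yz i *\<^sub>R p (Suc i))"
  by (induction n) (simp_all add: Let_def sweep_coeff_def split_beta)

lemma snd_am_sweep:
  "snd (am_sweep v p q 0 n yz) = snd yz - (\<Sum>i<n. sweep_coeff v p q yz i *\<^sub>R q (Suc i))"
  by (induction n) (simp_all add: Let_def sweep_coeff_def split_beta)

lemma am_sweep_orthogonal:
  assumes "\<And>i j. i < j \<Longrightarrow> j < n \<Longrightarrow> inner (v (Suc i)) (q (Suc j)) = 0"
    and "\<And>i. i < n \<Longrightarrow> inner (v (Suc i)) (q (Suc i)) \<noteq> 0"
  shows "i < n \<Longrightarrow> inner (v (Suc i)) (snd (am_sweep v p q 0 n yz)) = 0"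
  using assms
proof (induction n)
  case (Suc n)
  have "inner (v (Suc i)) (snd (am_sweep v p q 0 n yz)) = 0" if "i < n"
    using Suc that by simp
  moreover have "snd (am_sweep v p q 0 (Suc n) yz)
      = snd (am_sweep v p q 0 n yz) - sweep_coeff v p q yz n *\<^sub>R q (Suc n)"
    by (simp add: snd_am_sweep del: am_sweep.simps)
  ultimately show ?case
    using Suc.prems by (cases "i = n") (auto simp: inner_diff_right sweep_coeff_def)
qed simp

text \<open>The equation \<open>\<langle>v\<^sub>l, u\<rangle> = a\<^sub>l\<langle>v\<^sub>l, q\<^sub>l\<rangle> + (\<Sum>j<l. a\<^sub>j\<langle>v\<^sub>l, q\<^sub>j\<rangle>)\<close> for \<open>u = (\<Sum>j. a\<^sub>j q\<^sub>j)\<close> determines the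
  coefficients by forward substitution. The constant solves the resulting recursion
  \<open>K\<^sub>l = D/c + (D\<^sup>2/c)(\<Sum>j<l. K\<^sub>j)\<close>.\<close>

lemma triangular_coefficient_bound:
  fixes v q :: "nat \<Rightarrow> 'a::real_inner"
  assumes tri: "\<And>i j. i < j \<Longrightarrow> j < n \<Longrightarrow> inner (v i) (q j) = 0"
    and diag: "\<And>i. i < n \<Longrightarrow> c * E\<^sup>2 \<le> \<bar>inner (v i) (q i)\<bar>"
    and v: "\<And>i. i < n \<Longrightarrow> norm (v i) \<le> D * E" and q: "\<And>i. i < n \<Longrightarrow> norm (q i) \<le> D * E"
    and E: "0 < E" and c: "0 < c" and D: "0 \<le> D" and l: "l < n"
  shows "\<bar>a l\<bar> * E \<le> D / c * (1 + D\<^sup>2 / c) ^ l * norm (\<Sum>j<n. a j *\<^sub>R q j)"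
  using l
proof (induction l rule: less_induct)
  case (less l)
  define u where "u = (\<Sum>j<n. a j *\<^sub>R q j)"
  define t where "t = D\<^sup>2 / c"
  have t: "0 \<le> t" using c by (simp add: t_def)
  have split: "{..<n} = {..<l} \<union> {l} \<union> {l<..<n}" using less.prems by auto
  have "inner (v l) u = (\<Sum>j<n. a j * inner (v l) (q j))"
    by (simp add: u_def inner_sum_right)
  also have "\<dots> = (\<Sum>j<l. a j * inner (v l) (q j)) + a l * inner (v l) (q l)
      + (\<Sum>j\<in>{l<..<n}. a j * inner (v l) (q j))"
    unfolding split by (subst sum.union_disjoint; (subst sum.union_disjoint)?) auto
  also have "(\<Sum>j\<in>{l<..<n}. a j * inner (v l) (q j)) = 0" using tri by simp
  finally have "a l * inner (v l) (q l) = inner (v l) u - (\<Sum>j<l. a j * inner (v l) (q j))" by simp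
  then have "\<bar>a l\<bar> * \<bar>inner (v l) (q l)\<bar> \<le> \<bar>inner (v l) u\<bar> + (\<Sum>j<l. \<bar>a j\<bar> * \<bar>inner (v l) (q j)\<bar>)"
    unfolding abs_mult[symmetric]
    using sum_abs[of "\<lambda>j. a j * inner (v l) (q j)" "{..<l}"] by linarith
  also have "\<dots> \<le> (D * E) * norm u + (\<Sum>j<l. \<bar>a j\<bar> * ((D * E) * (D * E)))"
  proof (intro add_mono sum_mono mult_left_mono)
    show "\<bar>inner (v l) u\<bar> \<le> D * E * norm u"
      using Cauchy_Schwarz_ineq2[of "v l" u] v[OF less.prems]
      by (meson mult_right_mono norm_ge_zero order_trans)
    show "\<bar>inner (v l) (q j)\<bar> \<le> (D * E) * (D * E)" if "j \<in> {..<l}" for j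
      using Cauchy_Schwarz_ineq2[of "v l" "q j"] v[OF less.prems] q[of j] that less.prems E D
      by (smt (verit) lessThan_iff mult_mono norm_ge_zero order.strict_trans)
  qed auto
  also have "(\<Sum>j<l. \<bar>a j\<bar> * ((D * E) * (D * E))) = D\<^sup>2 * E * (\<Sum>j<l. \<bar>a j\<bar> * E)"
    by (simp add: sum_distrib_left power2_eq_square algebra_simps)
  finally have "\<bar>a l\<bar> * (c * E\<^sup>2) \<le> (D * E) * norm u + D\<^sup>2 * E * (\<Sum>j<l. \<bar>a j\<bar> * E)"
    using mult_left_mono[OF diag[OF less.prems], of "\<bar>a l\<bar>"] by linarith
  then have "(c * E) * (\<bar>a l\<bar> * E) \<le> (c * E) * (D / c * norm u + t * (\<Sum>j<l. \<bar>a j\<bar> * E))"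
    using c by (simp add: t_def power2_eq_square algebra_simps)
  then have "\<bar>a l\<bar> * E \<le> D / c * norm u + t * (\<Sum>j<l. \<bar>a j\<bar> * E)"
    using c E by (simp add: mult_le_cancel_left_pos)
  also have "(\<Sum>j<l. \<bar>a j\<bar> * E) \<le> (\<Sum>j<l. D / c * (1 + t) ^ j * norm u)"
    using less by (intro sum_mono) (auto simp: u_def t_def)
  also have "\<dots> = D / c * norm u * (\<Sum>j<l. (1 + t) ^ j)" by (simp add: sum_distrib_left mult_ac)
  finally have "\<bar>a l\<bar> * E \<le> D / c * norm u + t * (D / c * norm u * (\<Sum>j<l. (1 + t) ^ j))"
    using t by (simp add: mult_left_mono)
  also have "\<dots> = D / c * norm u * (1 + t * (\<Sum>j<l. (1 + t) ^ j))" by (simp add: algebra_simps)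
  also have "1 + t * (\<Sum>j<l. (1 + t) ^ j) = (1 + t) ^ l"
    by (induction l) (simp_all add: algebra_simps)
  finally show ?case by (simp add: u_def t_def mult_ac)
qed

section \<open>Quantities of order \<open>E\<^sup>k\<close> along a filter\<close>

text \<open>In the application a point \<open>w\<close> of the filter is a complete run of one block and \<open>E w\<close> is the
  distance of its first iterate from the solution. A bound that holds eventually along the filter
  thus has constants that are uniform over all runs starting close enough to the solution.\<close>

locale small_scale =
  fixes F :: "'w filter" and E :: "'w \<Rightarrow> real"
  assumes E_pos: "\<forall>\<^sub>F w in F. 0 < E w" and E_lim: "(E \<longlongrightarrow> 0) F"
begin

definition is_O :: "nat \<Rightarrow> ('w \<Rightarrow> 'b::real_normed_vector) \<Rightarrow> bool" where
  "is_O k f \<longleftrightarrow> (\<exists>C. \<forall>\<^sub>F w in F. norm (f w) \<le> C * E w ^ k)"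

lemma eventually_E_le: "0 < c \<Longrightarrow> \<forall>\<^sub>F w in F. E w \<le> c"
  using order_tendstoD(2)[OF E_lim, of c] by (auto elim: eventually_mono)

lemma is_OI: "\<forall>\<^sub>F w in F. norm (f w) \<le> C * E w ^ k \<Longrightarrow> is_O k f"
  unfolding is_O_def by blast

lemma is_OE:
  assumes "is_O k f"
  obtains C where "0 < C" "\<forall>\<^sub>F w in F. norm (f w) \<le> C * E w ^ k"
proof -
  obtain C where C: "\<forall>\<^sub>F w in F. norm (f w) \<le> C * E w ^ k" using assms unfolding is_O_def by blast
  have "\<forall>\<^sub>F w in F. norm (f w) \<le> max C 1 * E w ^ k"
    using C E_pos
  proof eventually_elim
    case (elim w)
    then have "C * E w ^ k \<le> max C 1 * E w ^ k" by (intro mult_right_mono) auto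
    with elim show ?case by linarith
  qed
  then show ?thesis by (intro that[of "max C 1"]) auto
qed

lemma is_O_bound:
  assumes "is_O k g" "\<forall>\<^sub>F w in F. norm (f w) \<le> C * norm (g w)"
  shows "is_O k f"
proof -
  obtain D where D: "\<forall>\<^sub>F w in F. norm (g w) \<le> D * E w ^ k" using assms(1) by (rule is_OE)
  show ?thesis
  proof (rule is_OI)
    show "\<forall>\<^sub>F w in F. norm (f w) \<le> (\<bar>C\<bar> * D) * E w ^ k"
      using D assms(2)
    proof eventually_elim
      case (elim w)
      have "C * norm (g w) \<le> \<bar>C\<bar> * norm (g w)" by (simp add: mult_right_mono)
      also have "\<dots> \<le> \<bar>C\<bar> * (D * E w ^ k)" using elim by (simp add: mult_left_mono)
      finally show ?case using elim by (simp add: mult.assoc)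
    qed
  qed
qed

lemma is_O_cong: "is_O k g \<Longrightarrow> \<forall>\<^sub>F w in F. f w = g w \<Longrightarrow> is_O k f"
  by (rule is_O_bound[of k g f 1]) (auto elim: eventually_mono)

lemma is_O_const: "is_O 0 (\<lambda>w. c)"
  by (rule is_OI[of _ "norm c"]) simp

lemma is_O_zero: "is_O k (\<lambda>w. 0)"
  by (rule is_OI[of _ 0]) simp

lemma is_O_mono:
  assumes "is_O k f" "j \<le> k"
  shows "is_O j f"
proof -
  obtain C where C: "0 < C" "\<forall>\<^sub>F w in F. norm (f w) \<le> C * E w ^ k" using assms(1) by (rule is_OE)
  have "\<forall>\<^sub>F w in F. norm (f w) \<le> C * E w ^ j"
    using C(2) E_pos eventually_E_le[of 1, simplified]
  proof eventually_elim
    case (elim w)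
    have "C * E w ^ k \<le> C * E w ^ j"
      using elim C(1) assms(2) by (intro mult_left_mono power_decreasing) auto
    with elim show ?case by linarith
  qed
  then show ?thesis by (rule is_OI)
qed

lemma is_O_add:
  assumes "is_O k f" "is_O k g"
  shows "is_O k (\<lambda>w. f w + g w)"
proof -
  obtain C where C: "\<forall>\<^sub>F w in F. norm (f w) \<le> C * E w ^ k" using assms(1) by (rule is_OE)
  obtain D where D: "\<forall>\<^sub>F w in F. norm (g w) \<le> D * E w ^ k" using assms(2) by (rule is_OE)
  show ?thesis
  proof (rule is_OI)
    show "\<forall>\<^sub>F w in F. norm (f w + g w) \<le> (C + D) * E w ^ k"
      using C D by eventually_elim (simp add: distrib_right norm_triangle_le)
  qed
qed

lemma is_O_minus: "is_O k f \<Longrightarrow> is_O k (\<lambda>w. - f w)"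
  by (rule is_O_bound[of k f _ 1]) auto

lemma is_O_diff: "is_O k f \<Longrightarrow> is_O k g \<Longrightarrow> is_O k (\<lambda>w. f w - g w)"
  using is_O_add[of k f "\<lambda>w. - g w"] is_O_minus[of k g] by simp

lemma is_O_sum: "(\<And>i. i \<in> I \<Longrightarrow> is_O k (f i)) \<Longrightarrow> is_O k (\<lambda>w. \<Sum>i\<in>I. f i w)"
  by (induction I rule: infinite_finite_induct) (auto intro: is_O_zero is_O_add)

lemma is_O_prod_bound:
  assumes "is_O j f" "is_O k g" "\<forall>\<^sub>F w in F. norm (h w) \<le> norm (f w) * norm (g w)"
  shows "is_O (j + k) h"
proof -
  obtain C where C: "\<forall>\<^sub>F w in F. norm (f w) \<le> C * E w ^ j" using assms(1) by (rule is_OE)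
  obtain D where D: "\<forall>\<^sub>F w in F. norm (g w) \<le> D * E w ^ k" using assms(2) by (rule is_OE)
  show ?thesis
  proof (rule is_OI)
    show "\<forall>\<^sub>F w in F. norm (h w) \<le> (C * D) * E w ^ (j + k)"
      using C D assms(3)
    proof eventually_elim
      case (elim w)
      have "norm (f w) * norm (g w) \<le> (C * E w ^ j) * (D * E w ^ k)"
        using elim by (intro mult_mono) (auto intro: order_trans[OF norm_ge_zero])
      with elim show ?case by (simp add: power_add mult_ac)
    qed
  qed
qed

lemma is_O_scaleR: "is_O j c \<Longrightarrow> is_O k f \<Longrightarrow> is_O (j + k) (\<lambda>w. c w *\<^sub>R f w)"
  by (rule is_O_prod_bound[of j c k f]) auto

lemma is_O_scaleR_bounded: "is_O 0 c \<Longrightarrow> is_O k f \<Longrightarrow> is_O k (\<lambda>w. c w *\<^sub>R f w)"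
  using is_O_scaleR[of 0 c k f] by simp

lemma is_O_inner: "is_O j f \<Longrightarrow> is_O k g \<Longrightarrow> is_O (j + k) (\<lambda>w. inner (f w) (g w))"
  by (rule is_O_prod_bound[of j f k g]) (auto simp: Cauchy_Schwarz_ineq2)

lemma is_O_matrix:
  fixes M :: "real^'m^'k"
  shows "is_O k f \<Longrightarrow> is_O k (\<lambda>w. M *v f w)"
  by (rule is_O_bound[of k f _ "onorm ((*v) M)"])
    (auto intro!: onorm matrix_vector_mul_bounded_linear always_eventually)

lemma is_O_divide:
  fixes a b :: "'w \<Rightarrow> real"
  assumes "is_O (i + k) a" "0 < c" "\<forall>\<^sub>F w in F. c * E w ^ k \<le> \<bar>b w\<bar>"
  shows "is_O i (\<lambda>w. a w / b w)"
proof -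
  obtain C where C: "0 < C" "\<forall>\<^sub>F w in F. norm (a w) \<le> C * E w ^ (i + k)" using assms(1) by (rule is_OE)
  show ?thesis
  proof (rule is_OI)
    show "\<forall>\<^sub>F w in F. norm (a w / b w) \<le> (C / c) * E w ^ i"
      using C(2) assms(3) E_pos
    proof eventually_elim
      case (elim w)
      have "0 < c * E w ^ k" using elim assms(2) by simp
      then have b: "0 < \<bar>b w\<bar>" using elim by linarith
      have "\<bar>a w\<bar> \<le> (C / c * E w ^ i) * (c * E w ^ k)"
        using elim assms(2) by (simp add: power_add)
      also have "\<dots> \<le> (C / c * E w ^ i) * \<bar>b w\<bar>"
        using elim C(1) assms(2) by (intro mult_left_mono) auto
      finally show ?case using b by (simp add: abs_divide divide_le_eq)
    qed
  qed
qed

lemma is_O_uniform: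
  fixes n :: nat
  assumes "\<And>i. i < n \<Longrightarrow> is_O k (f i)"
  obtains C where "0 < C" "\<forall>\<^sub>F w in F. \<forall>i<n. norm (f i w) \<le> C * E w ^ k"
proof -
  have "is_O k (\<lambda>w. \<Sum>i<n. norm (f i w))"
    by (intro is_O_sum is_O_bound[where C = 1, OF assms]) auto
  then obtain C where C: "0 < C" "\<forall>\<^sub>F w in F. norm (\<Sum>i<n. norm (f i w)) \<le> C * E w ^ k"
    by (rule is_OE)
  have "\<forall>\<^sub>F w in F. \<forall>i<n. norm (f i w) \<le> C * E w ^ k"
    using C(2)
  proof (eventually_elim, intro allI impI)
    fix w i assume w: "norm (\<Sum>i<n. norm (f i w)) \<le> C * E w ^ k" "i < n"
    then have "norm (f i w) \<le> (\<Sum>i<n. norm (f i w))"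
      by (intro member_le_sum) auto
    also have "\<dots> \<le> C * E w ^ k" using w(1) by (simp add: sum_nonneg)
    finally show "norm (f i w) \<le> C * E w ^ k" .
  qed
  with C(1) show ?thesis by (rule that)
qed

lemma eventually_le_of_higher_order:
  assumes "0 < c" "is_O (Suc k) f"
  shows "\<forall>\<^sub>F w in F. norm (f w) \<le> c * E w ^ k"
proof -
  obtain C where C: "0 < C" "\<forall>\<^sub>F w in F. norm (f w) \<le> C * E w ^ Suc k" using assms(2) by (rule is_OE)
  have "0 < c / C" using assms(1) C(1) by simp
  from eventually_E_le[OF this] C(2) E_pos show ?thesis
  proof eventually_elim
    case (elim w)
    have "C * E w \<le> c" using elim C(1) by (simp add: field_simps)
    then have "(C * E w) * E w ^ k \<le> c * E w ^ k" using elim by (intro mult_right_mono) auto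
    with elim(2) show ?case unfolding power_Suc mult.assoc[symmetric] by linarith
  qed
qed

text \<open>The starting vector \<open>W w\<close> of the Krylov space is left open, because the same directions
  approximate the Krylov spaces of \<open>r\<^sub>s\<close> and of \<open>A e\<^sub>s\<close>, and both are needed for Type I.\<close>

definition near_krylov :: "real^'n^'n \<Rightarrow> ('w \<Rightarrow> real^'n) \<Rightarrow> nat \<Rightarrow> ('w \<Rightarrow> real^'n) \<Rightarrow> bool" where
  "near_krylov A W k f \<longleftrightarrow> (\<exists>u. (\<forall>w. u w \<in> krylov A k (W w)) \<and> is_O 2 (\<lambda>w. f w - u w))"

lemma near_krylov_is_O2: "is_O 2 f \<Longrightarrow> near_krylov A W k f"
  unfolding near_krylov_def
  by (intro exI[of _ "\<lambda>w. 0"]) (simp add: subspace_krylov subspace_0)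

lemma near_krylov_mono: "near_krylov A W j f \<Longrightarrow> j \<le> k \<Longrightarrow> near_krylov A W k f"
  unfolding near_krylov_def using krylov_mono by blast

lemma near_krylov_add:
  assumes "near_krylov A W k f" "near_krylov A W k g"
  shows "near_krylov A W k (\<lambda>w. f w + g w)"
proof -
  obtain u v where u: "\<forall>w. u w \<in> krylov A k (W w)" "is_O 2 (\<lambda>w. f w - u w)"
    and v: "\<forall>w. v w \<in> krylov A k (W w)" "is_O 2 (\<lambda>w. g w - v w)"
    using assms unfolding near_krylov_def by blast
  have "is_O 2 (\<lambda>w. (f w + g w) - (u w + v w))"
    using is_O_add[OF u(2) v(2)] by (simp add: algebra_simps)
  with u v show ?thesis unfolding near_krylov_def
    by (intro exI[of _ "\<lambda>w. u w + v w"]) (simp add: subspace_krylov subspace_add)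
qed

lemma near_krylov_scaleR:
  assumes "is_O 0 c" "near_krylov A W k f"
  shows "near_krylov A W k (\<lambda>w. c w *\<^sub>R f w)"
proof -
  obtain u where u: "\<forall>w. u w \<in> krylov A k (W w)" "is_O 2 (\<lambda>w. f w - u w)"
    using assms unfolding near_krylov_def by blast
  have "is_O 2 (\<lambda>w. c w *\<^sub>R f w - c w *\<^sub>R u w)"
    using is_O_scaleR_bounded[OF assms(1) u(2)] by (simp add: algebra_simps)
  with u show ?thesis unfolding near_krylov_def
    by (intro exI[of _ "\<lambda>w. c w *\<^sub>R u w"]) (simp add: subspace_krylov subspace_scale)
qed

lemma near_krylov_minus: "near_krylov A W k f \<Longrightarrow> near_krylov A W k (\<lambda>w. - f w)"
  using near_krylov_scaleR[OF is_O_const[of "- 1 :: real"], of A W k f] by simp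

lemma near_krylov_diff:
  "near_krylov A W k f \<Longrightarrow> near_krylov A W k g \<Longrightarrow> near_krylov A W k (\<lambda>w. f w - g w)"
  using near_krylov_add[of A W k f "\<lambda>w. - g w"] near_krylov_minus[of A W k g] by simp

lemma near_krylov_sum:
  "(\<And>i. i \<in> I \<Longrightarrow> near_krylov A W k (f i)) \<Longrightarrow> near_krylov A W k (\<lambda>w. \<Sum>i\<in>I. f i w)"
  by (induction I rule: infinite_finite_induct)
    (auto intro: near_krylov_is_O2[OF is_O_zero] near_krylov_add)

lemma near_krylov_mult:
  assumes "near_krylov A W k f"
  shows "near_krylov A W (Suc k) (\<lambda>w. A *v f w)"
proof -
  obtain u where u: "\<forall>w. u w \<in> krylov A k (W w)" "is_O 2 (\<lambda>w. f w - u w)"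
    using assms unfolding near_krylov_def by blast
  have "is_O 2 (\<lambda>w. A *v f w - A *v u w)"
    using is_O_matrix[OF u(2), of A] by (simp add: matrix_vector_mult_diff_distrib)
  with u show ?thesis unfolding near_krylov_def
    by (intro exI[of _ "\<lambda>w. A *v u w"]) (simp add: mult_krylov)
qed

lemma near_krylov_cong:
  assumes "near_krylov A W k g" "\<forall>\<^sub>F w in F. f w = g w"
  shows "near_krylov A W k f"
proof -
  have "is_O 2 (\<lambda>w. f w - g w)"
    by (rule is_O_cong[OF is_O_zero]) (use assms(2) in \<open>auto elim: eventually_mono\<close>)
  from near_krylov_add[OF near_krylov_is_O2[OF this] assms(1)] show ?thesis by simp
qed

end

section \<open>One block between restarts\<close>

definition am_test :: "am_type \<Rightarrow> (nat \<Rightarrow> real^'n) \<Rightarrow> (nat \<Rightarrow> real^'n) \<Rightarrow> nat \<Rightarrow> real^'n" where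
  "am_test ty p q = (case ty of Type_I \<Rightarrow> p | Type_II \<Rightarrow> q)"

text \<open>A block with \<open>n\<close> directions \<open>(p 1, q 1), \<dots>, (p n, q n)\<close>; indices count from the restart.\<close>

definition am_block :: "am_type \<Rightarrow> nat \<Rightarrow> real \<Rightarrow> (nat \<Rightarrow> real) \<Rightarrow> (nat \<Rightarrow> real^'n) \<Rightarrow>
    (nat \<Rightarrow> real^'n) \<Rightarrow> (nat \<Rightarrow> real^'n) \<Rightarrow> (nat \<Rightarrow> real^'n) \<Rightarrow> bool" where
  "am_block ty n \<tau> \<beta> x r p q \<longleftrightarrow>
     (\<forall>j<n. (p (Suc j), q (Suc j))
        = am_sweep (am_test ty p q) p q 0 j (x (Suc j) - x j, r (Suc j) - r j)) \<and>
     (\<forall>j<n. \<tau> * \<bar>inner (am_test ty p q 1) (q 1)\<bar>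
        \<le> \<bar>inner (am_test ty p q (Suc j)) (q (Suc j))\<bar>) \<and>
     (\<forall>j\<le>n. x (Suc j) = (let (xbar, rbar) = am_sweep (am_test ty p q) p q 0 j (x j, r j)
        in xbar + \<beta> j *\<^sub>R rbar))"

lemma am_block_direction:
  assumes "am_block ty n \<tau> \<beta> x r p q" "j < n"
  defines "c \<equiv> sweep_coeff (am_test ty p q) p q (x (Suc j) - x j, r (Suc j) - r j)"
  shows "p (Suc j) = x (Suc j) - x j - (\<Sum>i<j. c i *\<^sub>R p (Suc i))"
    and "q (Suc j) = r (Suc j) - r j - (\<Sum>i<j. c i *\<^sub>R q (Suc i))"
proof -
  have eq: "(p (Suc j), q (Suc j))
      = am_sweep (am_test ty p q) p q 0 j (x (Suc j) - x j, r (Suc j) - r j)"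
    using assms(1,2) by (simp add: am_block_def)
  show "p (Suc j) = x (Suc j) - x j - (\<Sum>i<j. c i *\<^sub>R p (Suc i))"
    using arg_cong[OF eq, of fst] by (simp add: fst_am_sweep c_def)
  show "q (Suc j) = r (Suc j) - r j - (\<Sum>i<j. c i *\<^sub>R q (Suc i))"
    using arg_cong[OF eq, of snd] by (simp add: snd_am_sweep c_def)
qed

lemma am_block_step:
  assumes "am_block ty n \<tau> \<beta> x r p q" "j \<le> n"
  shows "x (Suc j) = fst (am_sweep (am_test ty p q) p q 0 j (x j, r j))
    + \<beta> j *\<^sub>R snd (am_sweep (am_test ty p q) p q 0 j (x j, r j))"
  using assms by (simp add: am_block_def split_beta Let_def)

lemma am_block_residual_span:
  assumes "am_block ty n \<tau> \<beta> x r p q" "j \<le> n"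
  shows "r j - r 0 \<in> span {q (Suc i) | i. i < n}"
  using assms(2)
proof (induction j)
  case (Suc j)
  define c where "c = sweep_coeff (am_test ty p q) p q (x (Suc j) - x j, r (Suc j) - r j)"
  have "r (Suc j) - r 0 = (r j - r 0) + q (Suc j) + (\<Sum>i<j. c i *\<^sub>R q (Suc i))"
    using am_block_direction(2)[OF assms(1), of j] Suc.prems by (simp add: c_def)
  moreover have "(r j - r 0) + q (Suc j) + (\<Sum>i<j. c i *\<^sub>R q (Suc i)) \<in> span {q (Suc i) | i. i < n}"
  proof (intro span_add)
    show "r j - r 0 \<in> span {q (Suc i) | i. i < n}" using Suc by simp
    show "q (Suc j) \<in> span {q (Suc i) | i. i < n}"
      using Suc.prems by (intro span_base) auto
    show "(\<Sum>i<j. c i *\<^sub>R q (Suc i)) \<in> span {q (Suc i) | i. i < n}"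
      using Suc.prems by (intro span_sum span_scale span_base) auto
  qed
  ultimately show ?case by (simp only:)
qed (simp add: span_zero)

text \<open>Every sweep makes its result orthogonal to the test vectors it passes. The directions are results
  of sweeps themselves, so these relations are exact even for nonlinear \<open>g\<close>.\<close>

lemma am_block_orthogonal:
  assumes b: "am_block ty n \<tau> \<beta> x r p q"
    and nz: "\<And>i. i < n \<Longrightarrow> inner (am_test ty p q (Suc i)) (q (Suc i)) \<noteq> 0"
  shows "j < n \<Longrightarrow> i < j \<Longrightarrow> inner (am_test ty p q (Suc i)) (q (Suc j)) = 0"
    and "i < n \<Longrightarrow> inner (am_test ty p q (Suc i)) (snd (am_sweep (am_test ty p q) p q 0 n yz)) = 0"
proof -
  have *: "\<forall>i<j. inner (am_test ty p q (Suc i)) (q (Suc j)) = 0" if "j < n" for j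
    using that
  proof (induction j rule: less_induct)
    case (less j)
    have "(p (Suc j), q (Suc j))
        = am_sweep (am_test ty p q) p q 0 j (x (Suc j) - x j, r (Suc j) - r j)"
      using b less.prems by (simp add: am_block_def)
    from arg_cong[OF this, of snd]
    have q: "q (Suc j) = snd (am_sweep (am_test ty p q) p q 0 j (x (Suc j) - x j, r (Suc j) - r j))"
      by simp
    show ?case unfolding q
      by (intro allI impI am_sweep_orthogonal) (use less nz in auto)
  qed
  then show "j < n \<Longrightarrow> i < j \<Longrightarrow> inner (am_test ty p q (Suc i)) (q (Suc j)) = 0" by simp
  show "inner (am_test ty p q (Suc i)) (snd (am_sweep (am_test ty p q) p q 0 n yz)) = 0" if "i < n"
    using that by (intro am_sweep_orthogonal) (use * nz in auto)
qed

text \<open>A family of blocks of the same length whose restarts approach the solution. The map \<open>g\<close> enters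
  only through the linear model of the residuals.\<close>

locale am_family = small_scale F E for F :: "'w filter" and E :: "'w \<Rightarrow> real" +
  fixes ty :: am_type and n :: nat and \<tau> \<beta>lo \<beta>hi \<mu> L :: real
    and A :: "real^'n^'n" and xs :: "real^'n"
    and B :: "'w \<Rightarrow> nat \<Rightarrow> real" and X R P Q :: "'w \<Rightarrow> nat \<Rightarrow> real^'n"
  assumes E_def: "E w = norm (X w 0 - xs)"
    and \<mu>: "0 < \<mu>" and coercive: "\<mu> * (norm y)\<^sup>2 \<le> inner y (A *v y)"
    and L: "0 < L" and A_le: "norm (A *v y) \<le> L * norm y"
    and \<tau>: "0 < \<tau>" and \<beta>lo: "0 < \<beta>lo"
    and B: "\<forall>\<^sub>F w in F. \<forall>j. B w j \<in> {\<beta>lo..\<beta>hi}"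
    and block: "\<forall>\<^sub>F w in F. am_block ty n \<tau> (B w) (X w) (R w) (P w) (Q w)"
    and X_O: "j \<le> n \<Longrightarrow> is_O 1 (\<lambda>w. X w j - xs)"
    and R_O: "j \<le> n \<Longrightarrow> is_O 2 (\<lambda>w. R w j + A *v (X w j - xs))"
begin

abbreviation V :: "'w \<Rightarrow> nat \<Rightarrow> real^'n" where
  "V w \<equiv> am_test ty (P w) (Q w)"

lemmas A_ge = inner_mult_ge_imp_norm_ge[of \<mu> A, OF coercive]

lemma R_O1: "j \<le> n \<Longrightarrow> is_O 1 (\<lambda>w. R w j)"
  using is_O_diff[OF is_O_mono[OF R_O, of j 1] is_O_matrix[OF X_O, of j A]] by simp

lemma B_O: "is_O 0 (\<lambda>w. B w j)"
proof (rule is_OI)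
  show "\<forall>\<^sub>F w in F. norm (B w j) \<le> \<beta>hi * E w ^ 0"
    using B
  proof eventually_elim
    case (elim w)
    then have "\<beta>lo \<le> B w j" "B w j \<le> \<beta>hi" by auto
    with \<beta>lo show ?case by simp
  qed
qed

lemma X_diff_O: "i \<le> n \<Longrightarrow> j \<le> n \<Longrightarrow> is_O 1 (\<lambda>w. X w i - X w j)"
  using is_O_diff[OF X_O X_O, of i j] by simp

lemma R_diff_O:
  "i \<le> n \<Longrightarrow> j \<le> n \<Longrightarrow> is_O 2 (\<lambda>w. R w i - R w j + A *v (X w i - X w j))"
  using is_O_diff[OF R_O R_O, of i j]
  by (simp add: matrix_vector_mult_diff_distrib algebra_simps)

lemma R0_lower: "\<forall>\<^sub>F w in F. \<mu> / 2 * E w \<le> norm (R w 0)"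
proof -
  have "\<forall>\<^sub>F w in F. norm (R w 0 + A *v (X w 0 - xs)) \<le> \<mu> / 2 * E w ^ 1"
    by (rule eventually_le_of_higher_order) (use \<mu> R_O[of 0] in \<open>auto simp: numeral_2_eq_2\<close>)
  then show ?thesis
  proof eventually_elim
    case (elim w)
    have "\<mu> * E w \<le> norm (A *v (X w 0 - xs))" by (simp add: E_def A_ge)
    also have "\<dots> \<le> norm (R w 0 + A *v (X w 0 - xs)) + norm (R w 0)"
      by (metis norm_triangle_ineq4 add.commute add_diff_cancel_left')
    finally show ?case using elim by simp
  qed
qed

text \<open>The first step of a block is \<open>\<beta>\<^sub>s r\<^sub>s\<close>, which is as long as \<open>e\<^sub>s\<close> up to constants. The test
  against \<open>\<tau>\<close> hands the resulting lower bound on to all later denominators.\<close>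

lemma denominator_lower:
  obtains c where "0 < c" "\<forall>\<^sub>F w in F. \<forall>i<n. c * (E w)\<^sup>2 \<le> \<bar>inner (V w (Suc i)) (Q w (Suc i))\<bar>"
proof (cases "n = 0")
  case True
  then show ?thesis using that[of 1] by simp
next
  case False
  then have n: "0 < n" by simp
  define b where "b = \<beta>lo * (\<mu> / 2)"
  have b: "0 < b" using \<beta>lo \<mu> by (simp add: b_def)
  have P1: "\<forall>\<^sub>F w in F. P w 1 = X w 1 - X w 0 \<and> Q w 1 = R w 1 - R w 0 \<and> P w 1 = B w 0 *\<^sub>R R w 0"
    using block
  proof eventually_elim
    case (elim w)
    show ?case
      using am_block_direction[OF elim n] am_block_step[OF elim, of 0] by simp
  qed
  have P1_ge: "\<forall>\<^sub>F w in F. b * E w \<le> norm (P w 1)"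
    using P1 R0_lower B E_pos
  proof eventually_elim
    case (elim w)
    have B0: "\<beta>lo \<le> B w 0" "0 \<le> B w 0" using elim \<beta>lo by (auto intro: order.trans[of 0 \<beta>lo])
    then have "\<beta>lo * (\<mu> / 2 * E w) \<le> B w 0 * norm (R w 0)"
      using elim \<mu> by (intro mult_mono) auto
    moreover have "norm (P w 1) = B w 0 * norm (R w 0)"
      using elim(1) B0(2) by (metis norm_scaleR abs_of_nonneg)
    ultimately show ?case by (simp add: b_def)
  qed
  have P1_O: "is_O 1 (\<lambda>w. P w 1)"
    using P1 n by (intro is_O_cong[OF X_diff_O[of 1 0]]) (auto elim: eventually_mono)
  have D_O: "is_O 2 (\<lambda>w. Q w 1 + A *v P w 1)"
    using P1 n by (intro is_O_cong[OF R_diff_O[of 1 0]]) (auto elim: eventually_mono)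
  obtain c where c: "0 < c" "\<forall>\<^sub>F w in F. c * (E w)\<^sup>2 \<le> \<bar>inner (V w 1) (Q w 1)\<bar>"
  proof (cases ty)
    case Type_I
    have "is_O 3 (\<lambda>w. inner (P w 1) (Q w 1 + A *v P w 1))"
      using is_O_inner[OF P1_O D_O] by (simp add: numeral_3_eq_3)
    then have "\<forall>\<^sub>F w in F. norm (inner (P w 1) (Q w 1 + A *v P w 1)) \<le> \<mu> * b\<^sup>2 / 2 * E w ^ 2"
      using \<mu> b by (intro eventually_le_of_higher_order) (simp_all add: numeral_3_eq_3 numeral_2_eq_2)
    then have "\<forall>\<^sub>F w in F. (\<mu> * b\<^sup>2 / 2) * (E w)\<^sup>2 \<le> \<bar>inner (V w 1) (Q w 1)\<bar>"
      using P1_ge E_pos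
    proof eventually_elim
      case (elim w)
      have "\<mu> * (b * E w)\<^sup>2 \<le> \<mu> * (norm (P w 1))\<^sup>2"
        using elim \<mu> b by (intro mult_left_mono power_mono) auto
      also have "\<dots> \<le> inner (P w 1) (A *v P w 1)" by (rule coercive)
      finally have "\<mu> * b\<^sup>2 * (E w)\<^sup>2 \<le> inner (P w 1) (A *v P w 1)"
        by (simp add: power_mult_distrib mult.assoc)
      moreover have "inner (P w 1) (A *v P w 1)
          = inner (P w 1) (Q w 1 + A *v P w 1) - inner (P w 1) (Q w 1)"
        by (simp add: inner_add_right)
      moreover have "inner (P w 1) (Q w 1 + A *v P w 1) \<le> \<mu> * b\<^sup>2 / 2 * E w ^ 2"
        using elim(1) by simp
      moreover have "V w 1 = P w 1" by (simp add: Type_I am_test_def)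
      ultimately show ?case by (simp add: field_simps)
    qed
    then show ?thesis using that[of "\<mu> * b\<^sup>2 / 2"] \<mu> b by simp
  next
    case Type_II
    have "\<forall>\<^sub>F w in F. norm (Q w 1 + A *v P w 1) \<le> \<mu> * b / 2 * E w ^ 1"
      using \<mu> b D_O by (intro eventually_le_of_higher_order) (simp_all add: numeral_2_eq_2)
    then have "\<forall>\<^sub>F w in F. (\<mu> * b / 2)\<^sup>2 * (E w)\<^sup>2 \<le> \<bar>inner (V w 1) (Q w 1)\<bar>"
      using P1_ge E_pos
    proof eventually_elim
      case (elim w)
      have "\<mu> * (b * E w) \<le> \<mu> * norm (P w 1)" using elim \<mu> by simp
      also have "\<dots> \<le> norm (A *v P w 1)" by (rule A_ge)
      also have "\<dots> \<le> norm (Q w 1 + A *v P w 1) + norm (Q w 1)"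
        by (metis norm_triangle_ineq4 add.commute add_diff_cancel_left')
      finally have "\<mu> * b / 2 * E w \<le> norm (Q w 1)" using elim by (simp add: field_simps)
      then have "(\<mu> * b / 2 * E w)\<^sup>2 \<le> (norm (Q w 1))\<^sup>2"
        using elim \<mu> b by (intro power_mono) auto
      then have "(\<mu> * b / 2)\<^sup>2 * (E w)\<^sup>2 \<le> inner (Q w 1) (Q w 1)"
        unfolding power_mult_distrib[of _ "E w"] power2_norm_eq_inner .
      then show ?case by (simp add: Type_II am_test_def)
    qed
    then show ?thesis using that[of "(\<mu> * b / 2)\<^sup>2"] \<mu> b by simp
  qed
  have "\<forall>\<^sub>F w in F. \<forall>i<n. (\<tau> * c) * (E w)\<^sup>2 \<le> \<bar>inner (V w (Suc i)) (Q w (Suc i))\<bar>"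
    using block c(2)
  proof (eventually_elim, intro allI impI)
    fix w i assume w: "am_block ty n \<tau> (B w) (X w) (R w) (P w) (Q w)"
      "c * (E w)\<^sup>2 \<le> \<bar>inner (V w 1) (Q w 1)\<bar>" and i: "i < n"
    have "\<tau> * (c * (E w)\<^sup>2) \<le> \<tau> * \<bar>inner (V w 1) (Q w 1)\<bar>"
      using w(2) \<tau> by (intro mult_left_mono) auto
    also have "\<dots> \<le> \<bar>inner (V w (Suc i)) (Q w (Suc i))\<bar>"
      using w(1) i unfolding am_block_def by blast
    finally show "(\<tau> * c) * (E w)\<^sup>2 \<le> \<bar>inner (V w (Suc i)) (Q w (Suc i))\<bar>" by (simp add: mult.assoc)
  qed
  then show ?thesis using that[of "\<tau> * c"] \<tau> c(1) by simp
qed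

text \<open>A coefficient is a quotient of an \<open>O(E\<^sup>2)\<close> numerator by a denominator of at least that order.\<close>

lemma sweep_coeff_O:
  assumes dirs: "\<And>i. i < j \<Longrightarrow> is_O 1 (\<lambda>w. P w (Suc i)) \<and> is_O 1 (\<lambda>w. Q w (Suc i))"
    and j: "j \<le> n" and Z: "is_O 1 Z"
  shows "i < j \<Longrightarrow> is_O 0 (\<lambda>w. sweep_coeff (V w) (P w) (Q w) (Y w, Z w) i)"
proof (induction i rule: less_induct)
  case (less i)
  obtain c where c: "0 < c" "\<forall>\<^sub>F w in F. \<forall>i<n. c * (E w)\<^sup>2 \<le> \<bar>inner (V w (Suc i)) (Q w (Suc i))\<bar>"
    by (rule denominator_lower)
  have V: "is_O 1 (\<lambda>w. V w (Suc i))"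
    using dirs[OF less.prems] by (cases ty) (simp_all add: am_test_def)
  have "is_O 1 (\<lambda>w. Z w - (\<Sum>l<i. sweep_coeff (V w) (P w) (Q w) (Y w, Z w) l *\<^sub>R Q w (Suc l)))"
    using less dirs by (intro is_O_diff Z is_O_sum is_O_scaleR_bounded) auto
  then have "is_O (0 + 2) (\<lambda>w. inner (V w (Suc i)) (snd (am_sweep (V w) (P w) (Q w) 0 i (Y w, Z w))))"
    using is_O_inner[OF V] by (simp add: snd_am_sweep numeral_2_eq_2)
  then show ?case
    unfolding sweep_coeff_def
    by (rule is_O_divide[OF _ c(1)]) (use c(2) less.prems j in \<open>auto elim: eventually_mono\<close>)
qed

abbreviation dir_coeff :: "nat \<Rightarrow> 'w \<Rightarrow> nat \<Rightarrow> real" where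
  "dir_coeff j w \<equiv> sweep_coeff (V w) (P w) (Q w) (X w (Suc j) - X w j, R w (Suc j) - R w j)"

abbreviation mix_coeff :: "nat \<Rightarrow> 'w \<Rightarrow> nat \<Rightarrow> real" where
  "mix_coeff j w \<equiv> sweep_coeff (V w) (P w) (Q w) (X w j, R w j)"

lemma directions_O: "i < n \<Longrightarrow> is_O 1 (\<lambda>w. P w (Suc i)) \<and> is_O 1 (\<lambda>w. Q w (Suc i))
    \<and> is_O 2 (\<lambda>w. Q w (Suc i) + A *v P w (Suc i))"
proof (induction i rule: less_induct)
  case (less i)
  have c: "is_O 0 (\<lambda>w. dir_coeff i w l)" if "l < i" for l
    by (rule sweep_coeff_O[where j = i])
      (use less that is_O_diff[OF R_O1 R_O1, of "Suc i" i] in auto)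
  have Pe: "\<forall>\<^sub>F w in F. P w (Suc i) = X w (Suc i) - X w i - (\<Sum>l<i. dir_coeff i w l *\<^sub>R P w (Suc l))"
    using block by eventually_elim (rule am_block_direction(1)[OF _ less.prems])
  have Qe: "\<forall>\<^sub>F w in F. Q w (Suc i) = R w (Suc i) - R w i - (\<Sum>l<i. dir_coeff i w l *\<^sub>R Q w (Suc l))"
    using block by eventually_elim (rule am_block_direction(2)[OF _ less.prems])
  have "is_O 1 (\<lambda>w. P w (Suc i))"
    by (rule is_O_cong[OF _ Pe])
      (use less c X_diff_O[of "Suc i" i] in \<open>auto intro!: is_O_diff is_O_sum is_O_scaleR_bounded\<close>)
  moreover have "is_O 1 (\<lambda>w. Q w (Suc i))"
    by (rule is_O_cong[OF _ Qe])
      (use less c R_O1 in \<open>auto intro!: is_O_diff is_O_sum is_O_scaleR_bounded\<close>)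
  moreover have "is_O 2 (\<lambda>w. Q w (Suc i) + A *v P w (Suc i))"
  proof (rule is_O_cong)
    show "is_O 2 (\<lambda>w. (R w (Suc i) - R w i + A *v (X w (Suc i) - X w i))
        - (\<Sum>l<i. dir_coeff i w l *\<^sub>R (Q w (Suc l) + A *v P w (Suc l))))"
      using less c R_diff_O[of "Suc i" i]
      by (intro is_O_diff is_O_sum is_O_scaleR_bounded) auto
    show "\<forall>\<^sub>F w in F. Q w (Suc i) + A *v P w (Suc i)
      = (R w (Suc i) - R w i + A *v (X w (Suc i) - X w i))
        - (\<Sum>l<i. dir_coeff i w l *\<^sub>R (Q w (Suc l) + A *v P w (Suc l)))"
      using Pe Qe
    proof eventually_elim
      case (elim w)
      have "A *v P w (Suc i) = A *v (X w (Suc i) - X w i)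
          - (\<Sum>l<i. dir_coeff i w l *\<^sub>R (A *v P w (Suc l)))"
        unfolding elim(1)
        by (simp add: matrix_vector_mult_diff_distrib linear_sum[of "(*v) A"] matrix_vector_mult_scaleR)
      then show ?case
        by (simp add: elim(2) matrix_vector_mult_diff_distrib scaleR_add_right sum.distrib)
    qed
  qed
  ultimately show ?case by blast
qed

lemma P_O: "i < n \<Longrightarrow> is_O 1 (\<lambda>w. P w (Suc i))"
  and Q_O: "i < n \<Longrightarrow> is_O 1 (\<lambda>w. Q w (Suc i))"
  and Q_A_P_O: "i < n \<Longrightarrow> is_O 2 (\<lambda>w. Q w (Suc i) + A *v P w (Suc i))"
  using directions_O by blast+

lemma mix_coeff_O: "j \<le> n \<Longrightarrow> i < j \<Longrightarrow> is_O 0 (\<lambda>w. mix_coeff j w i)"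
  by (rule sweep_coeff_O[where j = j]) (use directions_O R_O1 in auto)

text \<open>The mixed residual and the error of the mixed iterate from which the last step of the block
  starts.\<close>

definition rbar :: "'w \<Rightarrow> real^'n" where
  "rbar w = snd (am_sweep (V w) (P w) (Q w) 0 n (X w n, R w n))"

definition ebar :: "'w \<Rightarrow> real^'n" where
  "ebar w = fst (am_sweep (V w) (P w) (Q w) 0 n (X w n, R w n)) - xs"

lemma rbar_eq: "rbar w = R w n - (\<Sum>i<n. mix_coeff n w i *\<^sub>R Q w (Suc i))"
  by (simp add: rbar_def snd_am_sweep)

lemma ebar_eq: "ebar w = (X w n - xs) - (\<Sum>i<n. mix_coeff n w i *\<^sub>R P w (Suc i))"
  by (simp add: ebar_def fst_am_sweep)

lemma rbar_O: "is_O 1 rbar"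
  unfolding rbar_eq[abs_def] using directions_O mix_coeff_O[OF order.refl] R_O1
  by (intro is_O_diff is_O_sum is_O_scaleR_bounded) auto

lemma ebar_O: "is_O 1 ebar"
  unfolding ebar_eq[abs_def] using directions_O mix_coeff_O[OF order.refl]
  by (intro is_O_diff[OF X_O] is_O_sum is_O_scaleR_bounded) auto

lemma rbar_ebar_O: "is_O 2 (\<lambda>w. rbar w + A *v ebar w)"
proof (rule is_O_cong)
  show "is_O 2 (\<lambda>w. (R w n + A *v (X w n - xs))
      - (\<Sum>i<n. mix_coeff n w i *\<^sub>R (Q w (Suc i) + A *v P w (Suc i))))"
    using directions_O mix_coeff_O[OF order.refl] R_O
    by (intro is_O_diff is_O_sum is_O_scaleR_bounded) auto
  have "rbar w + A *v ebar w = (R w n + A *v (X w n - xs))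
      - (\<Sum>i<n. mix_coeff n w i *\<^sub>R (Q w (Suc i) + A *v P w (Suc i)))" for w
  proof -
    have "A *v ebar w = A *v (X w n - xs) - (\<Sum>i<n. mix_coeff n w i *\<^sub>R (A *v P w (Suc i)))"
      unfolding ebar_eq
      by (simp only: matrix_vector_mult_diff_distrib[of A "X w n - xs"] linear_sum[of "(*v) A"]
          matrix_vector_mult_scaleR matrix_vector_mul_linear)
    then show ?thesis by (simp add: rbar_eq scaleR_add_right sum.distrib algebra_simps)
  qed
  then show "\<forall>\<^sub>F w in F. rbar w + A *v ebar w = (R w n + A *v (X w n - xs))
      - (\<Sum>i<n. mix_coeff n w i *\<^sub>R (Q w (Suc i) + A *v P w (Suc i)))" by simp
qed

lemma next_iterate: "\<forall>\<^sub>F w in F. X w (Suc n) - xs = ebar w + B w n *\<^sub>R rbar w"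
  using block by eventually_elim (simp add: am_block_step[of ty n] ebar_def rbar_def)

lemma next_iterate_O: "is_O 1 (\<lambda>w. X w (Suc n) - xs)"
  by (rule is_O_cong[OF _ next_iterate]) (intro is_O_add ebar_O is_O_scaleR_bounded rbar_O B_O)

lemma tests_orthogonal:
  "\<forall>\<^sub>F w in F. (\<forall>j<n. \<forall>i<j. inner (V w (Suc i)) (Q w (Suc j)) = 0)
     \<and> (\<forall>i<n. inner (V w (Suc i)) (rbar w) = 0 \<and> inner (V w (Suc i)) (Q w (Suc i)) \<noteq> 0)"
proof -
  obtain c where c: "0 < c" "\<forall>\<^sub>F w in F. \<forall>i<n. c * (E w)\<^sup>2 \<le> \<bar>inner (V w (Suc i)) (Q w (Suc i))\<bar>"
    by (rule denominator_lower)
  from c(2) block E_pos show ?thesis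
  proof eventually_elim
    case (elim w)
    have "0 < c * (E w)\<^sup>2" using c(1) elim(3) by simp
    then have nz: "inner (V w (Suc i)) (Q w (Suc i)) \<noteq> 0" if "i < n" for i
      using elim(1) that by fastforce
    from am_block_orthogonal[OF elim(2) nz] nz show ?case by (simp add: rbar_def)
  qed
qed

text \<open>Each new direction combines the preceding ones, the residual \<open>r\<^sub>s\<close>, and images under \<open>A\<close> of the
  preceding ones, with coefficients \<open>O(1)\<close>, up to \<open>O(E\<^sup>2)\<close>.\<close>

lemma near_krylov_directions:
  assumes W: "near_krylov A W 1 (\<lambda>w. R w 0)"
  shows "j \<le> n \<Longrightarrow> near_krylov A W j (\<lambda>w. X w j - X w 0)
    \<and> (\<forall>i<j. near_krylov A W (Suc i) (\<lambda>w. P w (Suc i)))"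
proof (induction j)
  case 0
  show ?case by (simp add: near_krylov_is_O2 is_O_zero)
next
  case (Suc j)
  then have X: "near_krylov A W j (\<lambda>w. X w j - X w 0)"
    and P: "\<And>i. i < j \<Longrightarrow> near_krylov A W (Suc i) (\<lambda>w. P w (Suc i))" by auto
  have j: "j < n" using Suc.prems by simp
  have R: "near_krylov A W (Suc j) (\<lambda>w. R w j)"
  proof -
    have "near_krylov A W (Suc j) (\<lambda>w. R w j - R w 0 + A *v (X w j - X w 0))"
      using R_diff_O[of j 0] j by (simp add: near_krylov_is_O2)
    moreover have "near_krylov A W (Suc j) (\<lambda>w. R w 0)"
      by (rule near_krylov_mono[OF W]) simp
    ultimately have "near_krylov A W (Suc j) (\<lambda>w. (R w j - R w 0 + A *v (X w j - X w 0)) + R w 0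
        - A *v (X w j - X w 0))"
      by (rule near_krylov_diff[OF near_krylov_add near_krylov_mult[OF X]])
    then show ?thesis by simp
  qed
  have Q: "near_krylov A W (Suc j) (\<lambda>w. Q w (Suc i))" if "i < j" for i
  proof -
    have "near_krylov A W (Suc j) (\<lambda>w. Q w (Suc i) + A *v P w (Suc i))"
      using directions_O[of i] that j by (simp add: near_krylov_is_O2)
    moreover have "near_krylov A W (Suc j) (\<lambda>w. A *v P w (Suc i))"
      by (rule near_krylov_mono[OF near_krylov_mult[OF P[OF that]]]) (use that in simp)
    ultimately have "near_krylov A W (Suc j) (\<lambda>w. (Q w (Suc i) + A *v P w (Suc i)) - A *v P w (Suc i))"
      by (rule near_krylov_diff)
    then show ?thesis by simp
  qed
  have P': "near_krylov A W (Suc j) (\<lambda>w. P w (Suc i))" if "i < j" for i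
    using near_krylov_mono[OF P[OF that]] that by simp
  have "\<forall>\<^sub>F w in F. X w (Suc j) - X w j = - (\<Sum>i<j. mix_coeff j w i *\<^sub>R P w (Suc i))
      + B w j *\<^sub>R (R w j - (\<Sum>i<j. mix_coeff j w i *\<^sub>R Q w (Suc i)))"
    using block by eventually_elim
      (use j in \<open>simp add: am_block_step[of ty n] fst_am_sweep snd_am_sweep\<close>)
  then have step: "near_krylov A W (Suc j) (\<lambda>w. X w (Suc j) - X w j)"
  proof (rule near_krylov_cong[rotated])
    have "near_krylov A W (Suc j) (\<lambda>w. \<Sum>i<j. mix_coeff j w i *\<^sub>R P w (Suc i))"
      using j by (intro near_krylov_sum near_krylov_scaleR mix_coeff_O P') auto
    moreover have "near_krylov A W (Suc j) (\<lambda>w. \<Sum>i<j. mix_coeff j w i *\<^sub>R Q w (Suc i))"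
      using j by (intro near_krylov_sum near_krylov_scaleR mix_coeff_O Q) auto
    ultimately show "near_krylov A W (Suc j) (\<lambda>w. - (\<Sum>i<j. mix_coeff j w i *\<^sub>R P w (Suc i))
        + B w j *\<^sub>R (R w j - (\<Sum>i<j. mix_coeff j w i *\<^sub>R Q w (Suc i))))"
      by (rule near_krylov_add[OF near_krylov_minus
            near_krylov_scaleR[OF B_O near_krylov_diff[OF R]]])
  qed
  have X': "near_krylov A W (Suc j) (\<lambda>w. X w (Suc j) - X w 0)"
    using near_krylov_add[OF step near_krylov_mono[OF X]] by simp
  have c: "is_O 0 (\<lambda>w. dir_coeff j w l)" if "l < j" for l
    by (rule sweep_coeff_O[where j = j])
      (use directions_O j that is_O_diff[OF R_O1 R_O1, of "Suc j" j] in auto)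
  have "\<forall>\<^sub>F w in F. P w (Suc j) = X w (Suc j) - X w j - (\<Sum>l<j. dir_coeff j w l *\<^sub>R P w (Suc l))"
    using block by eventually_elim (rule am_block_direction(1)[OF _ j])
  then have "near_krylov A W (Suc j) (\<lambda>w. P w (Suc j))"
  proof (rule near_krylov_cong[rotated])
    have "near_krylov A W (Suc j) (\<lambda>w. \<Sum>l<j. dir_coeff j w l *\<^sub>R P w (Suc l))"
      by (intro near_krylov_sum near_krylov_scaleR c P') auto
    with step show "near_krylov A W (Suc j)
        (\<lambda>w. X w (Suc j) - X w j - (\<Sum>l<j. dir_coeff j w l *\<^sub>R P w (Suc l)))"
      by (rule near_krylov_diff)
  qed
  with P X' show ?case by (auto simp: less_Suc_eq)
qed

end

section \<open>Approximation of the Krylov space; Type II and full blocks\<close>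

context am_family
begin

lemma directions_near_krylov_elements:
  assumes W: "near_krylov A W 1 (\<lambda>w. R w 0)"
  obtains u C where "0 < C" "\<forall>w. \<forall>i<n. u i w \<in> krylov A n (W w)"
    "\<forall>\<^sub>F w in F. \<forall>i<n. norm (P w (Suc i) - u i w) \<le> C * (E w)\<^sup>2"
proof -
  have "\<forall>i\<in>{..<n}. \<exists>u. (\<forall>w. u w \<in> krylov A n (W w)) \<and> is_O 2 (\<lambda>w. P w (Suc i) - u w)"
  proof
    fix i assume i: "i \<in> {..<n}"
    then have "near_krylov A W (Suc i) (\<lambda>w. P w (Suc i))"
      using near_krylov_directions[OF W order.refl] by simp
    then have "near_krylov A W n (\<lambda>w. P w (Suc i))"
      by (rule near_krylov_mono) (use i in auto)
    then show "\<exists>u. (\<forall>w. u w \<in> krylov A n (W w)) \<and> is_O 2 (\<lambda>w. P w (Suc i) - u w)"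
      by (simp add: near_krylov_def)
  qed
  from bchoice[OF this] obtain u where u: "\<And>i w. i < n \<Longrightarrow> u i w \<in> krylov A n (W w)"
    "\<And>i. i < n \<Longrightarrow> is_O 2 (\<lambda>w. P w (Suc i) - u i w)" by auto
  obtain C where C: "0 < C" "\<forall>\<^sub>F w in F. \<forall>i<n. norm (P w (Suc i) - u i w) \<le> C * (E w)\<^sup>2"
    by (rule is_O_uniform[OF u(2)])
  have "\<forall>w. \<forall>i<n. u i w \<in> krylov A n (W w)" using u(1) by simp
  then show ?thesis by (rule that[OF C(1) _ C(2)])
qed

text \<open>Let \<open>u\<^sub>i\<close> be the Krylov elements next to the directions. For every combination,
  \<open>(\<Sum>i. a\<^sub>i q\<^sub>i) = - A (\<Sum>i. a\<^sub>i u\<^sub>i) + O(E\<^sup>2) (\<Sum>i. \<bar>a\<^sub>i\<bar>)\<close>, and the left side bounds \<open>E (\<Sum>i. \<bar>a\<^sub>i\<bar>)\<close>.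
  For small \<open>E\<close> the error term is absorbed, so the \<open>u\<^sub>i\<close> are independent; as there are \<open>n\<close> of them in
  a space of dimension at most \<open>n\<close>, they span it, with coefficients under control.\<close>

lemma krylov_approximation:
  assumes W: "near_krylov A W 1 (\<lambda>w. R w 0)"
  obtains C where "0 < C" "\<forall>\<^sub>F w in F. \<forall>z\<in>krylov A n (W w). \<exists>a.
    norm (z - (\<Sum>i<n. a i *\<^sub>R P w (Suc i))) \<le> C * E w * norm z \<and> (\<Sum>i<n. \<bar>a i\<bar>) * E w \<le> C * norm z"
proof -
  obtain u C3 where C3: "0 < C3" "\<forall>w. \<forall>i<n. u i w \<in> krylov A n (W w)"
    "\<forall>\<^sub>F w in F. \<forall>i<n. norm (P w (Suc i) - u i w) \<le> C3 * (E w)\<^sup>2"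
    by (rule directions_near_krylov_elements[OF W])
  obtain D1 where D1: "0 < D1" "\<forall>\<^sub>F w in F. \<forall>i<n. norm (P w (Suc i)) \<le> D1 * E w ^ 1"
    by (rule is_O_uniform[OF P_O])
  obtain D2 where D2: "0 < D2" "\<forall>\<^sub>F w in F. \<forall>i<n. norm (Q w (Suc i)) \<le> D2 * E w ^ 1"
    by (rule is_O_uniform[OF Q_O])
  obtain C4 where C4: "0 < C4" "\<forall>\<^sub>F w in F. \<forall>i<n. norm (Q w (Suc i) + A *v P w (Suc i)) \<le> C4 * (E w)\<^sup>2"
    by (rule is_O_uniform[OF Q_A_P_O])
  obtain c where c: "0 < c" "\<forall>\<^sub>F w in F. \<forall>i<n. c * (E w)\<^sup>2 \<le> \<bar>inner (V w (Suc i)) (Q w (Suc i))\<bar>"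
    by (rule denominator_lower)
  define D where "D = D1 + D2"
  have D: "0 < D" using D1 D2 by (simp add: D_def)
  define K where "K = real n * (D / c * (1 + D\<^sup>2 / c) ^ n)"
  have K: "0 \<le> K" using D c by (simp add: K_def)
  define C2 where "C2 = C4 + L * C3"
  have C2: "0 < C2" using C4 C3 L by (simp add: C2_def add_pos_pos)
  define M where "M = 2 * K * L"
  have M: "0 \<le> M" using K L by (simp add: M_def)
  have "0 < 1 / (2 * (K * C2 + 1))" using K C2 by (simp add: add_nonneg_pos)
  from eventually_E_le[OF this] E_pos c(2) D1(2) D2(2) C4(2) C3(3) tests_orthogonal
  have "\<forall>\<^sub>F w in F. \<forall>z\<in>krylov A n (W w). \<exists>a.
    norm (z - (\<Sum>i<n. a i *\<^sub>R P w (Suc i))) \<le> (M * (C3 + 1) + 1) * E w * norm z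
    \<and> (\<Sum>i<n. \<bar>a i\<bar>) * E w \<le> (M * (C3 + 1) + 1) * norm z"
  proof eventually_elim
    case (elim w)
    \<comment> \<open>This choice of \<open>E\<close> lets the error term take at most half of the left side.\<close>
    have small: "K * C2 * E w \<le> 1 / 2"
    proof -
      have "(K * C2 + 1) * E w \<le> (K * C2 + 1) * (1 / (2 * (K * C2 + 1)))"
        using elim(1) K C2 by (intro mult_left_mono) auto
      also have "\<dots> = 1 / 2" using K C2 by (simp add: field_simps add_nonneg_eq_0_iff)
      finally show ?thesis using elim(2) by (simp add: algebra_simps)
    qed
    have Vb: "norm (V w (Suc i)) \<le> D * E w" and Qb: "norm (Q w (Suc i)) \<le> D * E w" if "i < n" for i
    proof -
      have "0 \<le> D1 * E w" "0 \<le> D2 * E w" using D1 D2 elim(2) by auto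
      moreover have "norm (P w (Suc i)) \<le> D1 * E w" using elim(4) that by simp
      moreover have "norm (Q w (Suc i)) \<le> D2 * E w" using elim(5) that by simp
      ultimately show "norm (V w (Suc i)) \<le> D * E w" "norm (Q w (Suc i)) \<le> D * E w"
        by (cases ty; simp add: am_test_def D_def distrib_right)+
    qed
    have coeff: "(\<Sum>i<n. \<bar>a i\<bar>) * E w \<le> M * norm (\<Sum>i<n. a i *\<^sub>R u i w)" for a
    proof -
      define S where "S = (\<Sum>i<n. \<bar>a i\<bar>)"
      have S: "0 \<le> S" by (simp add: S_def sum_nonneg)
      have 1: "\<bar>a i\<bar> * E w \<le> D / c * (1 + D\<^sup>2 / c) ^ n * norm (\<Sum>j<n. a j *\<^sub>R Q w (Suc j))" if "i < n" for i
      proof -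
        have "\<bar>a i\<bar> * E w \<le> D / c * (1 + D\<^sup>2 / c) ^ i * norm (\<Sum>j<n. a j *\<^sub>R Q w (Suc j))"
        proof (rule triangular_coefficient_bound[where v = "\<lambda>i. V w (Suc i)"])
          show "inner (V w (Suc i)) (Q w (Suc j)) = 0" if "i < j" "j < n" for i j
            using elim(8) that by blast
          show "c * (E w)\<^sup>2 \<le> \<bar>inner (V w (Suc i)) (Q w (Suc i))\<bar>" if "i < n" for i
            using elim(3) that by blast
        qed (use elim(2) D c(1) that Vb Qb in auto)
        also have "\<dots> \<le> D / c * (1 + D\<^sup>2 / c) ^ n * norm (\<Sum>j<n. a j *\<^sub>R Q w (Suc j))"
          using D c(1) that by (intro mult_right_mono mult_left_mono power_increasing) auto
        finally show ?thesis .
      qed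
      have "S * E w = (\<Sum>i<n. \<bar>a i\<bar> * E w)" by (simp add: S_def sum_distrib_right)
      also have "\<dots> \<le> (\<Sum>i<n. D / c * (1 + D\<^sup>2 / c) ^ n * norm (\<Sum>j<n. a j *\<^sub>R Q w (Suc j)))"
        using 1 by (intro sum_mono) auto
      finally have 2: "S * E w \<le> K * norm (\<Sum>j<n. a j *\<^sub>R Q w (Suc j))" by (simp add: K_def mult.assoc)
      have "(\<Sum>j<n. a j *\<^sub>R Q w (Suc j))
          = (\<Sum>j<n. a j *\<^sub>R (Q w (Suc j) + A *v u j w)) - A *v (\<Sum>j<n. a j *\<^sub>R u j w)"
        by (simp add: scaleR_add_right sum.distrib linear_sum[of "(*v) A"] matrix_vector_mult_scaleR)
      also have "norm \<dots> \<le> norm (\<Sum>j<n. a j *\<^sub>R (Q w (Suc j) + A *v u j w)) + L * norm (\<Sum>j<n. a j *\<^sub>R u j w)"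
        by (rule order_trans[OF norm_triangle_ineq4 add_left_mono[OF A_le]])
      also have "norm (\<Sum>j<n. a j *\<^sub>R (Q w (Suc j) + A *v u j w)) \<le> (\<Sum>j<n. \<bar>a j\<bar> * (C2 * (E w)\<^sup>2))"
      proof (rule sum_norm_le)
        fix j assume "j \<in> {..<n}"
        then have j: "j < n" by simp
        have "Q w (Suc j) + A *v u j w
            = (Q w (Suc j) + A *v P w (Suc j)) - A *v (P w (Suc j) - u j w)"
          by (simp add: matrix_vector_mult_diff_distrib)
        also have "norm \<dots> \<le> C4 * (E w)\<^sup>2 + L * (C3 * (E w)\<^sup>2)"
        proof (rule order_trans[OF norm_triangle_ineq4 add_mono])
          show "norm (Q w (Suc j) + A *v P w (Suc j)) \<le> C4 * (E w)\<^sup>2" using elim(6) j by blast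
          have "norm (P w (Suc j) - u j w) \<le> C3 * (E w)\<^sup>2" using elim(7) j by blast
          then show "norm (A *v (P w (Suc j) - u j w)) \<le> L * (C3 * (E w)\<^sup>2)"
            using L by (intro order_trans[OF A_le] mult_left_mono) auto
        qed
        also have "\<dots> = C2 * (E w)\<^sup>2" by (simp add: C2_def distrib_right mult.assoc)
        finally show "norm (a j *\<^sub>R (Q w (Suc j) + A *v u j w)) \<le> \<bar>a j\<bar> * (C2 * (E w)\<^sup>2)"
          by (simp add: mult_left_mono)
      qed
      also have "(\<Sum>j<n. \<bar>a j\<bar> * (C2 * (E w)\<^sup>2)) = S * (C2 * (E w)\<^sup>2)" by (simp add: S_def sum_distrib_right)
      finally have "S * E w \<le> K * (S * (C2 * (E w)\<^sup>2) + L * norm (\<Sum>j<n. a j *\<^sub>R u j w))"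
        by (rule order_trans[OF 2 mult_left_mono[OF _ K]]) simp
      also have "\<dots> = (K * C2 * E w) * (S * E w) + K * L * norm (\<Sum>j<n. a j *\<^sub>R u j w)"
        by (simp add: algebra_simps power2_eq_square)
      also have "(K * C2 * E w) * (S * E w) \<le> 1 / 2 * (S * E w)"
        using small S elim(2) by (intro mult_right_mono) auto
      finally show ?thesis by (simp add: S_def M_def)
    qed
    show ?case
    proof
      fix z assume z: "z \<in> krylov A n (W w)"
      obtain a where a: "z = (\<Sum>i<n. a i *\<^sub>R u i w)"
      proof (rule family_spans_subspace[OF _ dim_krylov_le _ z])
        show "u i w \<in> krylov A n (W w)" if "i < n" for i using C3(2) that by blast
        show "\<forall>i<n. a i = 0" if "(\<Sum>i<n. a i *\<^sub>R u i w) = 0" for a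
        proof -
          have "(\<Sum>i<n. \<bar>a i\<bar>) \<le> 0" using coeff[of a] that elim(2) by (simp add: mult_le_0_iff)
          then have "(\<Sum>i<n. \<bar>a i\<bar>) = 0" by (simp add: sum_nonneg order_antisym)
          then show ?thesis by (simp add: sum_nonneg_eq_0_iff)
        qed
      qed (use that in blast)
      have S: "(\<Sum>i<n. \<bar>a i\<bar>) * E w \<le> M * norm z" unfolding a by (rule coeff)
      have "z - (\<Sum>i<n. a i *\<^sub>R P w (Suc i)) = (\<Sum>i<n. a i *\<^sub>R (u i w - P w (Suc i)))"
        by (simp add: a sum_subtractf algebra_simps)
      also have "norm \<dots> \<le> (\<Sum>i<n. \<bar>a i\<bar> * (C3 * (E w)\<^sup>2))"
        using elim(7) by (intro sum_norm_le) (auto intro!: mult_left_mono simp: norm_minus_commute)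
      also have "\<dots> = C3 * E w * ((\<Sum>i<n. \<bar>a i\<bar>) * E w)"
        by (simp add: sum_distrib_left sum_distrib_right power2_eq_square algebra_simps)
      also have "\<dots> \<le> C3 * E w * (M * norm z)"
        using S C3(1) elim(2) by (intro mult_left_mono) auto
      also have "\<dots> = (M * C3) * (E w * norm z)" by (simp add: algebra_simps)
      also have "\<dots> \<le> (M * (C3 + 1) + 1) * (E w * norm z)"
        using M elim(2) by (intro mult_right_mono) (auto simp: algebra_simps)
      finally have "norm (z - (\<Sum>i<n. a i *\<^sub>R P w (Suc i))) \<le> (M * (C3 + 1) + 1) * E w * norm z"
        by (simp add: mult.assoc)
      moreover have "(\<Sum>i<n. \<bar>a i\<bar>) * E w \<le> (M * (C3 + 1) + 1) * norm z"
      proof -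
        have "M * norm z \<le> (M * (C3 + 1) + 1) * norm z"
          using M C3(1) by (intro mult_right_mono) (auto simp: algebra_simps)
        with S show ?thesis by linarith
      qed
      ultimately show "\<exists>a. norm (z - (\<Sum>i<n. a i *\<^sub>R P w (Suc i))) \<le> (M * (C3 + 1) + 1) * E w * norm z
        \<and> (\<Sum>i<n. \<bar>a i\<bar>) * E w \<le> (M * (C3 + 1) + 1) * norm z" by blast
    qed
  qed
  moreover have "0 < M * (C3 + 1) + 1" using M C3(1) by (simp add: add_nonneg_pos)
  ultimately show ?thesis by (rule that[rotated])
qed

lemma near_krylov_R0: "near_krylov A (\<lambda>w. R w 0) 1 (\<lambda>w. R w 0)"
  unfolding near_krylov_def
  by (intro exI[of _ "\<lambda>w. R w 0"]) (use krylov_start[of _ A 0] in \<open>simp add: is_O_zero\<close>)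

text \<open>Up to \<open>O(E\<^sup>2)\<close>, \<open>r\<^sub>s = - A e\<^sub>s\<close>.\<close>

lemma near_krylov_linear_R0: "near_krylov A (\<lambda>w. A *v (X w 0 - xs)) 1 (\<lambda>w. R w 0)"
  unfolding near_krylov_def
proof (intro exI[of _ "\<lambda>w. - (A *v (X w 0 - xs))"] conjI allI)
  show "- (A *v (X w 0 - xs)) \<in> krylov A 1 (A *v (X w 0 - xs))" for w
    using krylov_start[of _ A 0] by (simp add: subspace_krylov subspace_neg)
  show "is_O 2 (\<lambda>w. R w 0 - - (A *v (X w 0 - xs)))" using R_O[of 0] by simp
qed

lemma theta_le: "\<forall>\<^sub>F w in F. spectral_norm (mat 1 - B w n *\<^sub>R A) \<le> 1 + \<beta>hi * L"
  using B
proof eventually_elim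
  case (elim w)
  then have b: "0 \<le> B w n" "B w n \<le> \<beta>hi" using \<beta>lo by (auto intro: order.trans[of 0 \<beta>lo])
  show ?case
  proof (rule spectral_norm_le)
    fix v
    have "norm ((mat 1 - B w n *\<^sub>R A) *v v) \<le> norm v + B w n * norm (A *v v)"
      using b(1) norm_triangle_ineq4[of v "B w n *\<^sub>R (A *v v)"]
      by (simp add: matrix_vector_mult_diff_rdistrib scaleR_matrix_vector_assoc[symmetric])
    also have "\<dots> \<le> norm v + \<beta>hi * (L * norm v)"
      using b A_le by (intro add_left_mono mult_mono) auto
    finally show "norm ((mat 1 - B w n *\<^sub>R A) *v v) \<le> (1 + \<beta>hi * L) * norm v"
      by (simp add: algebra_simps)
  qed
qed

text \<open>As \<open>\<theta>\<^sub>k\<close> is bounded, a quadratic error in the factor of \<open>\<theta>\<^sub>k\<close> remains a quadratic error.\<close>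

lemma is_O_absorb_theta:
  assumes "\<forall>\<^sub>F w in F. f w \<le> spectral_norm (mat 1 - B w n *\<^sub>R A) * g w + C * (E w)\<^sup>2"
    and "\<forall>\<^sub>F w in F. g w \<le> h w + D * (E w)\<^sup>2"
  shows "\<exists>C. \<forall>\<^sub>F w in F. f w \<le> spectral_norm (mat 1 - B w n *\<^sub>R A) * h w + C * (E w)\<^sup>2"
proof (rule exI)
  show "\<forall>\<^sub>F w in F. f w \<le> spectral_norm (mat 1 - B w n *\<^sub>R A) * h w
      + ((1 + \<beta>hi * L) * \<bar>D\<bar> + C) * (E w)\<^sup>2"
    using assms theta_le
  proof eventually_elim
    case (elim w)
    let ?t = "spectral_norm (mat 1 - B w n *\<^sub>R A)"
    have "D * (E w)\<^sup>2 \<le> \<bar>D\<bar> * (E w)\<^sup>2" by (simp add: mult_right_mono)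
    then have "g w \<le> h w + \<bar>D\<bar> * (E w)\<^sup>2" using elim(2) by linarith
    then have "?t * g w \<le> ?t * (h w + \<bar>D\<bar> * (E w)\<^sup>2)"
      by (intro mult_left_mono spectral_norm_nonneg)
    also have "\<dots> = ?t * h w + ?t * (\<bar>D\<bar> * (E w)\<^sup>2)" by (simp add: distrib_left)
    also have "?t * (\<bar>D\<bar> * (E w)\<^sup>2) \<le> (1 + \<beta>hi * L) * (\<bar>D\<bar> * (E w)\<^sup>2)"
      using elim(3) by (intro mult_right_mono) auto
    finally show ?case using elim(1) by (simp add: algebra_simps)
  qed
qed

text \<open>Since \<open>rbar = - A ebar\<close> up to \<open>O(E\<^sup>2)\<close>, the step \<open>ebar + \<beta> rbar\<close> multiplies both the error and
  the residual by \<open>I - \<beta> A\<close>.\<close>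

lemma next_residual_le:
  obtains C where "\<forall>\<^sub>F w in F. norm (A *v (X w (Suc n) - xs))
    \<le> spectral_norm (mat 1 - B w n *\<^sub>R A) * norm (rbar w) + C * (E w)\<^sup>2"
proof -
  obtain C where C: "\<forall>\<^sub>F w in F. norm (rbar w + A *v ebar w) \<le> C * (E w)\<^sup>2"
    using rbar_ebar_O by (rule is_OE)
  have "\<forall>\<^sub>F w in F. norm (A *v (X w (Suc n) - xs))
    \<le> spectral_norm (mat 1 - B w n *\<^sub>R A) * norm (rbar w) + C * (E w)\<^sup>2"
    using C next_iterate
  proof eventually_elim
    case (elim w)
    have "A *v (X w (Suc n) - xs) = (rbar w + A *v ebar w) - (mat 1 - B w n *\<^sub>R A) *v rbar w"
      unfolding elim(2)
      by (simp add: matrix_vector_mult_diff_rdistrib matrix_vector_right_distrib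
          matrix_vector_mult_scaleR scaleR_matrix_vector_assoc)
    also have "norm \<dots> \<le> C * (E w)\<^sup>2 + spectral_norm (mat 1 - B w n *\<^sub>R A) * norm (rbar w)"
      using elim(1) by (rule order_trans[OF norm_triangle_ineq4 add_mono[OF _ norm_mult_spectral_norm]])
    finally show ?case by simp
  qed
  then show ?thesis by (rule that)
qed

lemma next_error_le:
  obtains C where "\<forall>\<^sub>F w in F. norm (X w (Suc n) - xs)
    \<le> spectral_norm (mat 1 - B w n *\<^sub>R A) * norm (ebar w) + C * (E w)\<^sup>2"
proof -
  have "is_O 2 (\<lambda>w. B w n *\<^sub>R (rbar w + A *v ebar w))"
    by (intro is_O_scaleR_bounded B_O rbar_ebar_O)
  then obtain C where C: "\<forall>\<^sub>F w in F. norm (B w n *\<^sub>R (rbar w + A *v ebar w)) \<le> C * (E w)\<^sup>2"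
    by (rule is_OE)
  have "\<forall>\<^sub>F w in F. norm (X w (Suc n) - xs)
    \<le> spectral_norm (mat 1 - B w n *\<^sub>R A) * norm (ebar w) + C * (E w)\<^sup>2"
    using C next_iterate
  proof eventually_elim
    case (elim w)
    have "X w (Suc n) - xs = B w n *\<^sub>R (rbar w + A *v ebar w) + (mat 1 - B w n *\<^sub>R A) *v ebar w"
      unfolding elim(2)
      by (simp add: matrix_vector_mult_diff_rdistrib scaleR_add_right scaleR_matrix_vector_assoc)
    also have "norm \<dots> \<le> C * (E w)\<^sup>2 + spectral_norm (mat 1 - B w n *\<^sub>R A) * norm (ebar w)"
      using elim(1) by (rule order_trans[OF norm_triangle_ineq add_mono[OF _ norm_mult_spectral_norm]])
    finally show ?case by simp
  qed
  then show ?thesis by (rule that)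
qed

text \<open>The vector \<open>rbar\<close> lies in \<open>r\<^sub>s + span {q\<^sub>i}\<close> and is orthogonal to the \<open>q\<^sub>i\<close>, so it has minimal norm
  there. The optimal Krylov vector is \<open>r\<^sub>s + A z\<close> with \<open>\<parallel>z\<parallel> = O(E)\<close>; if \<open>z\<close> is approximated by
  \<open>\<Sum>i. a\<^sub>i p\<^sub>i\<close>, then \<open>r\<^sub>s - (\<Sum>i. a\<^sub>i q\<^sub>i)\<close> competes and is within \<open>O(E\<^sup>2)\<close> of the optimum.\<close>

lemma type_II_residual_minimal:
  assumes ty: "ty = Type_II"
  obtains C where "\<forall>\<^sub>F w in F. norm (rbar w) \<le> krylov_min A n (R w 0) + C * (E w)\<^sup>2"
proof -
  obtain C where C: "0 < C" "\<forall>\<^sub>F w in F. \<forall>z\<in>krylov A n (R w 0). \<exists>a.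
    norm (z - (\<Sum>i<n. a i *\<^sub>R P w (Suc i))) \<le> C * E w * norm z \<and> (\<Sum>i<n. \<bar>a i\<bar>) * E w \<le> C * norm z"
    by (rule krylov_approximation[OF near_krylov_R0])
  obtain C4 where C4: "0 < C4" "\<forall>\<^sub>F w in F. \<forall>i<n. norm (Q w (Suc i) + A *v P w (Suc i)) \<le> C4 * (E w)\<^sup>2"
    by (rule is_O_uniform[OF Q_A_P_O])
  obtain D where D: "0 < D" "\<forall>\<^sub>F w in F. norm (R w 0) \<le> D * E w ^ 1"
    by (rule is_OE[OF R_O1[OF le0]])
  have "\<forall>\<^sub>F w in F. norm (rbar w) \<le> krylov_min A n (R w 0) + ((L + C4) * C * (2 * D / \<mu>)) * (E w)\<^sup>2"
    using C(2) C4(2) D(2) E_pos block tests_orthogonal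
  proof eventually_elim
    case (elim w)
    obtain z where z: "z \<in> krylov A n (R w 0)" "norm (R w 0 + A *v z) = krylov_min A n (R w 0)"
      by (rule krylov_min_realized)
    have "\<mu> * norm z \<le> norm (A *v z)" by (rule A_ge)
    also have "\<dots> \<le> norm (R w 0 + A *v z) + norm (R w 0)"
      by (metis norm_triangle_ineq4 add_diff_cancel_left')
    also have "\<dots> \<le> 2 * (D * E w)" using z(2) krylov_min_le_norm[of A n "R w 0"] elim(3) by simp
    finally have nz: "norm z \<le> 2 * D / \<mu> * E w" using \<mu> by (simp add: field_simps)
    obtain a where a: "norm (z - (\<Sum>i<n. a i *\<^sub>R P w (Suc i))) \<le> C * E w * norm z"
      "(\<Sum>i<n. \<bar>a i\<bar>) * E w \<le> C * norm z" using elim(1) z(1) by blast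
    define y where "y = (\<Sum>i<n. a i *\<^sub>R Q w (Suc i))"
    define T where "T = span {Q w (Suc i) | i. i < n}"
    have "A *v z + y = A *v (z - (\<Sum>i<n. a i *\<^sub>R P w (Suc i)))
        + (\<Sum>i<n. a i *\<^sub>R (Q w (Suc i) + A *v P w (Suc i)))"
      by (simp add: y_def matrix_vector_mult_diff_distrib linear_sum[of "(*v) A"]
          matrix_vector_mult_scaleR scaleR_add_right sum.distrib)
    also have "norm \<dots> \<le> L * (C * E w * norm z) + (\<Sum>i<n. \<bar>a i\<bar> * (C4 * (E w)\<^sup>2))"
    proof (rule order_trans[OF norm_triangle_ineq add_mono])
      show "norm (A *v (z - (\<Sum>i<n. a i *\<^sub>R P w (Suc i)))) \<le> L * (C * E w * norm z)"
        using a(1) L by (intro order_trans[OF A_le] mult_left_mono) auto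
      show "norm (\<Sum>i<n. a i *\<^sub>R (Q w (Suc i) + A *v P w (Suc i)))
          \<le> (\<Sum>i<n. \<bar>a i\<bar> * (C4 * (E w)\<^sup>2))"
        using elim(2) by (intro sum_norm_le) (auto intro!: mult_left_mono)
    qed
    also have "(\<Sum>i<n. \<bar>a i\<bar> * (C4 * (E w)\<^sup>2)) = C4 * E w * ((\<Sum>i<n. \<bar>a i\<bar>) * E w)"
      by (simp add: sum_distrib_left sum_distrib_right power2_eq_square algebra_simps)
    also have "\<dots> \<le> C4 * E w * (C * norm z)"
      using a(2) C4(1) elim(4) by (intro mult_left_mono) auto
    also have "L * (C * E w * norm z) + C4 * E w * (C * norm z) = (L + C4) * C * E w * norm z"
      by (simp add: algebra_simps)
    also have "\<dots> \<le> (L + C4) * C * E w * (2 * D / \<mu> * E w)"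
      using nz L C4(1) C(1) elim(4) by (intro mult_left_mono) auto
    finally have y: "norm (A *v z + y) \<le> ((L + C4) * C * (2 * D / \<mu>)) * (E w)\<^sup>2"
      by (simp add: power2_eq_square mult_ac)
    have yT: "y \<in> T" unfolding y_def T_def by (intro span_sum span_scale span_base) auto
    have "(\<Sum>i<n. mix_coeff n w i *\<^sub>R Q w (Suc i)) \<in> T"
      unfolding T_def by (intro span_sum span_scale span_base) auto
    moreover have "R w n - R w 0 \<in> T"
      unfolding T_def by (rule am_block_residual_span[OF elim(5)]) simp
    ultimately have "(\<Sum>i<n. mix_coeff n w i *\<^sub>R Q w (Suc i)) - (R w n - R w 0) - y \<in> T"
      using yT unfolding T_def by (simp only: span_diff)
    then have d: "R w 0 - y - rbar w \<in> T" by (simp add: rbar_eq algebra_simps)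
    have "orthogonal (rbar w) (R w 0 - y - rbar w)"
    proof (rule orthogonal_to_span[OF d[unfolded T_def]])
      fix q assume "q \<in> {Q w (Suc i) | i. i < n}"
      then show "orthogonal (rbar w) q"
        using elim(6) by (auto simp: ty am_test_def orthogonal_def inner_commute)
    qed
    from norm_add_Pythagorean[OF this]
    have "(norm (rbar w))\<^sup>2 \<le> (norm (R w 0 - y))\<^sup>2" by simp
    then have "norm (rbar w) \<le> norm (R w 0 - y)" by (rule power2_le_imp_le) simp
    also have "R w 0 - y = (R w 0 + A *v z) - (A *v z + y)" by simp
    also have "norm \<dots> \<le> krylov_min A n (R w 0) + ((L + C4) * C * (2 * D / \<mu>)) * (E w)\<^sup>2"
      using y z(2) norm_triangle_ineq4[of "R w 0 + A *v z" "A *v z + y"] by linarith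
    finally show ?case .
  qed
  then show ?thesis by (rule that)
qed

lemma type_II_block:
  assumes "ty = Type_II"
  shows "\<exists>C. \<forall>\<^sub>F w in F. norm (A *v (X w (Suc n) - xs))
    \<le> spectral_norm (mat 1 - B w n *\<^sub>R A) * krylov_min A n (R w 0) + C * (E w)\<^sup>2"
proof -
  obtain C where C: "\<forall>\<^sub>F w in F. norm (A *v (X w (Suc n) - xs))
    \<le> spectral_norm (mat 1 - B w n *\<^sub>R A) * norm (rbar w) + C * (E w)\<^sup>2"
    by (rule next_residual_le)
  obtain D where D: "\<forall>\<^sub>F w in F. norm (rbar w) \<le> krylov_min A n (R w 0) + D * (E w)\<^sup>2"
    using assms by (rule type_II_residual_minimal)
  from C D show ?thesis by (rule is_O_absorb_theta)
qed

text \<open>The relations \<open>v\<^sub>i\<^sup>T q\<^sub>j = 0\<close> for \<open>i < j\<close> make the test vectors independent, so in a full block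
  \<open>rbar\<close> is orthogonal to a basis.\<close>

lemma full_block_residual_zero:
  assumes n: "n = CARD('n)"
  shows "\<forall>\<^sub>F w in F. rbar w = 0"
  using tests_orthogonal
proof eventually_elim
  case (elim w)
  obtain a where a: "rbar w = (\<Sum>i<n. a i *\<^sub>R V w (Suc i))"
  proof (rule family_spans_subspace[of n "\<lambda>i. V w (Suc i)" UNIV "rbar w"])
    show "\<forall>i<n. a i = 0" if s: "(\<Sum>i<n. a i *\<^sub>R V w (Suc i)) = 0" for a
    proof (rule ccontr)
      assume "\<not> (\<forall>i<n. a i = 0)"
      then have ne: "{i. i < n \<and> a i \<noteq> 0} \<noteq> {}" by auto
      define l where "l = Max {i. i < n \<and> a i \<noteq> 0}"
      have l: "l < n" "a l \<noteq> 0" using Max_in[OF _ ne] by (auto simp: l_def)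
      have above: "a i = 0" if "l < i" "i < n" for i
      proof (rule ccontr)
        assume "a i \<noteq> 0"
        then have "i \<le> l" unfolding l_def by (intro Max_ge) (use that in auto)
        with that show False by simp
      qed
      have "0 = inner (\<Sum>i<n. a i *\<^sub>R V w (Suc i)) (Q w (Suc l))" using s by simp
      also have "\<dots> = (\<Sum>i<n. a i * inner (V w (Suc i)) (Q w (Suc l)))" by (simp add: inner_sum_left)
      also have "\<dots> = (\<Sum>i\<in>{l}. a i * inner (V w (Suc i)) (Q w (Suc l)))"
        by (rule sum.mono_neutral_right) (use l above elim in \<open>auto simp: nat_neq_iff\<close>)
      finally show False using l elim by simp
    qed
  qed (use n that in \<open>auto simp: dim_UNIV\<close>)
  have "inner (rbar w) (rbar w) = (\<Sum>i<n. a i * inner (V w (Suc i)) (rbar w))"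
    by (subst (1) a) (simp add: inner_sum_left)
  also have "\<dots> = 0" using elim by simp
  finally show ?case by simp
qed

lemma full_block:
  assumes n: "n = CARD('n)"
  shows "is_O 2 (\<lambda>w. X w (Suc n) - xs)"
proof -
  have "is_O 2 (\<lambda>w. A *v ebar w)"
  proof (rule is_O_cong[OF rbar_ebar_O])
    show "\<forall>\<^sub>F w in F. A *v ebar w = rbar w + A *v ebar w"
      using full_block_residual_zero[OF n] by eventually_elim simp
  qed
  then have "is_O 2 ebar"
  proof (rule is_O_bound[where C = "1 / \<mu>"], intro always_eventually allI)
    show "norm (ebar w) \<le> 1 / \<mu> * norm (A *v ebar w)" for w
      using A_ge[of "ebar w"] \<mu> by (simp add: field_simps)
  qed
  then show ?thesis
  proof (rule is_O_cong)
    show "\<forall>\<^sub>F w in F. X w (Suc n) - xs = ebar w"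
      using next_iterate full_block_residual_zero[OF n] by eventually_elim simp
  qed
qed

end

section \<open>Type I blocks\<close>

text \<open>The factor \<open>(1 + \<gamma>\<^sup>2\<kappa>\<^sup>2)\<^bsup>1/2\<^esup>\<close> of an oblique projection method on the Krylov space of \<open>v\<close>.\<close>

definition galerkin_factor :: "real^'n^'n \<Rightarrow> nat \<Rightarrow> real^'n \<Rightarrow> real" where
  "galerkin_factor A n v = (let K = krylov A n v; \<pi> = orth_projector K in
     sqrt (1 + (spectral_norm (\<pi> ** A ** (mat 1 - \<pi>)))\<^sup>2
       * (onorm_on K (inv_into K ((*v) (\<pi> ** A ** \<pi>))))\<^sup>2))"

context am_family
begin

text \<open>A near-optimal competitor for the Krylov minimum of the initial error. The minimizer differs
  from \<open>e\<^sub>s\<close> by an element of the Krylov space of \<open>A e\<^sub>s\<close>; the directions of the block serve as a bridge to the Krylov space of \<open>r\<^sub>s\<close>,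
  since they nearly span both.\<close>

lemma competitor_in_residual_krylov:
  obtains C where "\<forall>\<^sub>F w in F. \<exists>u\<in>krylov A n (R w 0).
    norm (X w 0 - xs + u) \<le> krylov_min A n (X w 0 - xs) + C * (E w)\<^sup>2"
proof -
  obtain C where C: "0 < C" "\<forall>\<^sub>F w in F. \<forall>z\<in>krylov A n (A *v (X w 0 - xs)). \<exists>a.
    norm (z - (\<Sum>i<n. a i *\<^sub>R P w (Suc i))) \<le> C * E w * norm z \<and> (\<Sum>i<n. \<bar>a i\<bar>) * E w \<le> C * norm z"
    by (rule krylov_approximation[OF near_krylov_linear_R0])
  obtain U D where D: "0 < D" "\<forall>w. \<forall>i<n. U i w \<in> krylov A n (R w 0)"
    "\<forall>\<^sub>F w in F. \<forall>i<n. norm (P w (Suc i) - U i w) \<le> D * (E w)\<^sup>2"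
    by (rule directions_near_krylov_elements[OF near_krylov_R0])
  have "\<forall>\<^sub>F w in F. \<exists>u\<in>krylov A n (R w 0).
    norm (X w 0 - xs + u) \<le> krylov_min A n (X w 0 - xs) + (2 * C + 2 * C * D) * (E w)\<^sup>2"
    using C(2) D(3) E_pos
  proof eventually_elim
    case (elim w)
    let ?e = "X w 0 - xs"
    obtain u where u: "u \<in> krylov A n ?e" "norm (?e + A *v u) = krylov_min A n ?e"
      by (rule krylov_min_realized)
    define z where "z = A *v u"
    have z: "z \<in> krylov A n (A *v ?e)" unfolding z_def by (rule mult_krylov_shift[OF u(1)])
    have "norm z \<le> norm (?e + z) + norm ?e"
      by (metis norm_triangle_ineq4 add_diff_cancel_left')
    also have "\<dots> \<le> 2 * E w" using u(2) krylov_min_le_norm[of A n ?e] by (simp add: z_def E_def)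
    finally have nz: "norm z \<le> 2 * E w" .
    obtain a where a: "norm (z - (\<Sum>i<n. a i *\<^sub>R P w (Suc i))) \<le> C * E w * norm z"
      "(\<Sum>i<n. \<bar>a i\<bar>) * E w \<le> C * norm z" using elim(1) z by blast
    define y where "y = (\<Sum>i<n. a i *\<^sub>R U i w)"
    have y: "y \<in> krylov A n (R w 0)"
      unfolding y_def using D(2) subspace_krylov by (intro subspace_sum subspace_scale) auto
    have "norm ((\<Sum>i<n. a i *\<^sub>R P w (Suc i)) - y) = norm (\<Sum>i<n. a i *\<^sub>R (P w (Suc i) - U i w))"
      by (simp add: y_def sum_subtractf scaleR_diff_right)
    also have "\<dots> \<le> (\<Sum>i<n. \<bar>a i\<bar> * (D * (E w)\<^sup>2))"
      using elim(2) by (intro sum_norm_le) (auto intro!: mult_left_mono)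
    also have "\<dots> = D * E w * ((\<Sum>i<n. \<bar>a i\<bar>) * E w)"
      by (simp add: sum_distrib_left sum_distrib_right power2_eq_square algebra_simps)
    also have "\<dots> \<le> D * E w * (C * (2 * E w))"
      using a(2) nz C(1) D(1) elim(3) by (intro mult_left_mono order_trans[OF a(2)]) auto
    finally have 1: "norm ((\<Sum>i<n. a i *\<^sub>R P w (Suc i)) - y) \<le> D * E w * (C * (2 * E w))" .
    have 2: "norm (z - (\<Sum>i<n. a i *\<^sub>R P w (Suc i))) \<le> C * E w * (2 * E w)"
      using nz C(1) elim(3) by (intro order_trans[OF a(1)] mult_left_mono) auto
    have "norm (z - y) \<le> (2 * C + 2 * C * D) * (E w)\<^sup>2"
      using norm_triangle_ineq[of "z - (\<Sum>i<n. a i *\<^sub>R P w (Suc i))" "(\<Sum>i<n. a i *\<^sub>R P w (Suc i)) - y"] 1 2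
      by (simp add: power2_eq_square algebra_simps)
    moreover have "norm (?e + y) \<le> norm (?e + z) + norm (z - y)"
    proof -
      have "?e + y = (?e + z) - (z - y)" by simp
      then show ?thesis by (metis norm_triangle_ineq4)
    qed
    ultimately have "norm (?e + y) \<le> krylov_min A n ?e + (2 * C + 2 * C * D) * (E w)\<^sup>2"
      using u(2)[folded z_def] by linarith
    with y show ?case by blast
  qed
  then show ?thesis by (rule that)
qed

text \<open>In Type I the residual \<open>rbar\<close> is orthogonal to the directions, which nearly span the Krylov
  space.\<close>

lemma type_I_projected_residual_O:
  assumes ty: "ty = Type_I"
  shows "is_O 2 (\<lambda>w. orth_projector (krylov A n (R w 0)) *v rbar w)"
proof -
  obtain C where C: "0 < C" "\<forall>\<^sub>F w in F. \<forall>z\<in>krylov A n (R w 0). \<exists>a.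
    norm (z - (\<Sum>i<n. a i *\<^sub>R P w (Suc i))) \<le> C * E w * norm z \<and> (\<Sum>i<n. \<bar>a i\<bar>) * E w \<le> C * norm z"
    by (rule krylov_approximation[OF near_krylov_R0])
  obtain D where D: "0 < D" "\<forall>\<^sub>F w in F. norm (rbar w) \<le> D * E w ^ 1"
    by (rule is_OE[OF rbar_O])
  have "\<forall>\<^sub>F w in F. norm (orth_projector (krylov A n (R w 0)) *v rbar w) \<le> (C * D) * (E w)\<^sup>2"
    using C(2) D(2) E_pos tests_orthogonal
  proof eventually_elim
    case (elim w)
    define z where "z = orth_projector (krylov A n (R w 0)) *v rbar w"
    have z: "z \<in> krylov A n (R w 0)" unfolding z_def by (rule orth_projector_in[OF subspace_krylov])
    obtain a where a: "norm (z - (\<Sum>i<n. a i *\<^sub>R P w (Suc i))) \<le> C * E w * norm z"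
      using elim(1) z by blast
    have "norm z * norm z = inner (rbar w) z"
      using inner_orth_projector[OF subspace_krylov z, of "rbar w"]
      by (simp add: z_def[symmetric] power2_eq_square[symmetric] power2_norm_eq_inner)
    also have "\<dots> = inner (rbar w) (z - (\<Sum>i<n. a i *\<^sub>R P w (Suc i)))"
      using elim(4) by (simp add: inner_diff_right inner_sum_right ty am_test_def inner_commute)
    also have "\<dots> \<le> (D * E w) * (C * E w * norm z)"
      using elim(2) a D(1) elim(3) by (intro order_trans[OF norm_cauchy_schwarz] mult_mono) auto
    finally have "norm z * norm z \<le> ((C * D) * (E w)\<^sup>2) * norm z"
      by (simp add: power2_eq_square algebra_simps)
    then show ?case
      using C(1) D(1) unfolding z_def[symmetric] by (cases "z = 0") auto
  qed
  then show ?thesis by (rule is_OI)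
qed

lemma ebar_near_krylov:
  obtains u where "\<forall>w. u w \<in> krylov A n (R w 0)" "is_O 2 (\<lambda>w. ebar w - (X w 0 - xs) - u w)"
proof -
  have "near_krylov A (\<lambda>w. R w 0) n (\<lambda>w. (X w n - X w 0) - (\<Sum>i<n. mix_coeff n w i *\<^sub>R P w (Suc i)))"
  proof (rule near_krylov_diff)
    show "near_krylov A (\<lambda>w. R w 0) n (\<lambda>w. X w n - X w 0)"
      using near_krylov_directions[OF near_krylov_R0 order.refl] by blast
    have "near_krylov A (\<lambda>w. R w 0) n (\<lambda>w. P w (Suc i))" if "i < n" for i
    proof (rule near_krylov_mono)
      show "near_krylov A (\<lambda>w. R w 0) (Suc i) (\<lambda>w. P w (Suc i))"
        using near_krylov_directions[OF near_krylov_R0 order.refl] that by blast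
    qed (use that in simp)
    then show "near_krylov A (\<lambda>w. R w 0) n (\<lambda>w. \<Sum>i<n. mix_coeff n w i *\<^sub>R P w (Suc i))"
      by (intro near_krylov_sum near_krylov_scaleR mix_coeff_O) auto
  qed
  then obtain u where u: "\<forall>w. u w \<in> krylov A n (R w 0)"
    "is_O 2 (\<lambda>w. (X w n - X w 0) - (\<Sum>i<n. mix_coeff n w i *\<^sub>R P w (Suc i)) - u w)"
    unfolding near_krylov_def by (elim exE conjE)
  have eq: "ebar w - (X w 0 - xs) - u w
      = (X w n - X w 0) - (\<Sum>i<n. mix_coeff n w i *\<^sub>R P w (Suc i)) - u w" for w
    by (simp add: ebar_eq algebra_simps)
  have "is_O 2 (\<lambda>w. ebar w - (X w 0 - xs) - u w)" using u(2) by (simp only: eq)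
  with u(1) show ?thesis by (rule that)
qed

lemma galerkin_factor_le: "galerkin_factor A n v \<le> sqrt (1 + L\<^sup>2 * (1 / \<mu>)\<^sup>2)"
  unfolding galerkin_factor_def Let_def
  using compression_inverse_bounds(1,2)[OF subspace_krylov \<mu> coercive]
    spectral_norm_off_diagonal_le[OF subspace_krylov A_le less_imp_le[OF L]]
  by (intro real_sqrt_le_mono add_left_mono mult_mono power_mono) (auto simp: spectral_norm_nonneg)

lemma galerkin_factor_nonneg: "0 \<le> galerkin_factor A n v"
  by (simp add: galerkin_factor_def Let_def)

text \<open>The oblique projection bound is applied to an error \<open>e\<close> in \<open>e\<^sub>s + K\<close> close to \<open>ebar\<close>. Its part
  orthogonal to \<open>K\<close> is the same for all members of \<open>e\<^sub>s + K\<close>, in particular for the competitor.\<close>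

lemma type_I_error_le:
  assumes ty: "ty = Type_I"
  obtains C where "\<forall>\<^sub>F w in F. norm (ebar w)
    \<le> galerkin_factor A n (R w 0) * krylov_min A n (X w 0 - xs) + C * (E w)\<^sup>2"
proof -
  define s where "s = sqrt (1 + L\<^sup>2 * (1 / \<mu>)\<^sup>2)"
  obtain C1 where C1: "\<forall>\<^sub>F w in F. \<exists>u\<in>krylov A n (R w 0).
    norm (X w 0 - xs + u) \<le> krylov_min A n (X w 0 - xs) + C1 * (E w)\<^sup>2"
    by (rule competitor_in_residual_krylov)
  obtain C2 where C2: "\<forall>\<^sub>F w in F. norm (orth_projector (krylov A n (R w 0)) *v rbar w) \<le> C2 * (E w)\<^sup>2"
    by (rule is_OE[OF type_I_projected_residual_O[OF ty]])
  obtain u where u: "\<forall>w. u w \<in> krylov A n (R w 0)" "is_O 2 (\<lambda>w. ebar w - (X w 0 - xs) - u w)"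
    by (rule ebar_near_krylov)
  obtain C3 where C3: "\<forall>\<^sub>F w in F. norm (ebar w - (X w 0 - xs) - u w) \<le> C3 * (E w)\<^sup>2"
    by (rule is_OE[OF u(2)])
  obtain C4 where C4: "\<forall>\<^sub>F w in F. norm (rbar w + A *v ebar w) \<le> C4 * (E w)\<^sup>2"
    by (rule is_OE[OF rbar_ebar_O])
  have "\<forall>\<^sub>F w in F. norm (ebar w) \<le> galerkin_factor A n (R w 0) * krylov_min A n (X w 0 - xs)
      + (s * \<bar>C1\<bar> + (C2 + C4 + L * C3) / \<mu> + C3) * (E w)\<^sup>2"
    using C1 C2 C3 C4
  proof eventually_elim
    case (elim w)
    define K where "K = krylov A n (R w 0)"
    define \<pi> where "\<pi> = orth_projector K"
    define e where "e = X w 0 - xs + u w"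
    have K: "subspace K" by (simp add: K_def subspace_krylov)
    obtain v where v: "v \<in> K" "norm (X w 0 - xs + v) \<le> krylov_min A n (X w 0 - xs) + C1 * (E w)\<^sup>2"
      using elim(1) by (auto simp: K_def)
    have near: "norm (ebar w - e) \<le> C3 * (E w)\<^sup>2" using elim(3) by (simp add: e_def algebra_simps)
    have "\<pi> *v (A *v e) = \<pi> *v (rbar w + A *v ebar w) - \<pi> *v rbar w - \<pi> *v (A *v (ebar w - e))"
      by (simp add: matrix_vector_mult_diff_distrib matrix_vector_right_distrib)
    also have "norm \<dots> \<le> C4 * (E w)\<^sup>2 + C2 * (E w)\<^sup>2 + L * (C3 * (E w)\<^sup>2)"
    proof (intro order_trans[OF norm_triangle_ineq4] add_mono)
      show "norm (\<pi> *v (rbar w + A *v ebar w)) \<le> C4 * (E w)\<^sup>2"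
        unfolding \<pi>_def by (rule order_trans[OF norm_orth_projector_le[OF K] elim(4)])
      show "norm (\<pi> *v rbar w) \<le> C2 * (E w)\<^sup>2" using elim(2) by (simp add: \<pi>_def K_def)
      have "norm (A *v (ebar w - e)) \<le> L * (C3 * (E w)\<^sup>2)"
        using near L by (intro order_trans[OF A_le] mult_left_mono) auto
      then show "norm (\<pi> *v (A *v (ebar w - e))) \<le> L * (C3 * (E w)\<^sup>2)"
        unfolding \<pi>_def by (rule order_trans[OF norm_orth_projector_le[OF K]])
    qed
    finally have "norm (\<pi> *v (A *v e)) / \<mu> \<le> (C4 * (E w)\<^sup>2 + C2 * (E w)\<^sup>2 + L * (C3 * (E w)\<^sup>2)) / \<mu>"
      using \<mu> by (intro divide_right_mono) auto
    also have "\<dots> = (C2 + C4 + L * C3) / \<mu> * (E w)\<^sup>2" by (simp add: field_simps)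
    finally have res: "norm (\<pi> *v (A *v e)) / \<mu> \<le> (C2 + C4 + L * C3) / \<mu> * (E w)\<^sup>2" .
    \<comment> \<open>\<open>e\<close> and the competitor differ by an element of \<open>K\<close>.\<close>
    have "\<pi> *v (u w - v) = u w - v"
      unfolding \<pi>_def using u(1) v(1) by (intro orth_projector_eq_self K subspace_diff) (auto simp: K_def)
    then have "e - \<pi> *v e = (X w 0 - xs + v) - \<pi> *v (X w 0 - xs + v)"
      by (simp add: e_def matrix_vector_mult_diff_distrib matrix_vector_right_distrib algebra_simps)
    then have "norm (e - \<pi> *v e) \<le> norm (X w 0 - xs + v)"
      using norm_orth_complement_le[OF K] by (simp add: \<pi>_def)
    also have "\<dots> \<le> krylov_min A n (X w 0 - xs) + C1 * (E w)\<^sup>2" by (rule v(2))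
    also have "\<dots> \<le> krylov_min A n (X w 0 - xs) + \<bar>C1\<bar> * (E w)\<^sup>2" by (simp add: mult_right_mono)
    finally have "galerkin_factor A n (R w 0) * norm (e - \<pi> *v e)
        \<le> galerkin_factor A n (R w 0) * (krylov_min A n (X w 0 - xs) + \<bar>C1\<bar> * (E w)\<^sup>2)"
      by (rule mult_left_mono[OF _ galerkin_factor_nonneg])
    also have "\<dots> \<le> galerkin_factor A n (R w 0) * krylov_min A n (X w 0 - xs) + s * \<bar>C1\<bar> * (E w)\<^sup>2"
      using mult_right_mono[OF galerkin_factor_le[of "R w 0", folded s_def], of "\<bar>C1\<bar> * (E w)\<^sup>2"]
      by (simp add: algebra_simps)
    finally have comp: "galerkin_factor A n (R w 0) * norm (e - \<pi> *v e)
        \<le> galerkin_factor A n (R w 0) * krylov_min A n (X w 0 - xs) + s * \<bar>C1\<bar> * (E w)\<^sup>2" .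
    have "norm e \<le> galerkin_factor A n (R w 0) * norm (e - \<pi> *v e) + norm (\<pi> *v (A *v e)) / \<mu>"
      using oblique_projection_bound[OF K \<mu> coercive, of e]
      by (simp add: galerkin_factor_def Let_def K_def \<pi>_def)
    moreover have "norm (ebar w) \<le> norm e + norm (ebar w - e)"
      by (metis norm_triangle_ineq add.commute diff_add_cancel)
    ultimately have "norm (ebar w) \<le> galerkin_factor A n (R w 0) * krylov_min A n (X w 0 - xs)
        + s * \<bar>C1\<bar> * (E w)\<^sup>2 + (C2 + C4 + L * C3) / \<mu> * (E w)\<^sup>2 + C3 * (E w)\<^sup>2"
      using comp res near by linarith
    then show ?case by (simp only: distrib_right add.assoc)
  qed
  then show ?thesis by (rule that)
qed

lemma type_I_block:
  assumes "ty = Type_I"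
  shows "\<exists>C. \<forall>\<^sub>F w in F. norm (X w (Suc n) - xs) \<le> spectral_norm (mat 1 - B w n *\<^sub>R A)
    * (galerkin_factor A n (R w 0) * krylov_min A n (X w 0 - xs)) + C * (E w)\<^sup>2"
proof -
  obtain C where C: "\<forall>\<^sub>F w in F. norm (X w (Suc n) - xs)
    \<le> spectral_norm (mat 1 - B w n *\<^sub>R A) * norm (ebar w) + C * (E w)\<^sup>2"
    by (rule next_error_le)
  obtain D where D: "\<forall>\<^sub>F w in F. norm (ebar w)
    \<le> galerkin_factor A n (R w 0) * krylov_min A n (X w 0 - xs) + D * (E w)\<^sup>2"
    using assms by (rule type_I_error_le)
  from C D show ?thesis by (rule is_O_absorb_theta)
qed

end

section \<open>From block families to uniform constants\<close>

locale am_problem =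
  fixes g :: "real^'n \<Rightarrow> real^'n" and xs :: "real^'n" and A :: "real^'n^'n"
    and \<rho> \<kappa> \<mu> L \<tau> \<beta>lo \<beta>hi :: real
  assumes pos: "0 < \<rho>" "0 < \<kappa>" "0 < \<mu>" "0 < L" "0 < \<tau>" "0 < \<beta>lo"
    and coercive: "\<mu> * (norm y)\<^sup>2 \<le> inner y (A *v y)"
    and A_le: "norm (A *v y) \<le> L * norm y"
    and model: "norm (x - xs) \<le> \<rho> \<Longrightarrow> norm (g x - x + A *v (x - xs)) \<le> \<kappa> / 2 * (norm (x - xs))\<^sup>2"
begin

definition admissible_block :: "am_type \<Rightarrow> nat \<Rightarrow> real \<Rightarrow> (nat \<Rightarrow> real) \<Rightarrow> (nat \<Rightarrow> real^'n) \<Rightarrow>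
    (nat \<Rightarrow> real^'n) \<Rightarrow> (nat \<Rightarrow> real^'n) \<Rightarrow> (nat \<Rightarrow> real^'n) \<Rightarrow> bool" where
  "admissible_block ty n D \<beta> x r p q \<longleftrightarrow>
     (\<forall>j. \<beta> j \<in> {\<beta>lo..\<beta>hi}) \<and> am_block ty n \<tau> \<beta> x r p q \<and> x 0 \<noteq> xs \<and>
     (\<forall>j\<le>n. r j = g (x j) - x j \<and> norm (x j - xs) \<le> D * norm (x 0 - xs))"

lemma admissible_blockD:
  assumes "admissible_block ty n D \<beta> x r p q"
  shows "\<forall>j. \<beta> j \<in> {\<beta>lo..\<beta>hi}" "am_block ty n \<tau> \<beta> x r p q" "x 0 \<noteq> xs"
    "j \<le> n \<Longrightarrow> r j = g (x j) - x j" "j \<le> n \<Longrightarrow> norm (x j - xs) \<le> D * norm (x 0 - xs)"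
  using assms unfolding admissible_block_def by (elim conjE; assumption?; simp)+

definition block_estimate :: "am_type \<Rightarrow> nat \<Rightarrow> real \<Rightarrow> (nat \<Rightarrow> real) \<Rightarrow> (nat \<Rightarrow> real^'n) \<Rightarrow>
    (nat \<Rightarrow> real^'n) \<Rightarrow> bool" where
  "block_estimate ty n C \<beta> x r \<longleftrightarrow>
     norm (x (Suc n) - xs) \<le> C * norm (x 0 - xs) \<and>
     (ty = Type_I \<longrightarrow> norm (x (Suc n) - xs) \<le> spectral_norm (mat 1 - \<beta> n *\<^sub>R A)
        * (galerkin_factor A n (r 0) * krylov_min A n (x 0 - xs)) + C * (norm (x 0 - xs))\<^sup>2) \<and>
     (ty = Type_II \<longrightarrow> norm (A *v (x (Suc n) - xs)) \<le> spectral_norm (mat 1 - \<beta> n *\<^sub>R A)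
        * krylov_min A n (r 0) + C * (norm (x 0 - xs))\<^sup>2) \<and>
     (n = CARD('n) \<longrightarrow> norm (x (Suc n) - xs) \<le> C * (norm (x 0 - xs))\<^sup>2)"

lemma block_estimate_mono:
  assumes "block_estimate ty n C \<beta> x r" "C \<le> C'"
  shows "block_estimate ty n C' \<beta> x r"
proof -
  have "C * norm (x 0 - xs) \<le> C' * norm (x 0 - xs)"
    "C * (norm (x 0 - xs))\<^sup>2 \<le> C' * (norm (x 0 - xs))\<^sup>2"
    using assms(2) by (auto intro: mult_right_mono)
  with assms(1) show ?thesis unfolding block_estimate_def by (smt (verit))
qed

text \<open>The filter of all admissible blocks with \<open>E \<longrightarrow> 0\<close> turns the asymptotic statements into one radius
  and one constant for all blocks of length \<open>n\<close>.\<close>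

lemma block_estimate_exists:
  "\<exists>\<delta>>0. \<exists>C>0. \<forall>\<beta> x r p q. admissible_block ty n D \<beta> x r p q \<longrightarrow> norm (x 0 - xs) \<le> \<delta>
     \<longrightarrow> block_estimate ty n C \<beta> x r"
proof -
  define B :: "(nat \<Rightarrow> real) \<times> (nat \<Rightarrow> real^'n) \<times> (nat \<Rightarrow> real^'n) \<times> (nat \<Rightarrow> real^'n) \<times> (nat \<Rightarrow> real^'n)
    \<Rightarrow> nat \<Rightarrow> real" where "B w = fst w" for w
  define X :: "(nat \<Rightarrow> real) \<times> (nat \<Rightarrow> real^'n) \<times> (nat \<Rightarrow> real^'n) \<times> (nat \<Rightarrow> real^'n) \<times> (nat \<Rightarrow> real^'n)
    \<Rightarrow> nat \<Rightarrow> real^'n" where "X w = fst (snd w)" for w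
  define R :: "(nat \<Rightarrow> real) \<times> (nat \<Rightarrow> real^'n) \<times> (nat \<Rightarrow> real^'n) \<times> (nat \<Rightarrow> real^'n) \<times> (nat \<Rightarrow> real^'n)
    \<Rightarrow> nat \<Rightarrow> real^'n" where "R w = fst (snd (snd w))" for w
  define P :: "(nat \<Rightarrow> real) \<times> (nat \<Rightarrow> real^'n) \<times> (nat \<Rightarrow> real^'n) \<times> (nat \<Rightarrow> real^'n) \<times> (nat \<Rightarrow> real^'n)
    \<Rightarrow> nat \<Rightarrow> real^'n" where "P w = fst (snd (snd (snd w)))" for w
  define Q :: "(nat \<Rightarrow> real) \<times> (nat \<Rightarrow> real^'n) \<times> (nat \<Rightarrow> real^'n) \<times> (nat \<Rightarrow> real^'n) \<times> (nat \<Rightarrow> real^'n)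
    \<Rightarrow> nat \<Rightarrow> real^'n" where "Q w = snd (snd (snd (snd w)))" for w
  define E where "E w = norm (X w 0 - xs)" for w
  define S where "S = {w. admissible_block ty n D (B w) (X w) (R w) (P w) (Q w)}"
  define F where "F = inf (filtercomap E (nhds 0)) (principal S)"
  have S: "\<forall>\<^sub>F w in F. admissible_block ty n D (B w) (X w) (R w) (P w) (Q w)"
    unfolding F_def S_def by (simp add: eventually_inf_principal)
  have lim: "(E \<longlongrightarrow> 0) F"
    unfolding F_def by (rule filterlim_mono[OF filterlim_filtercomap order.refl inf_le1])
  interpret small_scale F E
  proof
    show "\<forall>\<^sub>F w in F. 0 < E w"
      using S
    proof eventually_elim
      case (elim w)
      show ?case using admissible_blockD(3)[OF elim] by (simp add: E_def)
    qed
  qed (rule lim)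
  have X_O: "is_O 1 (\<lambda>w. X w j - xs)" if "j \<le> n" for j
  proof (rule is_OI)
    show "\<forall>\<^sub>F w in F. norm (X w j - xs) \<le> D * E w ^ 1"
      using S
    proof eventually_elim
      case (elim w)
      show ?case using admissible_blockD(5)[OF elim that] by (simp add: E_def)
    qed
  qed
  interpret am_family F E ty n \<tau> \<beta>lo \<beta>hi \<mu> L A xs B X R P Q
  proof
    show "is_O 2 (\<lambda>w. R w j + A *v (X w j - xs))" if j: "j \<le> n" for j
    proof (rule is_O_bound)
      show "is_O 2 (\<lambda>w. norm (X w j - xs) *\<^sub>R (X w j - xs))"
      proof -
        have "is_O 1 (\<lambda>w. norm (X w j - xs))"
          by (rule is_O_bound[OF X_O[OF j], where C = 1]) simp
        from is_O_scaleR[OF this X_O[OF j]] show ?thesis by (simp add: numeral_2_eq_2)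
      qed
      obtain M where M: "0 < M" "\<forall>\<^sub>F w in F. norm (X w j - xs) \<le> M * E w ^ 1"
        by (rule is_OE[OF X_O[OF j]])
      have "0 < \<rho> / M" using M(1) pos by simp
      from eventually_E_le[OF this] M(2) S
      show "\<forall>\<^sub>F w in F. norm (R w j + A *v (X w j - xs))
          \<le> \<kappa> / 2 * norm (norm (X w j - xs) *\<^sub>R (X w j - xs))"
      proof eventually_elim
        case (elim w)
        have "M * E w \<le> \<rho>" using elim(1) M(1) by (simp add: field_simps)
        then have "norm (X w j - xs) \<le> \<rho>" using elim(2) by simp
        moreover have "R w j = g (X w j) - X w j"
          by (rule admissible_blockD(4)[OF elim(3) j])
        ultimately show ?case using model by (simp add: power2_eq_square)
      qed
    qed
    show "\<forall>\<^sub>F w in F. \<forall>j. B w j \<in> {\<beta>lo..\<beta>hi}"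
      using S by eventually_elim (rule admissible_blockD(1))
    show "\<forall>\<^sub>F w in F. am_block ty n \<tau> (B w) (X w) (R w) (P w) (Q w)"
      using S by eventually_elim (rule admissible_blockD(2))
  qed (use pos coercive A_le X_O in \<open>auto simp: E_def\<close>)
  obtain C1 where C1: "\<forall>\<^sub>F w in F. norm (X w (Suc n) - xs) \<le> C1 * E w ^ 1"
    by (rule is_OE[OF next_iterate_O])
  have "\<exists>C. \<forall>\<^sub>F w in F. ty = Type_I \<longrightarrow> norm (X w (Suc n) - xs) \<le> spectral_norm (mat 1 - B w n *\<^sub>R A)
        * (galerkin_factor A n (R w 0) * krylov_min A n (X w 0 - xs)) + C * (E w)\<^sup>2"
    using type_I_block by (cases "ty = Type_I") simp_all
  then obtain C2 where C2: "\<forall>\<^sub>F w in F. ty = Type_I \<longrightarrow> norm (X w (Suc n) - xs) \<le> spectral_norm (mat 1 - B w n *\<^sub>R A)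
        * (galerkin_factor A n (R w 0) * krylov_min A n (X w 0 - xs)) + C2 * (E w)\<^sup>2" ..
  have "\<exists>C. \<forall>\<^sub>F w in F. ty = Type_II \<longrightarrow> norm (A *v (X w (Suc n) - xs)) \<le> spectral_norm (mat 1 - B w n *\<^sub>R A)
        * krylov_min A n (R w 0) + C * (E w)\<^sup>2"
    using type_II_block by (cases "ty = Type_II") simp_all
  then obtain C3 where C3: "\<forall>\<^sub>F w in F. ty = Type_II \<longrightarrow> norm (A *v (X w (Suc n) - xs)) \<le> spectral_norm (mat 1 - B w n *\<^sub>R A)
        * krylov_min A n (R w 0) + C3 * (E w)\<^sup>2" ..
  have "\<exists>C. \<forall>\<^sub>F w in F. n = CARD('n) \<longrightarrow> norm (X w (Suc n) - xs) \<le> C * (E w)\<^sup>2"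
    using full_block unfolding is_O_def by (cases "n = CARD('n)") simp_all
  then obtain C4 where C4: "\<forall>\<^sub>F w in F. n = CARD('n) \<longrightarrow> norm (X w (Suc n) - xs) \<le> C4 * (E w)\<^sup>2" ..
  define C where "C = Max {1, C1, C2, C3, C4}"
  have C: "0 < C" "C1 \<le> C" "C2 \<le> C" "C3 \<le> C" "C4 \<le> C"
    by (auto simp: C_def less_max_iff_disj)
  have "\<forall>\<^sub>F w in F. block_estimate ty n C (B w) (X w) (R w)"
    using C1 C2 C3 C4
  proof eventually_elim
    case (elim w)
    have "C1 * E w \<le> C * E w" "C2 * (E w)\<^sup>2 \<le> C * (E w)\<^sup>2" "C3 * (E w)\<^sup>2 \<le> C * (E w)\<^sup>2"
      "C4 * (E w)\<^sup>2 \<le> C * (E w)\<^sup>2"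
      using C by (auto intro!: mult_right_mono simp: E_def)
    with elim show ?case unfolding block_estimate_def E_def[symmetric] power_one_right by (smt (verit))
  qed
  then obtain d where d: "0 < d" "\<And>w. w \<in> S \<Longrightarrow> E w < d \<Longrightarrow> block_estimate ty n C (B w) (X w) (R w)"
    unfolding F_def eventually_inf_principal eventually_filtercomap eventually_nhds_metric
    by (force simp: E_def)
  show ?thesis
  proof (intro exI conjI allI impI)
    show "0 < d / 2" "0 < C" using d C by auto
    fix \<beta> x r p q assume a: "admissible_block ty n D \<beta> x r p q" "norm (x 0 - xs) \<le> d / 2"
    then have "(\<beta>, x, r, p, q) \<in> S" by (simp add: S_def B_def X_def R_def P_def Q_def)
    moreover have "E (\<beta>, x, r, p, q) < d" using a(2) d(1) by (simp add: E_def X_def)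
    ultimately show "block_estimate ty n C \<beta> x r"
      using d(2)[of "(\<beta>, x, r, p, q)"] by (simp add: B_def X_def R_def)
  qed
qed

lemma block_estimate_uniform:
  "\<exists>\<delta>>0. \<exists>C>0. \<forall>n\<le>m. \<forall>\<beta> x r p q. admissible_block ty n D \<beta> x r p q \<longrightarrow> norm (x 0 - xs) \<le> \<delta>
     \<longrightarrow> block_estimate ty n C \<beta> x r"
proof (induction m)
  case 0
  show ?case using block_estimate_exists[of ty 0 D] by simp
next
  case (Suc m)
  obtain \<delta> C where 1: "0 < \<delta>" "0 < C" "\<And>n \<beta> x r p q. n \<le> m \<Longrightarrow> admissible_block ty n D \<beta> x r p q \<Longrightarrow>
      norm (x 0 - xs) \<le> \<delta> \<Longrightarrow> block_estimate ty n C \<beta> x r"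
    using Suc.IH by (elim exE conjE) metis
  obtain \<delta>' C' where 2: "0 < \<delta>'" "0 < C'" "\<And>\<beta> x r p q. admissible_block ty (Suc m) D \<beta> x r p q \<Longrightarrow>
      norm (x 0 - xs) \<le> \<delta>' \<Longrightarrow> block_estimate ty (Suc m) C' \<beta> x r"
    using block_estimate_exists[of ty "Suc m" D] by (elim exE conjE) metis
  show ?case
  proof (intro exI conjI allI impI)
    show "0 < min \<delta> \<delta>'" "0 < max C C'" using 1 2 by auto
    fix n \<beta> x r p q assume a: "n \<le> Suc m" "admissible_block ty n D \<beta> x r p q"
      "norm (x 0 - xs) \<le> min \<delta> \<delta>'"
    show "block_estimate ty n (max C C') \<beta> x r"
    proof (cases "n = Suc m")
      case True
      with a 2(3) have "block_estimate ty n C' \<beta> x r" by simp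
      then show ?thesis by (rule block_estimate_mono) simp
    next
      case False
      with a have "block_estimate ty n C \<beta> x r" by (intro 1(3)) auto
      then show ?thesis by (rule block_estimate_mono) simp
    qed
  qed
qed

text \<open>Within the radius \<open>\<mu>/\<kappa>\<close> the quadratic error of the linear model takes at most half of
  \<open>\<mu>\<parallel>x - x\<^sup>*\<parallel>\<close>.\<close>

lemma residual_bounds:
  assumes "norm (x - xs) \<le> min \<rho> (\<mu> / \<kappa>)"
  shows "\<mu> / 2 * norm (x - xs) \<le> norm (g x - x)" "norm (g x - x) \<le> (L + \<mu> / 2) * norm (x - xs)"
proof -
  have "\<kappa> * norm (x - xs) \<le> \<mu>" using assms pos by (simp add: field_simps)
  then have "(\<kappa> * norm (x - xs)) * norm (x - xs) \<le> \<mu> * norm (x - xs)" by (intro mult_right_mono) auto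
  then have m: "norm (g x - x + A *v (x - xs)) \<le> \<mu> / 2 * norm (x - xs)"
    using model[of x] assms by (simp add: power2_eq_square)
  have "\<mu> * norm (x - xs) \<le> norm (A *v (x - xs))"
    by (rule inner_mult_ge_imp_norm_ge[OF coercive])
  also have "\<dots> \<le> norm (g x - x + A *v (x - xs)) + norm (g x - x)"
    by (metis norm_triangle_ineq4 add.commute add_diff_cancel_right')
  finally show "\<mu> / 2 * norm (x - xs) \<le> norm (g x - x)" using m by simp
  have "norm (g x - x) \<le> norm (g x - x + A *v (x - xs)) + norm (A *v (x - xs))"
    by (metis norm_triangle_ineq4 add_diff_cancel_right')
  then show "norm (g x - x) \<le> (L + \<mu> / 2) * norm (x - xs)"
    using m A_le[of "x - xs"] by (simp add: distrib_right)
qed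

lemma residual_at_solution: "g xs - xs = 0"
  using model[of xs] pos by simp

end

section \<open>Blocks of a trajectory\<close>

lemma restarted_AM_iteration:
  assumes am: "restarted_AM ty g m \<tau> \<eta> \<beta> x r p q mm" and nz: "\<forall>j\<le>k. r j \<noteq> 0"
  defines "v \<equiv> am_test ty p q" and "s \<equiv> k - mm k"
  shows "mm k = 0 \<or> (0 < k \<and> mm k = Suc (mm (k - 1)) \<and> mm k \<le> m \<and> norm (r k) \<le> \<eta> * norm (r s) \<and>
      (p k, q k) = am_sweep v p q s (mm k - 1) (x k - x (k - 1), r k - r (k - 1)) \<and>
      \<tau> * \<bar>inner (v (Suc s)) (q (Suc s))\<bar> \<le> \<bar>inner (v k) (q k)\<bar>)"
    and "x (Suc k) = (let (xbar, rbar) = am_sweep v p q s (mm k) (x k, r k) in xbar + \<beta> k *\<^sub>R rbar)"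
    and "r k = g (x k) - x k"
proof -
  define m0 where "m0 = (if k = 0 then 0 else mm (k - 1) + 1)"
  define m1 where "m1 = (if m0 > m \<or> norm (r k) > \<eta> * norm (r (k - m0)) then 0 else m0)"
  have *: "(m1 > 0 \<longrightarrow>
              (p k, q k) = am_sweep v p q (k - m1) (m1 - 1) (x k - x (k - 1), r k - r (k - 1))) \<and>
           mm k = (if m1 > 0 \<and> \<bar>inner (v k) (q k)\<bar>
                       < \<tau> * \<bar>inner (v (k - m1 + 1)) (q (k - m1 + 1))\<bar>
                   then 0 else m1) \<and>
           (let (xbar, rbar) = am_sweep v p q (k - mm k) (mm k) (x k, r k)
            in x (Suc k) = xbar + \<beta> k *\<^sub>R rbar)"
    using am[unfolded restarted_AM_def Let_def, THEN conjunct2, THEN spec[of _ k], THEN mp, OF nz]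
    unfolding v_def am_test_def m0_def m1_def Let_def .
  show "x (Suc k) = (let (xbar, rbar) = am_sweep v p q s (mm k) (x k, r k) in xbar + \<beta> k *\<^sub>R rbar)"
    using * by (simp add: s_def split_beta Let_def)
  show "r k = g (x k) - x k" using am by (simp add: restarted_AM_def Let_def)
  show "mm k = 0 \<or> (0 < k \<and> mm k = Suc (mm (k - 1)) \<and> mm k \<le> m \<and> norm (r k) \<le> \<eta> * norm (r s) \<and>
      (p k, q k) = am_sweep v p q s (mm k - 1) (x k - x (k - 1), r k - r (k - 1)) \<and>
      \<tau> * \<bar>inner (v (Suc s)) (q (Suc s))\<bar> \<le> \<bar>inner (v k) (q k)\<bar>)"
  proof (cases "mm k = 0")
    case False
    then have 1: "mm k = m1" "0 < m1" using * by (auto split: if_splits)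
    then have 2: "m1 = m0" "m0 \<le> m" "norm (r k) \<le> \<eta> * norm (r (k - m0))"
      unfolding m1_def by (auto split: if_splits)
    then have 3: "0 < k" "m0 = Suc (mm (k - 1))" using 1 unfolding m0_def by (auto split: if_splits)
    have e: "m1 = mm k" "m0 = mm k" using 1 2 by simp_all
    have "(p k, q k) = am_sweep v p q s (mm k - 1) (x k - x (k - 1), r k - r (k - 1))"
      using *[THEN conjunct1, THEN mp, OF 1(2)] unfolding e s_def .
    moreover have "\<tau> * \<bar>inner (v (Suc s)) (q (Suc s))\<bar> \<le> \<bar>inner (v k) (q k)\<bar>"
      using *[THEN conjunct2, THEN conjunct1] False unfolding e s_def by (auto split: if_splits)
    ultimately show ?thesis
      using 2(2,3) 3 unfolding e s_def[symmetric] by blast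
  qed simp
qed

text \<open>Since the last restart the depth has grown by one in each iteration.\<close>

lemma restarted_AM_depth:
  assumes am: "restarted_AM ty g m \<tau> \<eta> \<beta> x r p q mm" and nz: "\<forall>j\<le>k. r j \<noteq> 0"
  shows "mm k \<le> k" and "i \<le> mm k \<Longrightarrow> mm (k - mm k + i) = i"
proof -
  have *: "j \<le> mm k \<Longrightarrow> j \<le> k \<and> mm (k - j) = mm k - j" for j
  proof (induction j)
    case (Suc j)
    then have "j \<le> k" "mm (k - j) = mm k - j" "0 < mm (k - j)" by auto
    moreover have "mm (k - j) = 0 \<or> 0 < k - j \<and> mm (k - j) = Suc (mm (k - j - 1))"
      using restarted_AM_iteration(1)[OF am, of "k - j"] nz by fastforce
    ultimately show ?case by auto
  qed simp
  show "mm k \<le> k" using *[of "mm k"] by simp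
  show "i \<le> mm k \<Longrightarrow> mm (k - mm k + i) = i"
    using *[of "mm k - i"] *[of "mm k"] by simp
qed

lemma restarted_AM_block:
  assumes am: "restarted_AM ty g m \<tau> \<eta> \<beta> x r p q mm" and nz: "\<forall>j\<le>k. r j \<noteq> 0"
  defines "n \<equiv> mm k" and "s \<equiv> k - mm k"
  shows "n \<le> m" and "\<And>j. 0 < j \<Longrightarrow> j \<le> n \<Longrightarrow> norm (r (s + j)) \<le> \<eta> * norm (r s)"
    and "am_block ty n \<tau> (\<lambda>j. \<beta> (s + j)) (\<lambda>j. x (s + j)) (\<lambda>j. r (s + j)) (\<lambda>j. p (s + j)) (\<lambda>j. q (s + j))"
proof -
  have sn: "s + n = k" using restarted_AM_depth(1)[OF am nz] by (simp add: s_def n_def)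
  have mm: "mm (s + i) = i" if "i \<le> n" for i
    using restarted_AM_depth(2)[OF am nz] that by (simp add: s_def n_def)
  have nz': "\<forall>j\<le>s + i. r j \<noteq> 0" if "i \<le> n" for i using nz sn that by auto
  note it = restarted_AM_iteration[OF am nz']
  have dir: "Suc j \<le> m \<and> norm (r (s + Suc j)) \<le> \<eta> * norm (r s) \<and>
      (p (s + Suc j), q (s + Suc j)) = am_sweep (am_test ty p q) p q s j
        (x (s + Suc j) - x (s + j), r (s + Suc j) - r (s + j)) \<and>
      \<tau> * \<bar>inner (am_test ty p q (Suc s)) (q (Suc s))\<bar>
        \<le> \<bar>inner (am_test ty p q (s + Suc j)) (q (s + Suc j))\<bar>" if "j < n" for j
    using it(1)[of "Suc j"] mm[of "Suc j"] that by simp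
  show "n \<le> m" using dir[of "n - 1"] by (cases n) auto
  show "norm (r (s + j)) \<le> \<eta> * norm (r s)" if "0 < j" "j \<le> n" for j
    using dir[of "j - 1"] that by (cases j) auto
  have test: "am_test ty (\<lambda>j. p (s + j)) (\<lambda>j. q (s + j)) = (\<lambda>j. am_test ty p q (s + j))"
    by (cases ty) (simp_all add: am_test_def)
  show "am_block ty n \<tau> (\<lambda>j. \<beta> (s + j)) (\<lambda>j. x (s + j)) (\<lambda>j. r (s + j)) (\<lambda>j. p (s + j)) (\<lambda>j. q (s + j))"
    unfolding am_block_def Let_def test am_sweep_shift[of _ _ _ s, symmetric]
  proof (intro conjI allI impI)
    fix j assume "j < n"
    with dir[of j] show "(p (s + Suc j), q (s + Suc j)) = am_sweep (am_test ty p q) p q s j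
        (x (s + Suc j) - x (s + j), r (s + Suc j) - r (s + j))"
      and "\<tau> * \<bar>inner (am_test ty p q (s + 1)) (q (s + 1))\<bar>
        \<le> \<bar>inner (am_test ty p q (s + Suc j)) (q (s + Suc j))\<bar>" by simp_all
  next
    fix j assume "j \<le> n"
    with it(2)[of j] mm[of j] show "x (s + Suc j) = (case am_sweep (am_test ty p q) p q s j (x (s + j), r (s + j))
        of (xbar, rbar) \<Rightarrow> xbar + \<beta> (s + j) *\<^sub>R rbar)" by (simp add: Let_def)
  qed
qed

section \<open>Convergence of trajectories\<close>

context am_problem
begin

definition trajectory :: "am_type \<Rightarrow> nat \<Rightarrow> real \<Rightarrow> real \<Rightarrow> (nat \<Rightarrow> real) \<Rightarrow> (nat \<Rightarrow> real^'n) \<Rightarrow>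
    (nat \<Rightarrow> real^'n) \<Rightarrow> (nat \<Rightarrow> real^'n) \<Rightarrow> (nat \<Rightarrow> real^'n) \<Rightarrow> (nat \<Rightarrow> nat) \<Rightarrow> nat \<Rightarrow> bool" where
  "trajectory ty m \<eta> \<eta>0 \<beta> x r p q mm k \<longleftrightarrow>
     (\<forall>j. \<beta> j \<in> {\<beta>lo..\<beta>hi}) \<and> restarted_AM ty g m \<tau> \<eta> \<beta> x r p q mm \<and>
     (\<forall>j\<le>k. r j \<noteq> 0) \<and> (\<forall>j\<le>k. norm (r j) \<le> \<eta>0 * norm (r 0))"

lemma trajectory_prefix: "trajectory ty m \<eta> \<eta>0 \<beta> x r p q mm k \<Longrightarrow> j \<le> k \<Longrightarrow>
    trajectory ty m \<eta> \<eta>0 \<beta> x r p q mm j"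
  by (simp add: trajectory_def)

text \<open>The two bounds on \<open>x s - xs\<close> serve the induction for contractive trajectories, where the quadratic
  term has to be compared with the residual at the restart.\<close>

definition step_estimate :: "am_type \<Rightarrow> real \<Rightarrow> (nat \<Rightarrow> real) \<Rightarrow> (nat \<Rightarrow> real^'n) \<Rightarrow>
    (nat \<Rightarrow> real^'n) \<Rightarrow> (nat \<Rightarrow> nat) \<Rightarrow> nat \<Rightarrow> bool" where
  "step_estimate ty C \<beta> x r mm k \<longleftrightarrow>
     (\<exists>s. s + mm k = k \<and> norm (x s - xs) \<le> C * norm (x 0 - xs) \<and> norm (x s - xs) \<le> C * norm (r s) \<and>
       block_estimate ty (mm k) C (\<lambda>j. \<beta> (s + j)) (\<lambda>j. x (s + j)) (\<lambda>j. r (s + j)) \<and>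
       norm (r (Suc k) + A *v (x (Suc k) - xs)) \<le> C * (norm (x s - xs))\<^sup>2)"

text \<open>Along the trajectory the iterates stay in the ball where the block estimate applies. The block
  estimate bounds the next error crudely, which is enough to place the next iterate in the region
  where errors and residuals are comparable; there the hypothesis on the residuals replaces the crude
  bound by one that does not deteriorate from block to block.\<close>

lemma trajectory_estimate:
  assumes \<eta>: "0 < \<eta>" and \<eta>0: "0 < \<eta>0"
  obtains \<epsilon> C where "0 < \<epsilon>" "0 < C"
    "\<forall>\<beta> x r p q mm k. trajectory ty m \<eta> \<eta>0 \<beta> x r p q mm k \<longrightarrow> norm (x 0 - xs) \<le> \<epsilon>
      \<longrightarrow> step_estimate ty C \<beta> x r mm k"
proof -
  \<comment> \<open>In the ball of radius \<open>b\<close> errors and residuals are comparable. The constant \<open>D\<close> bounds errors by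
    the error at the restart of the block (via \<open>\<eta>\<close>), \<open>C0\<close> by the initial error (via \<open>\<eta>0\<close>).\<close>
  define b where "b = min \<rho> (\<mu> / \<kappa>)"
  define \<Lambda> where "\<Lambda> = L + \<mu> / 2"
  define D where "D = max 1 (2 / \<mu> * \<eta> * \<Lambda>)"
  define C0 where "C0 = max 1 (2 / \<mu> * \<eta>0 * \<Lambda>)"
  have b: "0 < b" and \<Lambda>: "0 < \<Lambda>" and D: "1 \<le> D" and C0: "1 \<le> C0"
    using pos by (auto simp: b_def \<Lambda>_def D_def C0_def)
  obtain \<delta> C where \<delta>: "0 < \<delta>" and C: "0 < C"
    and blk: "\<forall>n\<le>m. \<forall>\<beta> x r p q. admissible_block ty n D \<beta> x r p q \<longrightarrow> norm (x 0 - xs) \<le> \<delta>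
     \<longrightarrow> block_estimate ty n C \<beta> x r"
    using block_estimate_uniform[of m ty D] by (elim exE conjE)
  define \<epsilon> where "\<epsilon> = min (min b \<delta> / C0) (b / (C * C0))"
  define C' where "C' = max (max C C0) (max (2 / \<mu>) (\<kappa> / 2 * C\<^sup>2))"
  have \<epsilon>: "0 < \<epsilon>" using b \<delta> C C0 by (auto simp: \<epsilon>_def)
  have \<epsilon>1: "C0 * t \<le> b" "C0 * t \<le> \<delta>" "C * (C0 * t) \<le> b" if "t \<le> \<epsilon>" for t
    using that b \<delta> C C0 by (auto simp: \<epsilon>_def field_simps)
  have C': "0 < C'" "C \<le> C'" "C0 \<le> C'" "2 / \<mu> \<le> C'" "\<kappa> / 2 * C\<^sup>2 \<le> C'"
    using C by (auto simp: C'_def less_max_iff_disj)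
  have lower: "norm (y - xs) \<le> 2 / \<mu> * norm (g y - y)" if "norm (y - xs) \<le> b" for y
    using residual_bounds(1)[of y] that pos by (simp add: b_def field_simps)
  have upper: "norm (g y - y) \<le> \<Lambda> * norm (y - xs)" if "norm (y - xs) \<le> b" for y
    using residual_bounds(2)[of y] that by (simp add: b_def \<Lambda>_def)
  have main: "step_estimate ty C' \<beta> x r mm k \<and> norm (x (Suc k) - xs) \<le> b"
    if tr: "trajectory ty m \<eta> \<eta>0 \<beta> x r p q mm k" and x0: "norm (x 0 - xs) \<le> \<epsilon>"
      and errs: "\<forall>i\<le>k. norm (x i - xs) \<le> C0 * norm (x 0 - xs)" for \<beta> x r p q mm k
  proof -
    have am: "restarted_AM ty g m \<tau> \<eta> \<beta> x r p q mm" and nz: "\<forall>j\<le>k. r j \<noteq> 0"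
      and bet: "\<forall>j. \<beta> j \<in> {\<beta>lo..\<beta>hi}"
      using tr unfolding trajectory_def by blast+
    define s where "s = k - mm k"
    have s: "s + mm k = k" using restarted_AM_depth(1)[OF am nz] by (simp add: s_def)
    have r: "r j = g (x j) - x j" for j using am by (simp add: restarted_AM_def Let_def)
    have small: "norm (x i - xs) \<le> b" "norm (x i - xs) \<le> \<delta>" if "i \<le> k" for i
      using errs that \<epsilon>1[OF x0] order_trans by blast+
    have xs_ne: "x s \<noteq> xs"
    proof
      assume "x s = xs"
      then have "r s = 0" using r[of s] residual_at_solution by simp
      with nz s show False by auto
    qed
    have "admissible_block ty (mm k) D (\<lambda>j. \<beta> (s + j)) (\<lambda>j. x (s + j)) (\<lambda>j. r (s + j))
        (\<lambda>j. p (s + j)) (\<lambda>j. q (s + j))"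
      unfolding admissible_block_def
    proof (intro conjI allI impI)
      show "am_block ty (mm k) \<tau> (\<lambda>j. \<beta> (s + j)) (\<lambda>j. x (s + j)) (\<lambda>j. r (s + j))
        (\<lambda>j. p (s + j)) (\<lambda>j. q (s + j))"
        unfolding s_def by (rule restarted_AM_block(3)[OF am nz])
      show "x (s + 0) \<noteq> xs" using xs_ne by simp
      fix j assume j: "j \<le> mm k"
      show "norm (x (s + j) - xs) \<le> D * norm (x (s + 0) - xs)"
      proof (cases "j = 0")
        case True
        then show ?thesis using mult_right_mono[OF D, of "norm (x s - xs)"] by simp
      next
        case False
        have "norm (x (s + j) - xs) \<le> 2 / \<mu> * norm (r (s + j))"
          using lower[OF small(1)] j s r by simp
        also have "\<dots> \<le> 2 / \<mu> * (\<eta> * norm (r s))"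
          using restarted_AM_block(2)[OF am nz, of j, folded s_def] False j pos
          by (intro mult_left_mono) auto
        also have "\<dots> \<le> 2 / \<mu> * (\<eta> * (\<Lambda> * norm (x s - xs)))"
          using upper[OF small(1), of s] s r \<eta> pos by (intro mult_left_mono) auto
        also have "\<dots> = (2 / \<mu> * \<eta> * \<Lambda>) * norm (x s - xs)" by simp
        also have "\<dots> \<le> D * norm (x s - xs)" by (intro mult_right_mono) (auto simp: D_def)
        finally show ?thesis by simp
      qed
    qed (use bet r in auto)
    moreover have "mm k \<le> m" by (rule restarted_AM_block(1)[OF am nz])
    moreover have "norm (x (s + 0) - xs) \<le> \<delta>" using small(2)[of s] s by simp
    ultimately have be: "block_estimate ty (mm k) C (\<lambda>j. \<beta> (s + j)) (\<lambda>j. x (s + j)) (\<lambda>j. r (s + j))"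
      using blk by blast
    then have nxt: "norm (x (Suc k) - xs) \<le> C * norm (x s - xs)"
      using s by (simp add: block_estimate_def)
    also have "\<dots> \<le> C * (C0 * norm (x 0 - xs))"
      using errs s C by (intro mult_left_mono) auto
    also have "\<dots> \<le> b" by (rule \<epsilon>1(3)[OF x0])
    finally have nxt_b: "norm (x (Suc k) - xs) \<le> b" .
    have "norm (r (Suc k) + A *v (x (Suc k) - xs)) \<le> \<kappa> / 2 * (norm (x (Suc k) - xs))\<^sup>2"
      unfolding r by (rule model) (use nxt_b in \<open>simp add: b_def\<close>)
    also have "\<dots> \<le> \<kappa> / 2 * (C * norm (x s - xs))\<^sup>2"
      using nxt pos by (intro mult_left_mono power_mono) auto
    also have "\<dots> = (\<kappa> / 2 * C\<^sup>2) * (norm (x s - xs))\<^sup>2" by (simp add: power_mult_distrib)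
    also have "\<dots> \<le> C' * (norm (x s - xs))\<^sup>2" using C'(5) by (intro mult_right_mono) auto
    finally have res: "norm (r (Suc k) + A *v (x (Suc k) - xs)) \<le> C' * (norm (x s - xs))\<^sup>2" .
    have "norm (x s - xs) \<le> C0 * norm (x 0 - xs)" using errs s by auto
    also have "\<dots> \<le> C' * norm (x 0 - xs)" using C'(3) by (intro mult_right_mono) auto
    finally have 1: "norm (x s - xs) \<le> C' * norm (x 0 - xs)" .
    have "norm (x s - xs) \<le> 2 / \<mu> * norm (r s)" using lower[OF small(1), of s] s r by simp
    also have "\<dots> \<le> C' * norm (r s)" using C'(4) by (intro mult_right_mono) auto
    finally have 2: "norm (x s - xs) \<le> C' * norm (r s)" .
    show ?thesis
      unfolding step_estimate_def
      using s 1 2 block_estimate_mono[OF be C'(2)] res nxt_b by blast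
  qed
  have errs: "\<forall>i\<le>k. norm (x i - xs) \<le> C0 * norm (x 0 - xs)"
    if "trajectory ty m \<eta> \<eta>0 \<beta> x r p q mm k" and x0: "norm (x 0 - xs) \<le> \<epsilon>" for \<beta> x r p q mm k
    using that(1)
  proof (induction k)
    case 0
    show ?case using mult_right_mono[OF C0, of "norm (x 0 - xs)"] by simp
  next
    case (Suc k)
    have IH: "\<forall>i\<le>k. norm (x i - xs) \<le> C0 * norm (x 0 - xs)"
      by (rule Suc.IH[OF trajectory_prefix[OF Suc.prems]]) simp
    have r: "r j = g (x j) - x j" for j
      using Suc.prems by (simp add: trajectory_def restarted_AM_def Let_def)
    have "norm (x (Suc k) - xs) \<le> b"
      using main[OF trajectory_prefix[OF Suc.prems] x0 IH] by simp
    from lower[OF this] have "norm (x (Suc k) - xs) \<le> 2 / \<mu> * norm (r (Suc k))" by (simp add: r)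
    also have "\<dots> \<le> 2 / \<mu> * (\<eta>0 * norm (r 0))"
      using Suc.prems pos unfolding trajectory_def by (intro mult_left_mono) auto
    also have "\<dots> \<le> 2 / \<mu> * (\<eta>0 * (\<Lambda> * norm (x 0 - xs)))"
    proof -
      have "norm (x 0 - xs) \<le> C0 * norm (x 0 - xs)"
        using mult_right_mono[OF C0, of "norm (x 0 - xs)"] by simp
      then have "norm (x 0 - xs) \<le> b" using \<epsilon>1(1)[OF x0] by linarith
      from upper[OF this] show ?thesis using \<eta>0 pos by (intro mult_left_mono) (auto simp: r)
    qed
    also have "\<dots> = (2 / \<mu> * \<eta>0 * \<Lambda>) * norm (x 0 - xs)" by simp
    also have "\<dots> \<le> C0 * norm (x 0 - xs)" by (intro mult_right_mono) (auto simp: C0_def)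
    finally show ?case using IH by (auto simp: le_Suc_eq)
  qed
  have "\<forall>\<beta> x r p q mm k. trajectory ty m \<eta> \<eta>0 \<beta> x r p q mm k \<longrightarrow> norm (x 0 - xs) \<le> \<epsilon>
      \<longrightarrow> step_estimate ty C' \<beta> x r mm k"
    using main errs by blast
  with \<epsilon> C'(1) show ?thesis by (rule that)
qed

lemma step_estimate_residual:
  assumes "step_estimate Type_II C \<beta> x r mm k"
  shows "norm (r (Suc k)) \<le> spectral_norm (mat 1 - \<beta> k *\<^sub>R A) * krylov_min A (mm k) (r (k - mm k))
    + 2 * C * (norm (x (k - mm k) - xs))\<^sup>2"
proof -
  obtain s where s: "s + mm k = k"
    and be: "block_estimate Type_II (mm k) C (\<lambda>j. \<beta> (s + j)) (\<lambda>j. x (s + j)) (\<lambda>j. r (s + j))"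
    and res: "norm (r (Suc k) + A *v (x (Suc k) - xs)) \<le> C * (norm (x s - xs))\<^sup>2"
    using assms unfolding step_estimate_def by (elim exE conjE)
  have sk: "s = k - mm k" using s by simp
  have "norm (A *v (x (Suc k) - xs)) \<le> spectral_norm (mat 1 - \<beta> k *\<^sub>R A) * krylov_min A (mm k) (r s)
      + C * (norm (x s - xs))\<^sup>2"
    using be s by (simp add: block_estimate_def)
  moreover have "norm (r (Suc k)) \<le> norm (r (Suc k) + A *v (x (Suc k) - xs)) + norm (A *v (x (Suc k) - xs))"
    by (metis norm_triangle_ineq4 add_diff_cancel_right')
  ultimately show ?thesis using res unfolding sk by linarith
qed

lemma step_estimate_full:
  assumes "step_estimate ty C \<beta> x r mm k" "mm k = CARD('n)"
  shows "norm (x (Suc k) - xs) \<le> C * (norm (x (k - mm k) - xs))\<^sup>2"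
proof -
  obtain s where s: "s + mm k = k"
    and be: "block_estimate ty (mm k) C (\<lambda>j. \<beta> (s + j)) (\<lambda>j. x (s + j)) (\<lambda>j. r (s + j))"
    using assms unfolding step_estimate_def by (elim exE conjE)
  have "norm (x (s + Suc (mm k)) - xs) \<le> C * (norm (x (s + 0) - xs))\<^sup>2"
    using be assms(2) unfolding block_estimate_def by blast
  moreover have "s = k - mm k" using s by simp
  ultimately show ?thesis using s by simp
qed

lemma step_estimate_type_I:
  assumes "step_estimate Type_I C \<beta> x r mm k"
  shows "norm (x (Suc k) - xs) \<le> spectral_norm (mat 1 - \<beta> k *\<^sub>R A)
    * galerkin_factor A (mm k) (r (k - mm k)) * krylov_min A (mm k) (x (k - mm k) - xs)
    + C * (norm (x (k - mm k) - xs))\<^sup>2"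
proof -
  obtain s where s: "s + mm k = k"
    and be: "block_estimate Type_I (mm k) C (\<lambda>j. \<beta> (s + j)) (\<lambda>j. x (s + j)) (\<lambda>j. r (s + j))"
    using assms unfolding step_estimate_def by (elim exE conjE)
  have sk: "s = k - mm k" using s by simp
  have "norm (x (Suc k) - xs) \<le> spectral_norm (mat 1 - \<beta> k *\<^sub>R A)
    * (galerkin_factor A (mm k) (r s) * krylov_min A (mm k) (x s - xs)) + C * (norm (x s - xs))\<^sup>2"
    using be s by (simp add: block_estimate_def)
  then show ?thesis unfolding sk mult.assoc .
qed

text \<open>A uniform contraction \<open>\<theta> < 1\<close> makes the residuals bounded by the initial one, so this case
  reduces to the previous one with \<open>\<eta>\<^sub>0 = 1\<close>: the minimum is at most \<open>\<parallel>r\<^sub>s\<parallel>\<close>, and close to the solution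
  the quadratic term is at most \<open>(1 - \<theta>)\<parallel>r\<^sub>s\<parallel>\<close>.\<close>

lemma contractive_trajectory:
  assumes \<eta>: "0 < \<eta>" and \<theta>: "\<theta> < 1"
  obtains \<epsilon> C where "0 < \<epsilon>" "0 < C"
    "\<forall>\<beta> x r p q mm k. (\<forall>j. \<beta> j \<in> {\<beta>lo..\<beta>hi}) \<and> restarted_AM Type_II g m \<tau> \<eta> \<beta> x r p q mm \<and>
      norm (x 0 - xs) \<le> \<epsilon> \<and> (\<forall>j\<le>k. r j \<noteq> 0) \<and> (\<forall>j. spectral_norm (mat 1 - \<beta> j *\<^sub>R A) \<le> \<theta>)
      \<longrightarrow> step_estimate Type_II C \<beta> x r mm k"
proof -
  obtain \<epsilon> C where \<epsilon>: "0 < \<epsilon>" and C: "0 < C"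
    and est: "\<forall>\<beta> x r p q mm k. trajectory Type_II m \<eta> 1 \<beta> x r p q mm k \<longrightarrow> norm (x 0 - xs) \<le> \<epsilon>
      \<longrightarrow> step_estimate Type_II C \<beta> x r mm k"
    by (rule trajectory_estimate[OF \<eta> zero_less_one])
  define \<epsilon>' where "\<epsilon>' = min \<epsilon> ((1 - \<theta>) / (2 * C * C * C))"
  have \<epsilon>': "0 < \<epsilon>'" "\<epsilon>' \<le> \<epsilon>" using \<epsilon> C \<theta> by (auto simp: \<epsilon>'_def)
  have small: "2 * C * (C * t) * C \<le> 1 - \<theta>" if "t \<le> \<epsilon>'" for t
    using that C by (auto simp: \<epsilon>'_def field_simps)
  have tr: "trajectory Type_II m \<eta> 1 \<beta> x r p q mm k"
    if am: "restarted_AM Type_II g m \<tau> \<eta> \<beta> x r p q mm" and bet: "\<forall>j. \<beta> j \<in> {\<beta>lo..\<beta>hi}"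
      and x0: "norm (x 0 - xs) \<le> \<epsilon>'" and con: "\<forall>j. spectral_norm (mat 1 - \<beta> j *\<^sub>R A) \<le> \<theta>"
      and nz: "\<forall>j\<le>k. r j \<noteq> 0" for \<beta> x r p q mm k
    using nz
  proof (induction k)
    case 0
    with am bet show ?case by (simp add: trajectory_def)
  next
    case (Suc k)
    then have tr: "trajectory Type_II m \<eta> 1 \<beta> x r p q mm k" by simp
    have se: "step_estimate Type_II C \<beta> x r mm k" using est tr x0 \<epsilon>'(2) by (meson order_trans)
    then obtain s where s: "s + mm k = k" "norm (x s - xs) \<le> C * norm (x 0 - xs)"
      "norm (x s - xs) \<le> C * norm (r s)" unfolding step_estimate_def by (elim exE conjE)
    have sk: "k - mm k = s" using s(1) by simp
    have "norm (r (Suc k)) \<le> spectral_norm (mat 1 - \<beta> k *\<^sub>R A) * krylov_min A (mm k) (r s)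
        + 2 * C * (norm (x s - xs))\<^sup>2"
      using step_estimate_residual[OF se] unfolding sk .
    also have "\<dots> \<le> \<theta> * norm (r s) + (1 - \<theta>) * norm (r s)"
    proof (rule add_mono)
      show "spectral_norm (mat 1 - \<beta> k *\<^sub>R A) * krylov_min A (mm k) (r s) \<le> \<theta> * norm (r s)"
        using con krylov_min_le_norm krylov_min_nonneg order_trans[OF spectral_norm_nonneg]
        by (intro mult_mono) blast+
      have "2 * C * (norm (x s - xs))\<^sup>2 = 2 * C * norm (x s - xs) * norm (x s - xs)"
        by (simp add: power2_eq_square)
      also have "\<dots> \<le> 2 * C * (C * norm (x 0 - xs)) * (C * norm (r s))"
        using s C by (intro mult_mono) auto
      also have "\<dots> = (2 * C * (C * norm (x 0 - xs)) * C) * norm (r s)" by simp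
      also have "\<dots> \<le> (1 - \<theta>) * norm (r s)" by (intro mult_right_mono small x0) auto
      finally show "2 * C * (norm (x s - xs))\<^sup>2 \<le> (1 - \<theta>) * norm (r s)" .
    qed
    also have "\<dots> = norm (r s)" by (simp add: algebra_simps)
    also have "\<dots> \<le> norm (r 0)" using tr s(1) by (simp add: trajectory_def)
    finally have "norm (r (Suc k)) \<le> norm (r 0)" .
    with tr Suc.prems show ?case unfolding trajectory_def by (auto simp: le_Suc_eq)
  qed
  have "step_estimate Type_II C \<beta> x r mm k"
    if "(\<forall>j. \<beta> j \<in> {\<beta>lo..\<beta>hi}) \<and> restarted_AM Type_II g m \<tau> \<eta> \<beta> x r p q mm \<and>
      norm (x 0 - xs) \<le> \<epsilon>' \<and> (\<forall>j\<le>k. r j \<noteq> 0) \<and> (\<forall>j. spectral_norm (mat 1 - \<beta> j *\<^sub>R A) \<le> \<theta>)"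
    for \<beta> x r p q mm k
  proof -
    have "trajectory Type_II m \<eta> 1 \<beta> x r p q mm k" using that by (intro tr) (elim conjE; assumption)+
    moreover have "norm (x 0 - xs) \<le> \<epsilon>" using that \<epsilon>'(2) by linarith
    ultimately show ?thesis using est by blast
  qed
  then have "\<forall>\<beta> x r p q mm k. (\<forall>j. \<beta> j \<in> {\<beta>lo..\<beta>hi}) \<and> restarted_AM Type_II g m \<tau> \<eta> \<beta> x r p q mm \<and>
      norm (x 0 - xs) \<le> \<epsilon>' \<and> (\<forall>j\<le>k. r j \<noteq> 0) \<and> (\<forall>j. spectral_norm (mat 1 - \<beta> j *\<^sub>R A) \<le> \<theta>)
      \<longrightarrow> step_estimate Type_II C \<beta> x r mm k" by blast
  with \<epsilon>'(1) C show ?thesis by (rule that)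
qed

end

lemma jacobian_fixed_point_map:
  fixes h g :: "real^'n \<Rightarrow> real^'n"
  assumes h: "h = (\<lambda>x. x - g x)" and d: "h differentiable (at a)"
  shows "mat 1 - jacobian g (at a) = jacobian h (at a)"
proof -
  have "(h has_derivative (\<lambda>y. jacobian h (at a) *v y)) (at a)" using d by (simp add: jacobian_works)
  then have "((\<lambda>x. x - h x) has_derivative (\<lambda>y. y - jacobian h (at a) *v y)) (at a)"
    by (intro has_derivative_diff has_derivative_ident)
  moreover have "(\<lambda>x. x - h x) = g" by (simp add: h)
  ultimately have g: "(g has_derivative (\<lambda>y. y - jacobian h (at a) *v y)) (at a)" by simp
  then have "(g has_derivative (\<lambda>y. jacobian g (at a) *v y)) (at a)"
    using differentiableI jacobian_works by blast
  from has_derivative_unique[OF this g]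
  have "jacobian g (at a) *v y = y - jacobian h (at a) *v y" for y by meson
  then show ?thesis by (simp add: matrix_eq matrix_vector_mult_diff_rdistrib)
qed

theorem theorem4p5:
  fixes g h :: "real^'n \<Rightarrow> real^'n" and xs :: "real^'n" and A :: "real^'n^'n"
    and \<rho> \<kappa> \<mu> L \<tau> \<eta> \<eta>0 \<beta>lo \<beta>hi :: real and m :: nat
  assumes h_def: "h = (\<lambda>x. x - g x)"
    and H: "assumption_H h xs"
    and consts_H: "constants_H h xs \<rho> \<kappa> \<mu> L"
    and A_def: "A = mat 1 - jacobian g (at xs)"
    and m: "0 < m" "m \<le> CARD('n)"
    and \<tau>: "0 < \<tau>" "\<tau> < 1"
    and \<eta>: "0 < \<eta>"
    and \<eta>0: "0 < \<eta>0"
    and \<beta>: "0 < \<beta>lo" "0 < \<beta>hi"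
  shows
    \<comment> \<open>Part 1\<close>
    "(\<exists>\<epsilon>>0. \<exists>C>0. \<forall>\<beta> x r p q mm k.
        (\<forall>j. \<beta> j \<in> {\<beta>lo..\<beta>hi}) \<and>
        restarted_AM Type_I g m \<tau> \<eta> \<beta> x r p q mm \<and>
        norm (x 0 - xs) \<le> \<epsilon> \<and> (\<forall>j\<le>k. r j \<noteq> 0) \<and>
        (\<forall>j\<le>k. norm (r j) \<le> \<eta>0 * norm (r 0))
        \<longrightarrow>
        (let s = k - mm k;
             K = krylov A (mm k) (r s);
             \<pi> = orth_projector K;
             Ak = \<pi> ** A ** \<pi>;
             \<theta>k = spectral_norm (mat 1 - \<beta> k *\<^sub>R A);
             \<gamma>k = spectral_norm (\<pi> ** A ** (mat 1 - \<pi>));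
             \<kappa>k = onorm_on K (inv_into K ((*v) Ak))
         in bij_betw ((*v) Ak) K K \<and> \<gamma>k \<le> L \<and> \<kappa>k \<le> 1 / \<mu> \<and>
            norm (x (Suc k) - xs)
              \<le> \<theta>k * sqrt (1 + \<gamma>k\<^sup>2 * \<kappa>k\<^sup>2) * krylov_min A (mm k) (x s - xs)
                 + \<kappa> * (C * (norm (x s - xs))\<^sup>2)))
    \<and>
    \<comment> \<open>Part 2, residuals bounded by the initial one\<close>
    (\<exists>\<epsilon>>0. \<exists>C>0. \<forall>\<beta> x r p q mm k.
        (\<forall>j. \<beta> j \<in> {\<beta>lo..\<beta>hi}) \<and>
        restarted_AM Type_II g m \<tau> \<eta> \<beta> x r p q mm \<and>
        norm (x 0 - xs) \<le> \<epsilon> \<and> (\<forall>j\<le>k. r j \<noteq> 0) \<and>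
        (\<forall>j\<le>k + 1. norm (r j) \<le> \<eta>0 * norm (r 0))
        \<longrightarrow>
        norm (r (Suc k))
          \<le> spectral_norm (mat 1 - \<beta> k *\<^sub>R A) * krylov_min A (mm k) (r (k - mm k))
             + \<kappa> * (C * (norm (x (k - mm k) - xs))\<^sup>2))
    \<and>
    \<comment> \<open>Part 2, alternative assumptions\<close>
    (\<forall>\<theta>. sqrt (1 - \<mu>\<^sup>2 / L\<^sup>2) \<le> \<theta> \<and> \<theta> < 1 \<longrightarrow>
      (\<exists>\<epsilon>>0. \<exists>C>0. \<forall>\<beta> x r p q mm k.
        (\<forall>j. \<beta> j \<in> {\<beta>lo..\<beta>hi}) \<and>
        restarted_AM Type_II g m \<tau> \<eta> \<beta> x r p q mm \<and>
        norm (x 0 - xs) \<le> \<epsilon> \<and> (\<forall>j\<le>k. r j \<noteq> 0) \<and>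
        (\<forall>j. spectral_norm (mat 1 - \<beta> j *\<^sub>R A) \<le> \<theta>)
        \<longrightarrow>
        norm (r (Suc k))
          \<le> spectral_norm (mat 1 - \<beta> k *\<^sub>R A) * krylov_min A (mm k) (r (k - mm k))
             + \<kappa> * (C * (norm (x (k - mm k) - xs))\<^sup>2)))
    \<and>
    \<comment> \<open>Part 3, Type-I\<close>
    (\<exists>\<epsilon>>0. \<exists>C>0. \<forall>\<beta> x r p q mm k.
        (\<forall>j. \<beta> j \<in> {\<beta>lo..\<beta>hi}) \<and>
        restarted_AM Type_I g m \<tau> \<eta> \<beta> x r p q mm \<and>
        norm (x 0 - xs) \<le> \<epsilon> \<and> (\<forall>j\<le>k. r j \<noteq> 0) \<and>
        (\<forall>j\<le>k. norm (r j) \<le> \<eta>0 * norm (r 0)) \<and>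
        mm k = CARD('n)
        \<longrightarrow> norm (x (Suc k) - xs) \<le> \<kappa> * (C * (norm (x (k - mm k) - xs))\<^sup>2))
    \<and>
    \<comment> \<open>Part 3, Type-II, residuals bounded by the initial one\<close>
    (\<exists>\<epsilon>>0. \<exists>C>0. \<forall>\<beta> x r p q mm k.
        (\<forall>j. \<beta> j \<in> {\<beta>lo..\<beta>hi}) \<and>
        restarted_AM Type_II g m \<tau> \<eta> \<beta> x r p q mm \<and>
        norm (x 0 - xs) \<le> \<epsilon> \<and> (\<forall>j\<le>k. r j \<noteq> 0) \<and>
        (\<forall>j\<le>k + 1. norm (r j) \<le> \<eta>0 * norm (r 0)) \<and>
        mm k = CARD('n)
        \<longrightarrow> norm (x (Suc k) - xs) \<le> \<kappa> * (C * (norm (x (k - mm k) - xs))\<^sup>2))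
    \<and>
    \<comment> \<open>Part 3, Type-II, alternative assumptions\<close>
    (\<forall>\<theta>. sqrt (1 - \<mu>\<^sup>2 / L\<^sup>2) \<le> \<theta> \<and> \<theta> < 1 \<longrightarrow>
      (\<exists>\<epsilon>>0. \<exists>C>0. \<forall>\<beta> x r p q mm k.
        (\<forall>j. \<beta> j \<in> {\<beta>lo..\<beta>hi}) \<and>
        restarted_AM Type_II g m \<tau> \<eta> \<beta> x r p q mm \<and>
        norm (x 0 - xs) \<le> \<epsilon> \<and> (\<forall>j\<le>k. r j \<noteq> 0) \<and>
        (\<forall>j. spectral_norm (mat 1 - \<beta> j *\<^sub>R A) \<le> \<theta>) \<and>
        mm k = CARD('n)
        \<longrightarrow> norm (x (Suc k) - xs) \<le> \<kappa> * (C * (norm (x (k - mm k) - xs))\<^sup>2)))"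
proof -
  have diff: "h differentiable (at xs)"
    using H unfolding assumption_H_def differentiable_on_def by (metis at_within_open)
  have hA: "jacobian h (at xs) = A"
    unfolding A_def by (rule jacobian_fixed_point_map[OF h_def diff, symmetric])
  have pos: "0 < \<rho>" "0 < \<kappa>" "0 < \<mu>" "0 < L"
    and ball: "\<And>x y. x \<in> cball xs \<rho> \<Longrightarrow> \<mu> * (norm y)\<^sup>2 \<le> inner y (jacobian h (at x) *v y) \<and>
      norm (jacobian h (at x) *v y) \<le> L * norm y \<and>
      norm (h x - jacobian h (at xs) *v (x - xs)) \<le> \<kappa> / 2 * (norm (x - xs))\<^sup>2"
    using consts_H unfolding constants_H_def by blast+
  interpret am_problem g xs A \<rho> \<kappa> \<mu> L \<tau> \<beta>lo \<beta>hi
  proof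
    show "\<mu> * (norm y)\<^sup>2 \<le> inner y (A *v y)" "norm (A *v y) \<le> L * norm y" for y
      using ball[of xs y] pos(1) by (simp_all add: hA)
    show "norm (g x - x + A *v (x - xs)) \<le> \<kappa> / 2 * (norm (x - xs))\<^sup>2" if "norm (x - xs) \<le> \<rho>" for x
    proof -
      have "x \<in> cball xs \<rho>" using that by (simp add: dist_norm norm_minus_commute)
      then have "norm (h x - A *v (x - xs)) \<le> \<kappa> / 2 * (norm (x - xs))\<^sup>2" using ball hA by metis
      moreover have "g x - x + A *v (x - xs) = - (h x - A *v (x - xs))" by (simp add: h_def)
      ultimately show ?thesis by (metis norm_minus_cancel)
    qed
  qed (use pos \<tau> \<beta> in auto)
  \<comment> \<open>The theorem displays the factor \<open>\<kappa>\<close> of the quadratic term separately.\<close>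
  have scale: "\<kappa> * (C / \<kappa> * t) = C * t" for C t :: real using pos(2) by simp
  obtain \<epsilon>1 C1 where e1: "0 < \<epsilon>1" "0 < C1"
    "\<forall>\<beta> x r p q mm k. trajectory Type_I m \<eta> \<eta>0 \<beta> x r p q mm k \<longrightarrow> norm (x 0 - xs) \<le> \<epsilon>1
      \<longrightarrow> step_estimate Type_I C1 \<beta> x r mm k"
    by (rule trajectory_estimate[OF \<eta> \<eta>0])
  obtain \<epsilon>2 C2 where e2: "0 < \<epsilon>2" "0 < C2"
    "\<forall>\<beta> x r p q mm k. trajectory Type_II m \<eta> \<eta>0 \<beta> x r p q mm k \<longrightarrow> norm (x 0 - xs) \<le> \<epsilon>2
      \<longrightarrow> step_estimate Type_II C2 \<beta> x r mm k"
    by (rule trajectory_estimate[OF \<eta> \<eta>0])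
  have t1: "step_estimate Type_I C1 \<beta> x r mm k"
    if "\<forall>j. \<beta> j \<in> {\<beta>lo..\<beta>hi}" "restarted_AM Type_I g m \<tau> \<eta> \<beta> x r p q mm" "norm (x 0 - xs) \<le> \<epsilon>1"
      "\<forall>j\<le>k. r j \<noteq> 0" "\<forall>j\<le>k. norm (r j) \<le> \<eta>0 * norm (r 0)" for \<beta> x r p q mm k
    using e1(3) that unfolding trajectory_def by blast
  have t2: "step_estimate Type_II C2 \<beta> x r mm k"
    if "\<forall>j. \<beta> j \<in> {\<beta>lo..\<beta>hi}" "restarted_AM Type_II g m \<tau> \<eta> \<beta> x r p q mm" "norm (x 0 - xs) \<le> \<epsilon>2"
      "\<forall>j\<le>k. r j \<noteq> 0" "\<forall>j\<le>k + 1. norm (r j) \<le> \<eta>0 * norm (r 0)" for \<beta> x r p q mm k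
  proof -
    have "\<forall>j\<le>k. norm (r j) \<le> \<eta>0 * norm (r 0)" using that(5) by simp
    with e2(3) that(1-4) show ?thesis unfolding trajectory_def by blast
  qed
  have part1: "let s = k - mm k;
             K = krylov A (mm k) (r s);
             \<pi> = orth_projector K;
             Ak = \<pi> ** A ** \<pi>;
             \<theta>k = spectral_norm (mat 1 - \<beta> k *\<^sub>R A);
             \<gamma>k = spectral_norm (\<pi> ** A ** (mat 1 - \<pi>));
             \<kappa>k = onorm_on K (inv_into K ((*v) Ak))
         in bij_betw ((*v) Ak) K K \<and> \<gamma>k \<le> L \<and> \<kappa>k \<le> 1 / \<mu> \<and>
            norm (x (Suc k) - xs)
              \<le> \<theta>k * sqrt (1 + \<gamma>k\<^sup>2 * \<kappa>k\<^sup>2) * krylov_min A (mm k) (x s - xs)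
                 + \<kappa> * (C1 / \<kappa> * (norm (x s - xs))\<^sup>2)"
    if "step_estimate Type_I C1 \<beta> x r mm k" for \<beta> x r mm k
    using step_estimate_type_I[OF that] compression_bij[OF subspace_krylov pos(3) coercive]
      compression_inverse_bounds(2)[OF subspace_krylov pos(3) coercive]
      spectral_norm_off_diagonal_le[OF subspace_krylov A_le less_imp_le[OF pos(4)]]
    unfolding Let_def scale galerkin_factor_def by blast
  have part2: "norm (r (Suc k))
      \<le> spectral_norm (mat 1 - \<beta> k *\<^sub>R A) * krylov_min A (mm k) (r (k - mm k))
        + \<kappa> * (2 * C / \<kappa> * (norm (x (k - mm k) - xs))\<^sup>2)"
    if "step_estimate Type_II C \<beta> x r mm k" for C \<beta> x r mm k
    using step_estimate_residual[OF that] unfolding scale .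
  have part3: "norm (x (Suc k) - xs) \<le> \<kappa> * (C / \<kappa> * (norm (x (k - mm k) - xs))\<^sup>2)"
    if "step_estimate ty C \<beta> x r mm k" "mm k = CARD('n)" for ty C \<beta> x r mm k
    using step_estimate_full[OF that] unfolding scale .
  have quot: "0 < C / \<kappa>" "0 < 2 * C / \<kappa>" if "0 < C" for C using that pos(2) by simp_all
  have witness: "\<exists>\<epsilon>>0. \<exists>C>0. \<Phi> \<epsilon> C" if "0 < \<epsilon>" "0 < C" "\<Phi> \<epsilon> C"
    for \<epsilon> C :: real and \<Phi> using that by blast
  show ?thesis
  proof (intro conjI, goal_cases)
    case 1
    show ?case
      by (rule witness[OF e1(1) quot(1)[OF e1(2)]], intro allI impI, elim conjE, rule part1, rule t1)
  next
    case 2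
    show ?case
      by (rule witness[OF e2(1) quot(2)[OF e2(2)]], intro allI impI, elim conjE, rule part2, rule t2)
  next
    case 3
    show ?case
    proof (intro allI impI)
      fix \<theta> assume "sqrt (1 - \<mu>\<^sup>2 / L\<^sup>2) \<le> \<theta> \<and> \<theta> < 1"
      then have "\<theta> < 1" by simp
      then obtain \<epsilon> C where e: "0 < \<epsilon>" "0 < C"
        and t: "\<forall>\<beta> x r p q mm k. (\<forall>j. \<beta> j \<in> {\<beta>lo..\<beta>hi}) \<and>
          restarted_AM Type_II g m \<tau> \<eta> \<beta> x r p q mm \<and> norm (x 0 - xs) \<le> \<epsilon> \<and>
          (\<forall>j\<le>k. r j \<noteq> 0) \<and> (\<forall>j. spectral_norm (mat 1 - \<beta> j *\<^sub>R A) \<le> \<theta>)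
          \<longrightarrow> step_estimate Type_II C \<beta> x r mm k"
        by (rule contractive_trajectory[OF \<eta>])
      show "\<exists>\<epsilon>>0. \<exists>C>0. \<forall>\<beta> x r p q mm k.
        (\<forall>j. \<beta> j \<in> {\<beta>lo..\<beta>hi}) \<and>
        restarted_AM Type_II g m \<tau> \<eta> \<beta> x r p q mm \<and>
        norm (x 0 - xs) \<le> \<epsilon> \<and> (\<forall>j\<le>k. r j \<noteq> 0) \<and>
        (\<forall>j. spectral_norm (mat 1 - \<beta> j *\<^sub>R A) \<le> \<theta>)
        \<longrightarrow>
        norm (r (Suc k))
          \<le> spectral_norm (mat 1 - \<beta> k *\<^sub>R A) * krylov_min A (mm k) (r (k - mm k))
             + \<kappa> * (C * (norm (x (k - mm k) - xs))\<^sup>2)"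
        by (rule witness[OF e(1) quot(2)[OF e(2)]], intro allI impI, rule part2, rule t[rule_format])
    qed
  next
    case 4
    show ?case
      by (rule witness[OF e1(1) quot(1)[OF e1(2)]], intro allI impI, elim conjE, rule part3, rule t1)
  next
    case 5
    show ?case
      by (rule witness[OF e2(1) quot(1)[OF e2(2)]], intro allI impI, elim conjE, rule part3, rule t2)
  next
    case 6
    show ?case
    proof (intro allI impI)
      fix \<theta> assume "sqrt (1 - \<mu>\<^sup>2 / L\<^sup>2) \<le> \<theta> \<and> \<theta> < 1"
      then have "\<theta> < 1" by simp
      then obtain \<epsilon> C where e: "0 < \<epsilon>" "0 < C"
        and t: "\<forall>\<beta> x r p q mm k. (\<forall>j. \<beta> j \<in> {\<beta>lo..\<beta>hi}) \<and>
          restarted_AM Type_II g m \<tau> \<eta> \<beta> x r p q mm \<and> norm (x 0 - xs) \<le> \<epsilon> \<and>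
          (\<forall>j\<le>k. r j \<noteq> 0) \<and> (\<forall>j. spectral_norm (mat 1 - \<beta> j *\<^sub>R A) \<le> \<theta>)
          \<longrightarrow> step_estimate Type_II C \<beta> x r mm k"
        by (rule contractive_trajectory[OF \<eta>])
      show "\<exists>\<epsilon>>0. \<exists>C>0. \<forall>\<beta> x r p q mm k.
        (\<forall>j. \<beta> j \<in> {\<beta>lo..\<beta>hi}) \<and>
        restarted_AM Type_II g m \<tau> \<eta> \<beta> x r p q mm \<and>
        norm (x 0 - xs) \<le> \<epsilon> \<and> (\<forall>j\<le>k. r j \<noteq> 0) \<and>
        (\<forall>j. spectral_norm (mat 1 - \<beta> j *\<^sub>R A) \<le> \<theta>) \<and>
        mm k = CARD('n)
        \<longrightarrow> norm (x (Suc k) - xs) \<le> \<kappa> * (C * (norm (x (k - mm k) - xs))\<^sup>2)"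
      proof (rule witness[OF e(1) quot(1)[OF e(2)]], intro allI impI, elim conjE, rule part3)
        fix \<beta> x r p q mm k
        assume "\<forall>j. \<beta> j \<in> {\<beta>lo..\<beta>hi}" "restarted_AM Type_II g m \<tau> \<eta> \<beta> x r p q mm"
          "norm (x 0 - xs) \<le> \<epsilon>" "\<forall>j\<le>k. r j \<noteq> 0"
          "\<forall>j. spectral_norm (mat 1 - \<beta> j *\<^sub>R A) \<le> \<theta>"
        with t show "step_estimate Type_II C \<beta> x r mm k" by blast
      qed
    qed
  qed
qed

end
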